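(* Let $(\mathcal{C},\cdot,n)$ be the split Cayley algebra over a field $\mathbb{F}$ of characteristic $3$, with canonical basis $e_1,e_2,u_1,u_2,u_3,v_1,v_2,v_3$. (1) For the order $3$ automorphism $\tau$ of $(\mathcal{C},\cdot,n)$ determined by $\tau(u_i)=u_i$, $i=1,2$, $\tau(u_3)=u_3+u_2$, the centralizer $\mathbf{Cent}_{\mathbf{Aut}(\mathcal{C},\cdot,n)}(\tau)$ is the derived subgroup of the parabolic subgroup $\mathbf{P}_{\{\varepsilon_1\}}$. (2) For the order $3$ automorphism $\tau$ of $(\mathcal{C},\cdot,n)$ determined by $\tau(u_i)=u_i$, $i=1,2$, $\tau(u_3)=u_3+v_3-(e_1-e_2)$, the centralizer $\mathbf{Cent}_{\mathbf{Aut}(\mathcal{C},\cdot,n)}(\tau)$ is the derived subgroup of the parabolic subgroup $\mathbf{P}_{\{\varepsilon_2-\varepsilon_1\}}$.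
   Context: The split Cayley algebra is the $8$-dimensional unital composition algebra with canonical basis $e_1,e_2,u_1,u_2,u_3,v_1,v_2,v_3$ where $e_1,e_2$ are orthogonal idempotents with $e_1+e_2=1$, $e_1u_i=u_i=u_ie_2$, $e_2v_i=v_i=v_ie_1$, $e_2u_i=u_ie_1=e_1v_i=v_ie_2=0$, $u_iu_{i+1}=v_{i+2}=-u_{i+1}u_i$, $v_iv_{i+1}=u_{i+2}=-v_{i+1}v_i$ (indices modulo $3$), $u_i^2=v_i^2=0$, $u_iv_i=-e_1$, $v_iu_i=-e_2$, $u_iv_j=v_iu_j=0$ for $i\ne j$, and $n(\alpha e_1+\beta e_2+\sum\mu_iu_i+\sum\nu_iv_i)=\alpha\beta+\sum\mu_i\nu_i$. The $u_i$ generate the algebra, so an automorphism is determined by its values on them. Algebraic groups are affine group schemes of finite type over $\mathbb{F}$, viewed as functors on unital commutative associative $\mathbb{F}$-algebras $R$. $\mathbf{Aut}(\mathcal{C},\cdot,n)(R)$ is the group of automorphisms of $\mathcal{C}\otimes_{\mathbb{F}}R$ over $R$ (a split simple group of type $G_2$), and the centralizer of $\tau$ is taken scheme-theoretically ($R$-points commuting with $\tau\otimes\mathrm{id}_R$). $\mathbf{T}$ is the maximal torus of automorphisms fixing $e_1,e_2$ and acting by $u_i\mapsto\alpha_iu_i$, $v_i\mapsto\alpha_i^{-1}v_i$, $\alpha_1\alpha_2\alpha_3=1$; $\varepsilon_i$ is the character $\alpha\mapsto\alpha_i$ (additive notation, $\varepsilon_1+\varepsilon_2+\varepsilon_3=0$).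 The root system is $\{\pm\varepsilon_i,\ \varepsilon_i-\varepsilon_j: i\neq j\}$, with simple roots $\varepsilon_1,\ \varepsilon_2-\varepsilon_1$ and positive roots $\Phi^+=\{\varepsilon_1,\varepsilon_2,-\varepsilon_3,\varepsilon_2-\varepsilon_1,\varepsilon_2-\varepsilon_3,\varepsilon_1-\varepsilon_3\}$. For a root $\alpha$, $\mathbf{U}_\alpha\simeq\mathbf{G}_a$ is the root subgroup; in characteristic $3$ it is $\{\exp(tx_\alpha)\}$, $\exp(\delta)=\mathrm{id}+\delta+\frac12\delta^2$, with $x_{\varepsilon_i-\varepsilon_j}=[L_{u_i},R_{v_j}]$, $x_{\varepsilon_i}=\mathrm{ad}_{u_i}$, $x_{-\varepsilon_i}=-\mathrm{ad}_{v_i}$, where $L,R$ are left and right multiplications and $\mathrm{ad}_x(y)=x\cdot y-y\cdot x$. For a simple root $\gamma$, $\mathbf{P}_{\{\gamma\}}$ is the parabolic subgroup generated by $\mathbf{T}$, $\mathbf{U}_{-\gamma}$ and the $\mathbf{U}_\alpha$, $\alpha\in\Phi^+$. *)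

theory Defs
  imports
    "HOL-Algebra.Algebraic_Closure_Type"
    "HOL-Algebra.Bij"
    "HOL-Library.Numeral_Type"
    "HOL-Library.Poly_Mapping"
begin

section \<open>The split Cayley algebra\<close>

text \<open>The index type \<^typ>\<open>3\<close> is the ring of integers modulo 3, so that 3 = 0 and
  i + 1, i + 2 are the cyclic successors of i.\<close>

datatype cay_basis = CE1 | CE2 | CU 3 | CV 3

type_synonym 'r cay_map = "(cay_basis \<Rightarrow> 'r) \<Rightarrow> (cay_basis \<Rightarrow> 'r)"

definition cay_mult ::
    "'r ring \<Rightarrow> (cay_basis \<Rightarrow> 'r) \<Rightarrow> (cay_basis \<Rightarrow> 'r) \<Rightarrow> (cay_basis \<Rightarrow> 'r)" where
  "cay_mult R x y = (\<lambda>c. case c of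
      CE1 \<Rightarrow> (x CE1 \<otimes>\<^bsub>R\<^esub> y CE1) \<ominus>\<^bsub>R\<^esub> (\<Oplus>\<^bsub>R\<^esub>i\<in>UNIV. x (CU i) \<otimes>\<^bsub>R\<^esub> y (CV i))
    | CE2 \<Rightarrow> (x CE2 \<otimes>\<^bsub>R\<^esub> y CE2) \<ominus>\<^bsub>R\<^esub> (\<Oplus>\<^bsub>R\<^esub>i\<in>UNIV. x (CV i) \<otimes>\<^bsub>R\<^esub> y (CU i))
    | CU k \<Rightarrow> ((x CE1 \<otimes>\<^bsub>R\<^esub> y (CU k)) \<oplus>\<^bsub>R\<^esub> (x (CU k) \<otimes>\<^bsub>R\<^esub> y CE2))
        \<oplus>\<^bsub>R\<^esub> ((x (CV (k + 1)) \<otimes>\<^bsub>R\<^esub> y (CV (k + 2))) \<ominus>\<^bsub>R\<^esub> (x (CV (k + 2)) \<otimes>\<^bsub>R\<^esub> y (CV (k + 1))))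
    | CV k \<Rightarrow> ((x CE2 \<otimes>\<^bsub>R\<^esub> y (CV k)) \<oplus>\<^bsub>R\<^esub> (x (CV k) \<otimes>\<^bsub>R\<^esub> y CE1))
        \<oplus>\<^bsub>R\<^esub> ((x (CU (k + 1)) \<otimes>\<^bsub>R\<^esub> y (CU (k + 2))) \<ominus>\<^bsub>R\<^esub> (x (CU (k + 2)) \<otimes>\<^bsub>R\<^esub> y (CU (k + 1)))))"

text \<open>The algebra over a commutative ring R, given by coordinates in the canonical basis. As the
  structure constants are integers, the algebra over R is the scalar extension to R of the algebra
  over the base field. The record type is that of modules with an additional
  product; the product is of course not associative.\<close>

definition cay :: "'r ring \<Rightarrow> ('r, cay_basis \<Rightarrow> 'r) module" where
  "cay R = \<lparr>carrier = UNIV \<rightarrow> carrier R,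
     monoid.mult = cay_mult R,
     monoid.one = (\<lambda>c. case c of CE1 \<Rightarrow> \<one>\<^bsub>R\<^esub> | CE2 \<Rightarrow> \<one>\<^bsub>R\<^esub> | CU i \<Rightarrow> \<zero>\<^bsub>R\<^esub> | CV i \<Rightarrow> \<zero>\<^bsub>R\<^esub>),
     ring.zero = (\<lambda>c. \<zero>\<^bsub>R\<^esub>),
     ring.add = (\<lambda>x y c. x c \<oplus>\<^bsub>R\<^esub> y c),
     module.smult = (\<lambda>r x c. r \<otimes>\<^bsub>R\<^esub> x c)\<rparr>"

definition cay_norm :: "'r ring \<Rightarrow> (cay_basis \<Rightarrow> 'r) \<Rightarrow> 'r" where
  "cay_norm R x = (x CE1 \<otimes>\<^bsub>R\<^esub> x CE2) \<oplus>\<^bsub>R\<^esub> (\<Oplus>\<^bsub>R\<^esub>i\<in>UNIV. x (CU i) \<otimes>\<^bsub>R\<^esub> x (CV i))"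

definition cb :: "'r ring \<Rightarrow> cay_basis \<Rightarrow> (cay_basis \<Rightarrow> 'r)" where
  "cb R b = (\<lambda>c. if c = b then \<one>\<^bsub>R\<^esub> else \<zero>\<^bsub>R\<^esub>)"

text \<open>The multiplication table of the canonical basis, as a check of \<^const>\<open>cay_mult\<close>.\<close>

lemma UNIV_3_eq: "(UNIV :: 3 set) = {1, 2, 3}"
proof -
  have "card {1, 2, 3 :: 3} = CARD(3)" by simp
  then show ?thesis by (metis card_eq_UNIV_imp_eq_UNIV finite)
qed

lemma index_3_cases: "i = 1 \<or> i = 2 \<or> i = 3" for i :: 3
  using UNIV_3_eq by blast

lemma (in cring) finsum_3:
  assumes "f \<in> UNIV \<rightarrow> carrier R"
  shows "finsum R f (UNIV :: 3 set) = f 1 \<oplus> (f 2 \<oplus> f 3)"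
  unfolding UNIV_3_eq using assms by (subst finsum_insert; auto simp: Pi_def)+

lemma index_3_add_1_eq_0: "i + 1 = 0 \<longleftrightarrow> i = 2" "1 + i = 0 \<longleftrightarrow> i = 2" for i :: 3
  using index_3_cases[of i] by auto

lemma cay_mult_table:
  fixes R :: "'r ring" and i j :: 3
  assumes "cring R"
  shows
    "cb R CE1 \<otimes>\<^bsub>cay R\<^esub> cb R CE1 = cb R CE1"
    "cb R CE2 \<otimes>\<^bsub>cay R\<^esub> cb R CE2 = cb R CE2"
    "cb R CE1 \<otimes>\<^bsub>cay R\<^esub> cb R CE2 = \<zero>\<^bsub>cay R\<^esub>"
    "cb R CE2 \<otimes>\<^bsub>cay R\<^esub> cb R CE1 = \<zero>\<^bsub>cay R\<^esub>"
    "cb R CE1 \<oplus>\<^bsub>cay R\<^esub> cb R CE2 = \<one>\<^bsub>cay R\<^esub>"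
    "cb R CE1 \<otimes>\<^bsub>cay R\<^esub> cb R (CU i) = cb R (CU i)"
    "cb R (CU i) \<otimes>\<^bsub>cay R\<^esub> cb R CE2 = cb R (CU i)"
    "cb R CE2 \<otimes>\<^bsub>cay R\<^esub> cb R (CV i) = cb R (CV i)"
    "cb R (CV i) \<otimes>\<^bsub>cay R\<^esub> cb R CE1 = cb R (CV i)"
    "cb R CE2 \<otimes>\<^bsub>cay R\<^esub> cb R (CU i) = \<zero>\<^bsub>cay R\<^esub>"
    "cb R (CU i) \<otimes>\<^bsub>cay R\<^esub> cb R CE1 = \<zero>\<^bsub>cay R\<^esub>"
    "cb R CE1 \<otimes>\<^bsub>cay R\<^esub> cb R (CV i) = \<zero>\<^bsub>cay R\<^esub>"
    "cb R (CV i) \<otimes>\<^bsub>cay R\<^esub> cb R CE2 = \<zero>\<^bsub>cay R\<^esub>"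
    "cb R (CU i) \<otimes>\<^bsub>cay R\<^esub> cb R (CU (i + 1)) = cb R (CV (i + 2))"
    "cb R (CU (i + 1)) \<otimes>\<^bsub>cay R\<^esub> cb R (CU i) = (\<ominus>\<^bsub>R\<^esub> \<one>\<^bsub>R\<^esub>) \<odot>\<^bsub>cay R\<^esub> cb R (CV (i + 2))"
    "cb R (CV i) \<otimes>\<^bsub>cay R\<^esub> cb R (CV (i + 1)) = cb R (CU (i + 2))"
    "cb R (CV (i + 1)) \<otimes>\<^bsub>cay R\<^esub> cb R (CV i) = (\<ominus>\<^bsub>R\<^esub> \<one>\<^bsub>R\<^esub>) \<odot>\<^bsub>cay R\<^esub> cb R (CU (i + 2))"
    "cb R (CU i) \<otimes>\<^bsub>cay R\<^esub> cb R (CU i) = \<zero>\<^bsub>cay R\<^esub>"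
    "cb R (CV i) \<otimes>\<^bsub>cay R\<^esub> cb R (CV i) = \<zero>\<^bsub>cay R\<^esub>"
    "cb R (CU i) \<otimes>\<^bsub>cay R\<^esub> cb R (CV i) = (\<ominus>\<^bsub>R\<^esub> \<one>\<^bsub>R\<^esub>) \<odot>\<^bsub>cay R\<^esub> cb R CE1"
    "cb R (CV i) \<otimes>\<^bsub>cay R\<^esub> cb R (CU i) = (\<ominus>\<^bsub>R\<^esub> \<one>\<^bsub>R\<^esub>) \<odot>\<^bsub>cay R\<^esub> cb R CE2"
    "i \<noteq> j \<Longrightarrow> cb R (CU i) \<otimes>\<^bsub>cay R\<^esub> cb R (CV j) = \<zero>\<^bsub>cay R\<^esub>"
    "i \<noteq> j \<Longrightarrow> cb R (CV i) \<otimes>\<^bsub>cay R\<^esub> cb R (CU j) = \<zero>\<^bsub>cay R\<^esub>"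
proof -
  interpret cring R by fact
  note d = cay_def cay_mult_def cb_def fun_eq_iff finsum_3 a_minus_def index_3_add_1_eq_0
  show "cb R CE1 \<otimes>\<^bsub>cay R\<^esub> cb R CE1 = cb R CE1"
      "cb R CE2 \<otimes>\<^bsub>cay R\<^esub> cb R CE2 = cb R CE2"
      "cb R CE1 \<otimes>\<^bsub>cay R\<^esub> cb R CE2 = \<zero>\<^bsub>cay R\<^esub>"
      "cb R CE2 \<otimes>\<^bsub>cay R\<^esub> cb R CE1 = \<zero>\<^bsub>cay R\<^esub>"
      "cb R CE1 \<oplus>\<^bsub>cay R\<^esub> cb R CE2 = \<one>\<^bsub>cay R\<^esub>"
      "cb R CE1 \<otimes>\<^bsub>cay R\<^esub> cb R (CU i) = cb R (CU i)"
      "cb R (CU i) \<otimes>\<^bsub>cay R\<^esub> cb R CE2 = cb R (CU i)"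
      "cb R CE2 \<otimes>\<^bsub>cay R\<^esub> cb R (CV i) = cb R (CV i)"
      "cb R (CV i) \<otimes>\<^bsub>cay R\<^esub> cb R CE1 = cb R (CV i)"
      "cb R CE2 \<otimes>\<^bsub>cay R\<^esub> cb R (CU i) = \<zero>\<^bsub>cay R\<^esub>"
      "cb R (CU i) \<otimes>\<^bsub>cay R\<^esub> cb R CE1 = \<zero>\<^bsub>cay R\<^esub>"
      "cb R CE1 \<otimes>\<^bsub>cay R\<^esub> cb R (CV i) = \<zero>\<^bsub>cay R\<^esub>"
      "cb R (CV i) \<otimes>\<^bsub>cay R\<^esub> cb R CE2 = \<zero>\<^bsub>cay R\<^esub>"
      "cb R (CU i) \<otimes>\<^bsub>cay R\<^esub> cb R (CU (i + 1)) = cb R (CV (i + 2))"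
      "cb R (CU (i + 1)) \<otimes>\<^bsub>cay R\<^esub> cb R (CU i) = (\<ominus>\<^bsub>R\<^esub> \<one>\<^bsub>R\<^esub>) \<odot>\<^bsub>cay R\<^esub> cb R (CV (i + 2))"
      "cb R (CV i) \<otimes>\<^bsub>cay R\<^esub> cb R (CV (i + 1)) = cb R (CU (i + 2))"
      "cb R (CV (i + 1)) \<otimes>\<^bsub>cay R\<^esub> cb R (CV i) = (\<ominus>\<^bsub>R\<^esub> \<one>\<^bsub>R\<^esub>) \<odot>\<^bsub>cay R\<^esub> cb R (CU (i + 2))"
      "cb R (CU i) \<otimes>\<^bsub>cay R\<^esub> cb R (CU i) = \<zero>\<^bsub>cay R\<^esub>"
      "cb R (CV i) \<otimes>\<^bsub>cay R\<^esub> cb R (CV i) = \<zero>\<^bsub>cay R\<^esub>"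
      "cb R (CU i) \<otimes>\<^bsub>cay R\<^esub> cb R (CV i) = (\<ominus>\<^bsub>R\<^esub> \<one>\<^bsub>R\<^esub>) \<odot>\<^bsub>cay R\<^esub> cb R CE1"
      "cb R (CV i) \<otimes>\<^bsub>cay R\<^esub> cb R (CU i) = (\<ominus>\<^bsub>R\<^esub> \<one>\<^bsub>R\<^esub>) \<odot>\<^bsub>cay R\<^esub> cb R CE2"
      "i \<noteq> j \<Longrightarrow> cb R (CU i) \<otimes>\<^bsub>cay R\<^esub> cb R (CV j) = \<zero>\<^bsub>cay R\<^esub>"
      "i \<noteq> j \<Longrightarrow> cb R (CV i) \<otimes>\<^bsub>cay R\<^esub> cb R (CU j) = \<zero>\<^bsub>cay R\<^esub>"
    using index_3_cases[of i] index_3_cases[of j] by (auto simp: d split: cay_basis.splits)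
qed

section \<open>The automorphism group scheme and its closed subgroup schemes\<close>

text \<open>The R-points of the automorphism group scheme, for a commutative ring R. Elements of
  \<^const>\<open>Bij\<close> are extensional, so that maps are determined by their values on the carrier.\<close>

definition cay_automorphisms :: "'r ring \<Rightarrow> 'r cay_map set" where
  "cay_automorphisms R = {f \<in> Bij (carrier (cay R)).
     (\<forall>x\<in>carrier (cay R). \<forall>y\<in>carrier (cay R). f (x \<oplus>\<^bsub>cay R\<^esub> y) = f x \<oplus>\<^bsub>cay R\<^esub> f y) \<and>
     (\<forall>r\<in>carrier R. \<forall>x\<in>carrier (cay R). f (r \<odot>\<^bsub>cay R\<^esub> x) = r \<odot>\<^bsub>cay R\<^esub> f x) \<and>
     (\<forall>x\<in>carrier (cay R). \<forall>y\<in>carrier (cay R). f (x \<otimes>\<^bsub>cay R\<^esub> y) = f x \<otimes>\<^bsub>cay R\<^esub> f y) \<and>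
     (\<forall>x\<in>carrier (cay R). cay_norm R (f x) = cay_norm R x)}"

definition cay_Aut :: "'r ring \<Rightarrow> 'r cay_map monoid" where
  "cay_Aut R = (BijGroup (carrier (cay R)))\<lparr>carrier := cay_automorphisms R\<rparr>"

text \<open>The base field is a type \<open>'f\<close> of class \<^class>\<open>field\<close>. A unital commutative associative
  algebra over it is a commutative ring R with a structure homomorphism.\<close>

abbreviation base_ring :: "'f::field ring" where
  "base_ring \<equiv> ring_of_type_algebra"

abbreviation comm_alg :: "'r ring \<Rightarrow> ('f::field \<Rightarrow> 'r) \<Rightarrow> bool" where
  "comm_alg R \<phi> \<equiv> ring_hom_cring base_ring R \<phi>"

text \<open>A closed subscheme of the automorphism scheme is given by a set of polynomials over \<open>'f\<close> in
  the 64 matrix entries; the variable (a, b) stands for the a-coordinate of the image of the basis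
  element b. These entries generate the coordinate ring of the automorphism scheme: the inverse of
  an automorphism is its adjoint with respect to the polar form of the norm, hence has entries that are
  up to a permutation the entries of the automorphism itself.\<close>

type_synonym 'f cay_eqns = "(((cay_basis \<times> cay_basis) \<Rightarrow>\<^sub>0 nat) \<Rightarrow>\<^sub>0 'f) set"

definition mpoly_eval ::
    "'r ring \<Rightarrow> ('f::zero \<Rightarrow> 'r) \<Rightarrow> ('x \<Rightarrow> 'r) \<Rightarrow> (('x \<Rightarrow>\<^sub>0 nat) \<Rightarrow>\<^sub>0 'f) \<Rightarrow> 'r" where
  "mpoly_eval R \<phi> a p = (\<Oplus>\<^bsub>R\<^esub>m\<in>Poly_Mapping.keys p.
     \<phi> (Poly_Mapping.lookup p m) \<otimes>\<^bsub>R\<^esub> (\<Otimes>\<^bsub>R\<^esub>x\<in>Poly_Mapping.keys m. a x [^]\<^bsub>R\<^esub> Poly_Mapping.lookup m x))"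

definition points :: "'f::field cay_eqns \<Rightarrow> 'r ring \<Rightarrow> ('f \<Rightarrow> 'r) \<Rightarrow> 'r cay_map set" where
  "points I R \<phi> = {f \<in> carrier (cay_Aut R).
     \<forall>p\<in>I. mpoly_eval R \<phi> (\<lambda>(a, b). f (cb R b) a) p = \<zero>\<^bsub>R\<^esub>}"

text \<open>Quantification over all algebras inside a definition has to take place in a fixed type. Every
  finitely (even countably) generated commutative algebra over \<open>'f\<close> is isomorphic to a quotient of
  the polynomial ring in variables indexed by \<^typ>\<open>nat\<close>, and the elements of such a quotient are
  sets of polynomials. Whether a closed subscheme is a subgroup, or contains a subfunctor that is an
  image of a scheme of finite type, is decided on finitely generated algebras (Yoneda).\<close>

type_synonym 'f test = "((nat \<Rightarrow>\<^sub>0 nat) \<Rightarrow>\<^sub>0 'f) set"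

definition closed_subgroup :: "'f::field cay_eqns \<Rightarrow> bool" where
  "closed_subgroup I \<longleftrightarrow> (\<forall>(R :: 'f test ring) \<phi>. comm_alg R \<phi> \<longrightarrow> subgroup (points I R \<phi>) (cay_Aut R))"

text \<open>The closed subgroup scheme generated by a subfunctor S, i.e. the intersection of all closed
  subgroup schemes that contain S. Intersections of closed subschemes are given by unions of sets of
  equations.\<close>

definition generated ::
    "('f test ring \<Rightarrow> ('f::field \<Rightarrow> 'f test) \<Rightarrow> 'f test cay_map set) \<Rightarrow> 'f cay_eqns" where
  "generated S = \<Union>{I. closed_subgroup I \<and> (\<forall>R \<phi>. comm_alg R \<phi> \<longrightarrow> S R \<phi> \<subseteq> points I R \<phi>)}"

lemma points_generated:
  "f \<in> points (generated S) R \<phi> \<longleftrightarrow> f \<in> carrier (cay_Aut R) \<and>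
     (\<forall>I. closed_subgroup I \<and> (\<forall>R \<phi>. comm_alg R \<phi> \<longrightarrow> S R \<phi> \<subseteq> points I R \<phi>) \<longrightarrow> f \<in> points I R \<phi>)"
  by (auto simp: points_def generated_def)

text \<open>The derived subgroup of a group scheme is the closed subgroup scheme generated by the
  commutator morphism.\<close>

definition derived_subgroup :: "'f::field cay_eqns \<Rightarrow> 'f cay_eqns" where
  "derived_subgroup I = generated (\<lambda>R \<phi>.
     {f \<otimes>\<^bsub>cay_Aut R\<^esub> g \<otimes>\<^bsub>cay_Aut R\<^esub> inv\<^bsub>cay_Aut R\<^esub> f \<otimes>\<^bsub>cay_Aut R\<^esub> inv\<^bsub>cay_Aut R\<^esub> g | f g.
        f \<in> points I R \<phi> \<and> g \<in> points I R \<phi>})"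

text \<open>Scalar extension to R of a linear endomorphism of the algebra over the base field, and the
  R-points of the scheme-theoretic centralizer.\<close>

definition cay_extend :: "'r ring \<Rightarrow> ('f::field \<Rightarrow> 'r) \<Rightarrow> 'f cay_map \<Rightarrow> 'r cay_map" where
  "cay_extend R \<phi> \<tau> = (\<lambda>x\<in>carrier (cay R). \<lambda>a. \<Oplus>\<^bsub>R\<^esub>b\<in>UNIV. \<phi> (\<tau> (cb base_ring b) a) \<otimes>\<^bsub>R\<^esub> x b)"

definition centralizer_points :: "'f::field cay_map \<Rightarrow> 'r ring \<Rightarrow> ('f \<Rightarrow> 'r) \<Rightarrow> 'r cay_map set" where
  "centralizer_points \<tau> R \<phi> = {f \<in> carrier (cay_Aut R).
     f \<otimes>\<^bsub>cay_Aut R\<^esub> cay_extend R \<phi> \<tau> = cay_extend R \<phi> \<tau> \<otimes>\<^bsub>cay_Aut R\<^esub> f}"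

section \<open>The maximal torus, root subgroups and parabolic subgroups\<close>

definition torus :: "'r ring \<Rightarrow> 'r cay_map set" where
  "torus R = {f \<in> carrier (cay_Aut R). \<exists>\<alpha> :: 3 \<Rightarrow> 'r.
     (\<forall>i. \<alpha> i \<in> Units R) \<and> \<alpha> 1 \<otimes>\<^bsub>R\<^esub> \<alpha> 2 \<otimes>\<^bsub>R\<^esub> \<alpha> 3 = \<one>\<^bsub>R\<^esub> \<and>
     f (cb R CE1) = cb R CE1 \<and> f (cb R CE2) = cb R CE2 \<and>
     (\<forall>i. f (cb R (CU i)) = \<alpha> i \<odot>\<^bsub>cay R\<^esub> cb R (CU i)) \<and>
     (\<forall>i. f (cb R (CV i)) = inv\<^bsub>R\<^esub> \<alpha> i \<odot>\<^bsub>cay R\<^esub> cb R (CV i))}"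

text \<open>The roots \<open>\<epsilon>\<^sub>i\<close>, \<open>- \<epsilon>\<^sub>i\<close> and \<open>\<epsilon>\<^sub>i - \<epsilon>\<^sub>j\<close>. The last constructor is only used for distinct
  indices; then different terms denote different roots.\<close>

datatype root = PosEps 3 | NegEps 3 | EpsDiff 3 3

fun neg_root :: "root \<Rightarrow> root" where
  "neg_root (PosEps i) = NegEps i"
| "neg_root (NegEps i) = PosEps i"
| "neg_root (EpsDiff i j) = EpsDiff j i"

definition positive_roots :: "root set" where
  "positive_roots = {PosEps 1, PosEps 2, NegEps 3, EpsDiff 2 1, EpsDiff 2 3, EpsDiff 1 3}"

definition cay_ad :: "'r ring \<Rightarrow> (cay_basis \<Rightarrow> 'r) \<Rightarrow> 'r cay_map" where
  "cay_ad R x y = (x \<otimes>\<^bsub>cay R\<^esub> y) \<ominus>\<^bsub>cay R\<^esub> (y \<otimes>\<^bsub>cay R\<^esub> x)"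

text \<open>The third equation is the commutator of the left multiplication by \<open>u\<^sub>i\<close> and the right
  multiplication by \<open>v\<^sub>j\<close>.\<close>

fun root_vector :: "'r ring \<Rightarrow> root \<Rightarrow> 'r cay_map" where
  "root_vector R (PosEps i) y = cay_ad R (cb R (CU i)) y"
| "root_vector R (NegEps i) y = \<ominus>\<^bsub>cay R\<^esub> cay_ad R (cb R (CV i)) y"
| "root_vector R (EpsDiff i j) y =
     (cb R (CU i) \<otimes>\<^bsub>cay R\<^esub> (y \<otimes>\<^bsub>cay R\<^esub> cb R (CV j))) \<ominus>\<^bsub>cay R\<^esub> ((cb R (CU i) \<otimes>\<^bsub>cay R\<^esub> y) \<otimes>\<^bsub>cay R\<^esub> cb R (CV j))"

definition cay_exp :: "'r ring \<Rightarrow> ('f::field \<Rightarrow> 'r) \<Rightarrow> 'r cay_map \<Rightarrow> 'r cay_map" where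
  "cay_exp R \<phi> \<delta> = (\<lambda>y\<in>carrier (cay R). y \<oplus>\<^bsub>cay R\<^esub> \<delta> y \<oplus>\<^bsub>cay R\<^esub> \<phi> (1 / 2) \<odot>\<^bsub>cay R\<^esub> \<delta> (\<delta> y))"

text \<open>The root subgroups. The description is for characteristic 3, where all the root vectors
  are derivations.\<close>

definition root_subgroup :: "root \<Rightarrow> 'r ring \<Rightarrow> ('f::field \<Rightarrow> 'r) \<Rightarrow> 'r cay_map set" where
  "root_subgroup \<alpha> R \<phi> = {cay_exp R \<phi> (\<lambda>y. t \<odot>\<^bsub>cay R\<^esub> root_vector R \<alpha> y) | t. t \<in> carrier R}"

definition parabolic :: "root \<Rightarrow> 'f::field cay_eqns" where
  "parabolic \<gamma> = generated (\<lambda>R \<phi>.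
     torus R \<union> root_subgroup (neg_root \<gamma>) R \<phi> \<union> (\<Union>\<alpha>\<in>positive_roots. root_subgroup \<alpha> R \<phi>))"

end

theory Submission
  imports Defs
begin

text \<open>Both automorphisms are root elements x(1), for the highest long and the highest short root. The
  torus, the root subgroups with positive roots and the one with root minus gamma stabilize a coordinate subspace
  (the plane spanned by the second u and the third v, respectively the line spanned by the third v),
  hence so does the parabolic subgroup. On this stabilizer the nilpotent part of x(1) is
  semi-invariant, with a character that dies on commutators. So the derived subgroup
  centralizes x(1).

  Conversely, in characteristic 3 conjugation by a suitable torus element with entries 1, - 1 turns
  x(t) into x(- t), and x(- t) x(- t) = x(t). So every root element is a commutator, and by a universal
  polynomial argument products of root elements over any ring are points of the derived subgroup. A point of
  the centralizer is the product of unipotent root elements and a 2 by 2 matrix of determinant 1,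
  which is a product of elementary matrices as soon as an entry of its first column is a unit. These two entries
  generate the unit ideal, so after localization an equation p of the derived subgroup satisfies
  a^n p(f) = 0 = c^m p(f), whence p(f) = 0.\<close>

section \<open>Automorphisms of the split Cayley algebra\<close>

text \<open>The localization is forced: over a general ring a 2 by 2 matrix of determinant 1 need
  not be a product of elementary matrices, so a point of the centralizer is not written as a product
  of root elements over its own ring. Only the vanishing of equations is needed, and this is
  compatible with ring homomorphisms. A second obstacle are the types: \<open>generated\<close> and
  \<open>closed_subgroup\<close> quantify over algebras in one fixed type, while the ring at hand
  and its localizations live in others. A product of root elements has finitely many parameters, so
  it is the image of such a product over a test algebra, where the hypotheses apply. The two roots
  are not treated alike. The long root element is the identity plus a derivation of square zero,
  which the torus scales by one character. The short one has in addition a quadratic term, scaled by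
  the square of the character, so the semi-invariant object used there is the vector v3 itself. That
  commuting with the short root element forces v3 to be fixed is read off from the square of its
  nilpotent part.\<close>

type_synonym 'f mpoly = "(nat \<Rightarrow>\<^sub>0 nat) \<Rightarrow>\<^sub>0 'f"

abbreviation cay_add_abbrev (infixl "\<boxplus>\<index>" 65) where
  "x \<boxplus>\<^bsub>R\<^esub> y \<equiv> x \<oplus>\<^bsub>cay R\<^esub> y"

abbreviation cay_mult_abbrev (infixl "\<boxtimes>\<index>" 70) where
  "x \<boxtimes>\<^bsub>R\<^esub> y \<equiv> x \<otimes>\<^bsub>cay R\<^esub> y"

abbreviation cay_smult_abbrev (infixl "\<cdot>\<index>" 70) where
  "r \<cdot>\<^bsub>R\<^esub> x \<equiv> r \<odot>\<^bsub>cay R\<^esub> x"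

abbreviation cay_Aut_mult_abbrev (infixl "\<bullet>\<index>" 70) where
  "f \<bullet>\<^bsub>R\<^esub> g \<equiv> f \<otimes>\<^bsub>cay_Aut R\<^esub> g"

abbreviation cay_Aut_inv_abbrev ("Inv\<index> _" [81] 80) where
  "Inv\<^bsub>R\<^esub> f \<equiv> inv\<^bsub>cay_Aut R\<^esub> f"

abbreviation cay_carrier ("\<C>\<index>") where
  "\<C>\<^bsub>R\<^esub> \<equiv> carrier (cay R)"

abbreviation cay_Aut_carrier ("\<A>\<index>") where
  "\<A>\<^bsub>R\<^esub> \<equiv> carrier (cay_Aut R)"

lemma index_3_reduce: "(4 :: 3) = 1" "(5 :: 3) = 2"
  by simp_all

lemma all_index_3: "(\<forall>i :: 3. P i) \<longleftrightarrow> P 1 \<and> P 2 \<and> P 3"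
  using index_3_cases by metis

lemma all_cay_basis:
  "(\<forall>b. P b) \<longleftrightarrow> P CE1 \<and> P CE2 \<and> P (CU 1) \<and> P (CU 2) \<and> P (CU 3) \<and> P (CV 1) \<and> P (CV 2) \<and> P (CV 3)"
proof -
  have "(\<forall>b. P b) \<longleftrightarrow> P CE1 \<and> P CE2 \<and> (\<forall>i. P (CU i)) \<and> (\<forall>i. P (CV i))"
    by (metis cay_basis.exhaust)
  then show ?thesis
    unfolding all_index_3 by blast
qed

lemma cay_basis_induct:
  assumes "P CE1" "P CE2" "P (CU 1)" "P (CU 2)" "P (CU 3)" "P (CV 1)" "P (CV 2)" "P (CV 3)"
  shows "P b"
  using assms all_cay_basis[of P] by blast

instance cay_basis :: finite
proof
  have "(UNIV :: cay_basis set) = {CE1, CE2, CU 1, CU 2, CU 3, CV 1, CV 2, CV 3}"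
    using all_cay_basis[of "\<lambda>b. b \<in> {CE1, CE2, CU 1, CU 2, CU 3, CV 1, CV 2, CV 3}"] by blast
  then show "finite (UNIV :: cay_basis set)"
    by (metis finite.emptyI finite.insertI)
qed

text \<open>The Gram matrix of the polar form in the canonical basis is a permutation matrix; this
  is the permutation.\<close>

fun dual :: "cay_basis \<Rightarrow> cay_basis" where
  "dual CE1 = CE2"
| "dual CE2 = CE1"
| "dual (CU i) = CV i"
| "dual (CV i) = CU i"

definition cay_trace :: "'r ring \<Rightarrow> (cay_basis \<Rightarrow> 'r) \<Rightarrow> 'r" where
  "cay_trace R x = x CE1 \<oplus>\<^bsub>R\<^esub> x CE2"

definition cay_polar :: "'r ring \<Rightarrow> (cay_basis \<Rightarrow> 'r) \<Rightarrow> (cay_basis \<Rightarrow> 'r) \<Rightarrow> 'r" where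
  "cay_polar R x y =
    cay_norm R (x \<boxplus>\<^bsub>R\<^esub> y) \<ominus>\<^bsub>R\<^esub> cay_norm R x \<ominus>\<^bsub>R\<^esub> cay_norm R y"

locale cay_ring = cring R for R :: "'r ring" (structure)
begin

lemma cay_carrier_iff: "x \<in> \<C> \<longleftrightarrow> (\<forall>c. x c \<in> carrier R)"
  by (auto simp: cay_def)

lemma cay_coord_closed [simp]: "x \<in> \<C> \<Longrightarrow> x c \<in> carrier R"
  by (simp add: cay_carrier_iff)

lemma cay_zero_coord [simp]: "\<zero>\<^bsub>cay R\<^esub> c = \<zero>"
  and cay_add_coord [simp]: "(x \<boxplus> y) c = x c \<oplus> y c"
  and cay_smult_coord [simp]: "(r \<cdot> x) c = r \<otimes> x c"
  and cay_one_coord [simp]: "\<one>\<^bsub>cay R\<^esub> CE1 = \<one>" "\<one>\<^bsub>cay R\<^esub> CE2 = \<one>"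
    "\<one>\<^bsub>cay R\<^esub> (CU i) = \<zero>" "\<one>\<^bsub>cay R\<^esub> (CV i) = \<zero>"
  by (simp_all add: cay_def)

lemma cay_mult_coord:
  assumes "x \<in> \<C>" "y \<in> \<C>"
  shows
    "(x \<boxtimes> y) CE1 = x CE1 \<otimes> y CE1
      \<ominus> (x (CU 1) \<otimes> y (CV 1) \<oplus> (x (CU 2) \<otimes> y (CV 2) \<oplus> x (CU 3) \<otimes> y (CV 3)))"
    "(x \<boxtimes> y) CE2 = x CE2 \<otimes> y CE2
      \<ominus> (x (CV 1) \<otimes> y (CU 1) \<oplus> (x (CV 2) \<otimes> y (CU 2) \<oplus> x (CV 3) \<otimes> y (CU 3)))"
    "(x \<boxtimes> y) (CU 1) = (x CE1 \<otimes> y (CU 1) \<oplus> x (CU 1) \<otimes> y CE2)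
      \<oplus> (x (CV 2) \<otimes> y (CV 3) \<ominus> x (CV 3) \<otimes> y (CV 2))"
    "(x \<boxtimes> y) (CU 2) = (x CE1 \<otimes> y (CU 2) \<oplus> x (CU 2) \<otimes> y CE2)
      \<oplus> (x (CV 3) \<otimes> y (CV 1) \<ominus> x (CV 1) \<otimes> y (CV 3))"
    "(x \<boxtimes> y) (CU 3) = (x CE1 \<otimes> y (CU 3) \<oplus> x (CU 3) \<otimes> y CE2)
      \<oplus> (x (CV 1) \<otimes> y (CV 2) \<ominus> x (CV 2) \<otimes> y (CV 1))"
    "(x \<boxtimes> y) (CV 1) = (x CE2 \<otimes> y (CV 1) \<oplus> x (CV 1) \<otimes> y CE1)
      \<oplus> (x (CU 2) \<otimes> y (CU 3) \<ominus> x (CU 3) \<otimes> y (CU 2))"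
    "(x \<boxtimes> y) (CV 2) = (x CE2 \<otimes> y (CV 2) \<oplus> x (CV 2) \<otimes> y CE1)
      \<oplus> (x (CU 3) \<otimes> y (CU 1) \<ominus> x (CU 1) \<otimes> y (CU 3))"
    "(x \<boxtimes> y) (CV 3) = (x CE2 \<otimes> y (CV 3) \<oplus> x (CV 3) \<otimes> y CE1)
      \<oplus> (x (CU 1) \<otimes> y (CU 2) \<ominus> x (CU 2) \<otimes> y (CU 1))"
  using assms unfolding cay_def cay_mult_def
  by (simp_all add: finsum_3 index_3_reduce Pi_iff)

lemma cay_closed [simp, intro]:
  shows "\<zero>\<^bsub>cay R\<^esub> \<in> \<C>" "\<one>\<^bsub>cay R\<^esub> \<in> \<C>" "cb R b \<in> \<C>"
    "x \<in> \<C> \<Longrightarrow> y \<in> \<C> \<Longrightarrow> x \<boxplus> y \<in> \<C>"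
    "x \<in> \<C> \<Longrightarrow> y \<in> \<C> \<Longrightarrow> x \<boxtimes> y \<in> \<C>"
    "r \<in> carrier R \<Longrightarrow> x \<in> \<C> \<Longrightarrow> r \<cdot> x \<in> \<C>"
proof -
  show "\<one>\<^bsub>cay R\<^esub> \<in> \<C>"
    by (simp add: cay_carrier_iff all_cay_basis)
  show "x \<boxtimes> y \<in> \<C>" if "x \<in> \<C>" "y \<in> \<C>"
    unfolding cay_carrier_iff all_cay_basis using that by (simp add: cay_mult_coord)
qed (simp_all add: cay_carrier_iff cb_def)

lemma cay_abelian_group: "abelian_group (cay R)"
proof (rule abelian_groupI)
  fix x assume x: "x \<in> \<C>"
  show "\<exists>y\<in>\<C>. y \<boxplus> x = \<zero>\<^bsub>cay R\<^esub>"
    by (rule bexI[of _ "\<lambda>c. \<ominus> x c"]) (use x in \<open>auto simp: cay_carrier_iff fun_eq_iff l_neg\<close>)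
qed (auto simp: fun_eq_iff a_ac)

lemma cay_minus_coord [simp]:
  assumes "x \<in> \<C>"
  shows "(\<ominus>\<^bsub>cay R\<^esub> x) c = \<ominus> x c"
proof -
  interpret C: abelian_group "cay R" by (rule cay_abelian_group)
  have "\<ominus>\<^bsub>cay R\<^esub> x = (\<lambda>c. \<ominus> x c)"
    by (rule C.minus_equality[OF _ assms])
      (use assms in \<open>auto simp: cay_carrier_iff fun_eq_iff l_neg\<close>)
  then show ?thesis by simp
qed

lemma cay_uminus_closed [simp, intro]: "x \<in> \<C> \<Longrightarrow> \<ominus>\<^bsub>cay R\<^esub> x \<in> \<C>"
  by (simp add: cay_carrier_iff)

lemma cay_diff_closed [simp, intro]:
  "x \<in> \<C> \<Longrightarrow> y \<in> \<C> \<Longrightarrow> x \<ominus>\<^bsub>cay R\<^esub> y \<in> \<C>"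
  by (simp add: a_minus_def)

lemma cay_diff_coord [simp]:
  "y \<in> \<C> \<Longrightarrow> (x \<ominus>\<^bsub>cay R\<^esub> y) c = x c \<ominus> y c"
  by (simp add: a_minus_def)

lemma cay_norm_eq:
  assumes "x \<in> \<C>"
  shows "cay_norm R x = x CE1 \<otimes> x CE2
    \<oplus> (x (CU 1) \<otimes> x (CV 1) \<oplus> (x (CU 2) \<otimes> x (CV 2) \<oplus> x (CU 3) \<otimes> x (CV 3)))"
  using assms by (simp add: cay_norm_def finsum_3)

lemma cay_polar_eq:
  assumes x: "x \<in> \<C>" and y: "y \<in> \<C>"
  shows "cay_polar R x y = (x CE1 \<otimes> y CE2 \<oplus> y CE1 \<otimes> x CE2)
    \<oplus> ((x (CU 1) \<otimes> y (CV 1) \<oplus> y (CU 1) \<otimes> x (CV 1))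
    \<oplus> ((x (CU 2) \<otimes> y (CV 2) \<oplus> y (CU 2) \<otimes> x (CV 2))
    \<oplus> (x (CU 3) \<otimes> y (CV 3) \<oplus> y (CU 3) \<otimes> x (CV 3))))"
proof -
  \<comment> \<open>Products are abstracted to variables, so that \<open>algebra\<close> only sees
    small identities: \<open>mult\<close> expands one product of sums, while \<open>split\<close>
    and \<open>cancel\<close> subtract the two norms summand by summand.\<close>
  have mult: "(a \<oplus> b) \<otimes> (c \<oplus> d) = a \<otimes> c \<oplus> (b \<otimes> d \<oplus> (a \<otimes> d \<oplus> b \<otimes> c))"
    if "a \<in> carrier R" "b \<in> carrier R" "c \<in> carrier R" "d \<in> carrier R" for a b c d
    using that by algebra
  have split: "(a \<oplus> (b \<oplus> c)) \<oplus> e \<ominus> (a \<oplus> f) \<ominus> (b \<oplus> g) = c \<oplus> (e \<ominus> f \<ominus> g)"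
    if "a \<in> carrier R" "b \<in> carrier R" "c \<in> carrier R"
      "e \<in> carrier R" "f \<in> carrier R" "g \<in> carrier R" for a b c e f g
    using that by algebra
  have cancel: "(a \<oplus> (b \<oplus> c)) \<ominus> a \<ominus> b = c"
    if "a \<in> carrier R" "b \<in> carrier R" "c \<in> carrier R" for a b c
    using that by algebra
  show ?thesis
    using x y by (simp add: cay_polar_def cay_norm_eq mult split cancel)
qed

lemma cay_polar_cb:
  assumes "x \<in> \<C>"
  shows "cay_polar R (cb R b) x = x (dual b)"
  using assms
  by (induction b rule: cay_basis_induct; simp add: cay_polar_eq; simp add: cb_def)

end

section \<open>Linear maps, the automorphism group, and a criterion for automorphisms\<close>

definition cay_linear :: "'r ring \<Rightarrow> 'r cay_map \<Rightarrow> bool" where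
  "cay_linear R f \<longleftrightarrow> f \<in> carrier (cay R) \<rightarrow> carrier (cay R) \<and>
     (\<forall>x\<in>carrier (cay R). \<forall>y\<in>carrier (cay R). f (x \<boxplus>\<^bsub>R\<^esub> y) = f x \<boxplus>\<^bsub>R\<^esub> f y) \<and>
     (\<forall>r\<in>carrier R. \<forall>x\<in>carrier (cay R). f (r \<cdot>\<^bsub>R\<^esub> x) = r \<cdot>\<^bsub>R\<^esub> f x)"

lemma cay_linear_closed: "cay_linear R f \<Longrightarrow> x \<in> carrier (cay R) \<Longrightarrow> f x \<in> carrier (cay R)"
  and cay_linear_add: "cay_linear R f \<Longrightarrow> x \<in> carrier (cay R) \<Longrightarrow> y \<in> carrier (cay R) \<Longrightarrow>
    f (x \<boxplus>\<^bsub>R\<^esub> y) = f x \<boxplus>\<^bsub>R\<^esub> f y"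
  and cay_linear_smult: "cay_linear R f \<Longrightarrow> r \<in> carrier R \<Longrightarrow> x \<in> carrier (cay R) \<Longrightarrow>
    f (r \<cdot>\<^bsub>R\<^esub> x) = r \<cdot>\<^bsub>R\<^esub> f x"
  by (auto simp: cay_linear_def)

lemma cay_linear_comp: "cay_linear R f \<Longrightarrow> cay_linear R g \<Longrightarrow> cay_linear R (\<lambda>x. f (g x))"
  by (auto simp: cay_linear_def Pi_def)

lemma cay_linear_id: "cay_linear R (\<lambda>x. x)"
  by (simp add: cay_linear_def)

lemma cay_Aut_linear: "f \<in> carrier (cay_Aut R) \<Longrightarrow> cay_linear R f"
  by (auto simp: cay_Aut_def cay_automorphisms_def cay_linear_def Bij_def bij_betw_def)

lemmas cay_Aut_closed = cay_Aut_linear [THEN cay_linear_closed]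
lemmas cay_Aut_add = cay_Aut_linear [THEN cay_linear_add]
lemmas cay_Aut_smult = cay_Aut_linear [THEN cay_linear_smult]

lemma cay_Aut_mult:
  "f \<in> carrier (cay_Aut R) \<Longrightarrow> x \<in> carrier (cay R) \<Longrightarrow> y \<in> carrier (cay R) \<Longrightarrow>
    f (x \<boxtimes>\<^bsub>R\<^esub> y) = f x \<boxtimes>\<^bsub>R\<^esub> f y"
  and cay_Aut_norm:
  "f \<in> carrier (cay_Aut R) \<Longrightarrow> x \<in> carrier (cay R) \<Longrightarrow> cay_norm R (f x) = cay_norm R x"
  and cay_Aut_Bij: "f \<in> carrier (cay_Aut R) \<Longrightarrow> f \<in> Bij (carrier (cay R))"
  by (auto simp: cay_Aut_def cay_automorphisms_def)

lemma cay_Aut_extensional: "f \<in> carrier (cay_Aut R) \<Longrightarrow> f \<in> extensional (carrier (cay R))"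
  using cay_Aut_Bij Bij_imp_extensional by blast

context cay_ring
begin

lemma cay_eqI: "x = y \<longleftrightarrow> x CE1 = y CE1 \<and> x CE2 = y CE2 \<and> x (CU 1) = y (CU 1) \<and> x (CU 2) = y (CU 2)
    \<and> x (CU 3) = y (CU 3) \<and> x (CV 1) = y (CV 1) \<and> x (CV 2) = y (CV 2) \<and> x (CV 3) = y (CV 3)"
  by (simp only: fun_eq_iff all_cay_basis)

lemma cay_linear_uminus:
  assumes "cay_linear R f" "x \<in> \<C>"
  shows "f (\<ominus>\<^bsub>cay R\<^esub> x) = \<ominus>\<^bsub>cay R\<^esub> f x"
proof -
  have "\<ominus>\<^bsub>cay R\<^esub> y = (\<ominus> \<one>) \<cdot> y" if "y \<in> \<C>" for y
    using that by (simp add: fun_eq_iff l_minus)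
  then show ?thesis
    using assms by (metis a_inv_closed cay_linear_closed cay_linear_smult one_closed)
qed

lemma cay_linear_diff:
  assumes "cay_linear R f" "x \<in> \<C>" "y \<in> \<C>"
  shows "f (x \<ominus>\<^bsub>cay R\<^esub> y) = f x \<ominus>\<^bsub>cay R\<^esub> f y"
  unfolding a_minus_def using assms by (metis cay_linear_add cay_linear_uminus cay_uminus_closed)

lemma cay_linear_expand:
  assumes f: "cay_linear R f" and x: "x \<in> \<C>"
  shows "f x a = (\<Oplus>b\<in>UNIV. f (cb R b) a \<otimes> x b)"
proof -
  \<comment> \<open>The induction runs over a finite set containing the support of \<open>x\<close>
    and peels off one coordinate at a time.\<close>
  have "f x a = (\<Oplus>b\<in>B. f (cb R b) a \<otimes> x b)"
    if "finite B" "x \<in> \<C>" "\<forall>b. b \<notin> B \<longrightarrow> x b = \<zero>" for B x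
    using that
  proof (induction B arbitrary: x rule: finite_induct)
    case empty
    then have "x = \<zero> \<cdot> x"
      by (auto simp: fun_eq_iff)
    then have "f x = \<zero> \<cdot> f x"
      by (metis cay_linear_smult[OF f] zero_closed empty(1))
    then have "f x a = \<zero> \<otimes> f x a"
      by (metis cay_smult_coord)
    then show ?case
      using cay_linear_closed[OF f empty(1)] by simp
  next
    case (insert b B)
    let ?y = "x(b := \<zero>)"
    have y: "?y \<in> \<C>" "\<forall>c. c \<notin> B \<longrightarrow> ?y c = \<zero>"
      using insert by (auto simp: cay_carrier_iff)
    have [simp]: "x b \<in> carrier R"
      using insert by simp
    have "x = ?y \<boxplus> x b \<cdot> cb R b"
      using insert by (auto simp: fun_eq_iff cb_def)
    then have "f x = f ?y \<boxplus> x b \<cdot> f (cb R b)"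
      using y by (metis \<open>x b \<in> carrier R\<close> cay_closed(3,6) cay_linear_add cay_linear_smult f)
    then have "f x a = f ?y a \<oplus> x b \<otimes> f (cb R b) a"
      by simp
    also have "f ?y a = (\<Oplus>c\<in>B. f (cb R c) a \<otimes> ?y c)"
      using insert y by blast
    also have "\<dots> = (\<Oplus>c\<in>B. f (cb R c) a \<otimes> x c)"
      by (rule finsum_cong') (use insert y f in \<open>auto simp: cay_linear_closed\<close>)
    finally show ?case
      using insert f by (simp add: Pi_def cay_linear_closed a_comm m_comm)
  qed
  then show ?thesis
    using x by simp
qed

lemma cay_linear_eq:
  assumes "cay_linear R f" "cay_linear R g" "\<And>b. f (cb R b) = g (cb R b)" "x \<in> \<C>"
  shows "f x = g x"
  using assms by (simp add: fun_eq_iff cay_linear_expand[of _ x])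

lemma add_interchange:
  assumes "a \<in> carrier R" "b \<in> carrier R" "c \<in> carrier R" "d \<in> carrier R"
  shows "(a \<oplus> b) \<oplus> (c \<oplus> d) = (a \<oplus> c) \<oplus> (b \<oplus> d)"
    "(a \<oplus> b) \<ominus> (c \<oplus> d) = (a \<ominus> c) \<oplus> (b \<ominus> d)"
  using assms by algebra+

text \<open>The two shapes are those of an idempotent coordinate and of a vector coordinate in
  \<open>cay_mult_coord\<close>. With them as rewrite rules, additivity of the product in each
  argument needs no further ring normalization.\<close>

lemma add_interchange_3_4:
  assumes "a \<in> carrier R" "b \<in> carrier R" "c \<in> carrier R" "d \<in> carrier R"
    "a' \<in> carrier R" "b' \<in> carrier R" "c' \<in> carrier R" "d' \<in> carrier R"
  shows "(a \<oplus> a') \<ominus> ((b \<oplus> b') \<oplus> ((c \<oplus> c') \<oplus> (d \<oplus> d')))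
      = (a \<ominus> (b \<oplus> (c \<oplus> d))) \<oplus> (a' \<ominus> (b' \<oplus> (c' \<oplus> d')))"
    "((a \<oplus> a') \<oplus> (b \<oplus> b')) \<oplus> ((c \<oplus> c') \<ominus> (d \<oplus> d'))
      = ((a \<oplus> b) \<oplus> (c \<ominus> d)) \<oplus> ((a' \<oplus> b') \<oplus> (c' \<ominus> d'))"
proof -
  show "(a \<oplus> a') \<ominus> ((b \<oplus> b') \<oplus> ((c \<oplus> c') \<oplus> (d \<oplus> d')))
      = (a \<ominus> (b \<oplus> (c \<oplus> d))) \<oplus> (a' \<ominus> (b' \<oplus> (c' \<oplus> d')))"
    by (simp only: assms a_closed add_interchange(1)[of c c' d d']
        add_interchange(1)[of b b' "c \<oplus> d"] add_interchange(2))
  show "((a \<oplus> a') \<oplus> (b \<oplus> b')) \<oplus> ((c \<oplus> c') \<ominus> (d \<oplus> d'))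
      = ((a \<oplus> b) \<oplus> (c \<ominus> d)) \<oplus> ((a' \<oplus> b') \<oplus> (c' \<ominus> d'))"
    by (simp only: assms a_closed minus_closed add_interchange(1)[of a a' b b'] add_interchange(2)[of c c']
        add_interchange(1)[of "a \<oplus> b" "a' \<oplus> b'"])
qed

lemma cay_linear_mult:
  assumes x: "x \<in> \<C>"
  shows cay_linear_left_mult: "cay_linear R (\<lambda>y. x \<boxtimes> y)"
    and cay_linear_right_mult: "cay_linear R (\<lambda>y. y \<boxtimes> x)"
proof -
  note [simp] = cay_coord_closed[OF x]
  have "x \<boxtimes> (y \<boxplus> z) = x \<boxtimes> y \<boxplus> x \<boxtimes> z"
    "(y \<boxplus> z) \<boxtimes> x = y \<boxtimes> x \<boxplus> z \<boxtimes> x"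
    if "y \<in> \<C>" "z \<in> \<C>" for y z
    unfolding cay_eqI using that x by (simp_all add: cay_mult_coord r_distr l_distr add_interchange_3_4)
  moreover have "x \<boxtimes> (r \<cdot> y) = r \<cdot> (x \<boxtimes> y)"
    "(r \<cdot> y) \<boxtimes> x = r \<cdot> (y \<boxtimes> x)"
    if "y \<in> \<C>" "r \<in> carrier R" for y r
    unfolding cay_eqI using that x
    by (simp_all add: cay_mult_coord minus_eq r_distr r_minus m_lcomm[of _ r] m_assoc)
  ultimately show "cay_linear R (\<lambda>y. x \<boxtimes> y)" "cay_linear R (\<lambda>y. y \<boxtimes> x)"
    using x by (auto simp: cay_linear_def)
qed

lemma group_cay_Aut: "group (cay_Aut R)"
proof -
  let ?S = "\<C>"
  have "subgroup (cay_automorphisms R) (BijGroup ?S)"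
  proof (rule group.subgroupI[OF group_BijGroup])
    show "cay_automorphisms R \<subseteq> carrier (BijGroup ?S)"
      by (auto simp: cay_automorphisms_def BijGroup_def)
    have "(\<lambda>x\<in>?S. x) \<in> cay_automorphisms R"
      by (simp add: cay_automorphisms_def id_Bij)
    then show "cay_automorphisms R \<noteq> {}"
      by blast
  next
    fix f assume f: "f \<in> cay_automorphisms R"
    then have B: "f \<in> Bij ?S"
      by (simp add: cay_automorphisms_def)
    define g where "g = (\<lambda>x\<in>?S. inv_into ?S f x)"
    have g: "g x \<in> ?S" "f (g x) = x" if "x \<in> ?S" for x
      using that B by (auto simp: g_def Bij_def bij_betw_def inv_into_into f_inv_into_f)
    have inj: "f x = f y \<Longrightarrow> x = y" if "x \<in> ?S" "y \<in> ?S" for x y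
      using that B by (auto simp: Bij_def bij_betw_def inj_on_def)
    have "g \<in> Bij ?S"
      unfolding g_def by (rule restrict_inv_into_Bij[OF B])
    moreover have "g (x \<boxplus> y) = g x \<boxplus> g y" if "x \<in> ?S" "y \<in> ?S" for x y
      by (rule inj) (use f that g in \<open>auto simp: cay_automorphisms_def\<close>)
    moreover have "g (x \<boxtimes> y) = g x \<boxtimes> g y" if "x \<in> ?S" "y \<in> ?S" for x y
      by (rule inj) (use f that g in \<open>auto simp: cay_automorphisms_def\<close>)
    moreover have "g (r \<cdot> x) = r \<cdot> g x" if "x \<in> ?S" "r \<in> carrier R" for x r
      by (rule inj) (use f that g in \<open>auto simp: cay_automorphisms_def\<close>)
    moreover have "cay_norm R (g x) = cay_norm R x" if "x \<in> ?S" for x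
    proof -
      have "cay_norm R (f (g x)) = cay_norm R (g x)"
        using f g(1)[OF that] by (simp add: cay_automorphisms_def)
      then show ?thesis
        using g(2)[OF that] by simp
    qed
    ultimately show "inv\<^bsub>BijGroup ?S\<^esub> f \<in> cay_automorphisms R"
      unfolding inv_BijGroup[OF B] g_def[symmetric] by (simp add: cay_automorphisms_def)
  next
    fix f g assume f: "f \<in> cay_automorphisms R" and g: "g \<in> cay_automorphisms R"
    then have B: "f \<in> Bij ?S" "g \<in> Bij ?S"
      by (simp_all add: cay_automorphisms_def)
    then have [simp]: "f x \<in> ?S" "g x \<in> ?S" if "x \<in> ?S" for x
      using that Bij_imp_funcset by blast+
    have "compose ?S f g \<in> cay_automorphisms R"
      using f g compose_Bij[OF B] by (simp add: cay_automorphisms_def compose_eq)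
    then show "f \<otimes>\<^bsub>BijGroup ?S\<^esub> g \<in> cay_automorphisms R"
      using B by (simp add: BijGroup_def)
  qed
  from subgroup.subgroup_is_group[OF this group_BijGroup] show ?thesis
    by (simp add: cay_Aut_def)
qed

sublocale A: group "cay_Aut R"
  by (rule group_cay_Aut)

lemma cay_Aut_comp_apply [simp]:
  assumes "f \<in> \<A>" "g \<in> \<A>" "x \<in> \<C>"
  shows "(f \<bullet> g) x = f (g x)"
  using assms cay_Aut_Bij[OF assms(1)] cay_Aut_Bij[OF assms(2)]
  by (simp add: cay_Aut_def BijGroup_def compose_eq)

lemma cay_Aut_one_apply [simp]: "x \<in> \<C> \<Longrightarrow> \<one>\<^bsub>cay_Aut R\<^esub> x = x"
  by (simp add: cay_Aut_def BijGroup_def)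

lemma cay_Aut_inv_apply [simp]:
  assumes "f \<in> \<A>" "x \<in> \<C>"
  shows "(Inv f) (f x) = x" "f ((Inv f) x) = x"
  using assms by (metis A.inv_closed A.l_inv A.r_inv cay_Aut_comp_apply cay_Aut_one_apply)+

lemma cay_Aut_ext:
  assumes "f \<in> \<A>" "g \<in> \<A>" "\<And>x. x \<in> \<C> \<Longrightarrow> f x = g x"
  shows "f = g"
  using assms by (meson cay_Aut_extensional extensionalityI)

lemma cay_Aut_eqI:
  assumes "f \<in> \<A>" "g \<in> \<A>" "\<And>b. f (cb R b) = g (cb R b)"
  shows "f = g"
  using assms by (intro cay_Aut_ext) (auto intro: cay_linear_eq cay_Aut_linear)

text \<open>\<open>cay_automorphisms\<close> does not ask for the unit to be preserved. Surjectivity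
  gives it: the image of the unit times the image of a preimage of the unit can be computed in two
  ways.\<close>

lemma cay_Aut_one:
  assumes f: "f \<in> \<A>"
  shows "f \<one>\<^bsub>cay R\<^esub> = \<one>\<^bsub>cay R\<^esub>"
proof -
  let ?g = "Inv f"
  have one: "\<one>\<^bsub>cay R\<^esub> \<boxtimes> x = x" "x \<boxtimes> \<one>\<^bsub>cay R\<^esub> = x" if "x \<in> \<C>" for x
    unfolding cay_eqI using that by (simp_all add: cay_mult_coord minus_eq)
  let ?e = "f \<one>\<^bsub>cay R\<^esub>"
  have e: "?e \<in> \<C>" "?g \<one>\<^bsub>cay R\<^esub> \<in> \<C>"
    using cay_Aut_closed[OF f] cay_Aut_closed[OF A.inv_closed[OF f]] by blast+
  have "?e = ?e \<boxtimes> f (?g \<one>\<^bsub>cay R\<^esub>)"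
    using f e by (simp add: one)
  also have "\<dots> = f (\<one>\<^bsub>cay R\<^esub> \<boxtimes> ?g \<one>\<^bsub>cay R\<^esub>)"
    using f e by (simp add: cay_Aut_mult)
  also have "\<dots> = \<one>\<^bsub>cay R\<^esub>"
    using f e by (simp add: one)
  finally show ?thesis .
qed

lemma cay_Aut_polar:
  assumes "f \<in> \<A>" "x \<in> \<C>" "y \<in> \<C>"
  shows "cay_polar R (f x) (f y) = cay_polar R x y"
  unfolding cay_polar_def using assms
  by (metis cay_Aut_add cay_Aut_norm cay_closed(4))

text \<open>The inverse of an isometry of the polar form is its adjoint, and pairing with a basis
  vector reads off the dual coordinate. Thus conditions on the entries of the inverse are polynomial
  conditions on the entries of \<open>f\<close>.\<close>

lemma cay_Aut_inv_coord:
  assumes f: "f \<in> \<A>"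
  shows "(Inv f) (cb R b) a = f (cb R (dual a)) (dual b)"
proof -
  let ?g = "Inv f"
  have dd: "dual (dual c) = c" for c
    by (cases c) auto
  have sym: "cay_polar R x y = cay_polar R y x" if "x \<in> \<C>" "y \<in> \<C>" for x y
    using that by (simp add: cay_polar_eq a_comm m_comm)
  have g: "?g (cb R b) \<in> \<C>"
    using cay_Aut_closed[OF A.inv_closed[OF f]] by blast
  have "?g (cb R b) a = cay_polar R (cb R (dual a)) (?g (cb R b))"
    using cay_polar_cb[OF g, of "dual a"] by (simp add: dd)
  also have "\<dots> = cay_polar R (f (cb R (dual a))) (cb R b)"
    using cay_Aut_polar[OF f, of "cb R (dual a)" "?g (cb R b)"] f g by simp
  also have "\<dots> = f (cb R (dual a)) (dual b)"
    by (metis cay_polar_cb cay_Aut_closed[OF f] cay_closed(3) sym)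
  finally show ?thesis .
qed

lemma cay_Aut_trace:
  assumes f: "f \<in> \<A>" and x: "x \<in> \<C>"
  shows "cay_trace R (f x) = cay_trace R x"
proof -
  have "cay_trace R y = cay_polar R y \<one>\<^bsub>cay R\<^esub>" if "y \<in> \<C>" for y
    using that by (simp add: cay_polar_eq cay_trace_def)
  then show ?thesis
    by (metis cay_Aut_closed cay_Aut_one cay_Aut_polar cay_closed(2) f x)
qed

text \<open>The second factor is the conjugate of \<open>x\<close>. The identity expresses the norm
  through product, unit and trace, which is how \<open>cay_AutI\<close> obtains invariance of the
  norm.\<close>

lemma cay_mult_conj:
  assumes x: "x \<in> \<C>"
  shows "x \<boxtimes> (cay_trace R x \<cdot> \<one>\<^bsub>cay R\<^esub> \<ominus>\<^bsub>cay R\<^esub> x) = cay_norm R x \<cdot> \<one>\<^bsub>cay R\<^esub>"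
proof -
  have t: "cay_trace R x \<in> carrier R"
    using x by (simp add: cay_trace_def)
  define y where "y = cay_trace R x \<cdot> \<one>\<^bsub>cay R\<^esub> \<ominus>\<^bsub>cay R\<^esub> x"
  have y: "y \<in> \<C>"
    using x t by (simp add: y_def)
  have canc: "(a \<oplus> b) \<oplus> \<ominus> b = a" "(a \<oplus> b) \<oplus> \<ominus> a = b" if "a \<in> carrier R" "b \<in> carrier R" for a b
    using that by algebra+
  have yc: "y CE1 = x CE2" "y CE2 = x CE1" "y (CU i) = \<ominus> x (CU i)" "y (CV i) = \<ominus> x (CV i)" for i
    using x t by (simp_all add: y_def minus_eq cay_trace_def canc)
  have "x \<boxtimes> y = cay_norm R x \<cdot> \<one>\<^bsub>cay R\<^esub>"
    unfolding cay_eqI using x y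
    by (simp add: cay_mult_coord yc cay_norm_eq minus_eq r_minus l_minus minus_add m_comm r_neg l_neg)
  then show ?thesis
    by (simp add: y_def)
qed

text \<open>Whatever is linear or bilinear can be checked on basis vectors. The norm is quadratic,
  so it is replaced by the linear trace; \<open>cay_mult_conj\<close> then recovers it.\<close>

lemma cay_AutI:
  assumes f: "cay_linear R f" and g: "cay_linear R g" and ext: "f \<in> extensional (\<C>)"
    and gf: "\<And>b. g (f (cb R b)) = cb R b" and fg: "\<And>b. f (g (cb R b)) = cb R b"
    and mult: "\<And>b c. f (cb R b \<boxtimes> cb R c) = f (cb R b) \<boxtimes> f (cb R c)"
    and trace: "\<And>b. cay_trace R (f (cb R b)) = cay_trace R (cb R b)"
  shows "f \<in> \<A>"
proof -
  let ?S = "\<C>"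
  note fc = cay_linear_closed[OF f] and gc = cay_linear_closed[OF g]
  have gf': "g (f x) = x" and fg': "f (g x) = x" if "x \<in> ?S" for x
    using cay_linear_eq[OF cay_linear_comp[OF g f] cay_linear_id gf that]
      cay_linear_eq[OF cay_linear_comp[OF f g] cay_linear_id fg that] by simp_all
  have "bij_betw f ?S ?S"
    by (rule bij_betw_byWitness[of _ g]) (use gf' fg' fc gc in auto)
  then have bij: "f \<in> Bij ?S"
    using ext by (simp add: Bij_def)
  have cc: "cb R c \<in> ?S" for c
    by simp
  have m1: "f (x \<boxtimes> cb R c) = f x \<boxtimes> f (cb R c)" if "x \<in> ?S" for x c
    by (rule cay_linear_eq[OF cay_linear_comp[OF f cay_linear_right_mult[OF cc]]
          cay_linear_comp[OF cay_linear_right_mult[OF fc[OF cc]] f] mult that])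
  have m: "f (x \<boxtimes> y) = f x \<boxtimes> f y" if x: "x \<in> ?S" and y: "y \<in> ?S" for x y
    by (rule cay_linear_eq[OF cay_linear_comp[OF f cay_linear_left_mult[OF x]]
          cay_linear_comp[OF cay_linear_left_mult[OF fc[OF x]] f] m1[OF x] y])
  have one: "\<one>\<^bsub>cay R\<^esub> \<boxtimes> x = x" "x \<boxtimes> \<one>\<^bsub>cay R\<^esub> = x" if "x \<in> ?S" for x
    unfolding cay_eqI using that by (simp_all add: cay_mult_coord minus_eq)
  have f1: "f \<one>\<^bsub>cay R\<^esub> = \<one>\<^bsub>cay R\<^esub>"
    using m[of "\<one>\<^bsub>cay R\<^esub>" "g \<one>\<^bsub>cay R\<^esub>"] by (simp add: one fc gc fg')
  \<comment> \<open>Multiplying the scalar-valued trace by the unit makes it an endomorphism, to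
    which \<open>cay_linear_eq\<close> applies.\<close>
  have lin_tr: "cay_linear R (\<lambda>x. cay_trace R x \<cdot> \<one>\<^bsub>cay R\<^esub>)"
    unfolding cay_linear_def
    by (auto simp: cay_trace_def cay_eqI r_distr add_interchange(1))
  have tr: "cay_trace R (f x) = cay_trace R x" if "x \<in> ?S" for x
  proof -
    have "cay_trace R (f x) \<cdot> \<one>\<^bsub>cay R\<^esub> = cay_trace R x \<cdot> \<one>\<^bsub>cay R\<^esub>"
      using cay_linear_eq[OF cay_linear_comp[OF lin_tr f] lin_tr _ that] trace by simp
    then have "(cay_trace R (f x) \<cdot> \<one>\<^bsub>cay R\<^esub>) CE1 = (cay_trace R x \<cdot> \<one>\<^bsub>cay R\<^esub>) CE1"
      by (rule arg_cong)
    then show ?thesis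
      using fc[OF that] that by (simp add: cay_trace_def)
  qed
  have "cay_norm R (f x) = cay_norm R x" if x: "x \<in> ?S" for x
  proof -
    have t: "cay_trace R x \<in> carrier R" and n: "cay_norm R x \<in> carrier R" "cay_norm R (f x) \<in> carrier R"
      using x fc[OF x] by (simp_all add: cay_trace_def cay_norm_eq)
    have "cay_norm R x \<cdot> \<one>\<^bsub>cay R\<^esub> = f (cay_norm R x \<cdot> \<one>\<^bsub>cay R\<^esub>)"
      using cay_linear_smult[OF f n(1), of "\<one>\<^bsub>cay R\<^esub>"] f1 by simp
    also have "\<dots> = f (x \<boxtimes> (cay_trace R x \<cdot> \<one>\<^bsub>cay R\<^esub> \<ominus>\<^bsub>cay R\<^esub> x))"
      using cay_mult_conj[OF x] by simp
    also have "\<dots> = f x \<boxtimes> (cay_trace R (f x) \<cdot> \<one>\<^bsub>cay R\<^esub> \<ominus>\<^bsub>cay R\<^esub> f x)"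
      using x t by (simp only: m cay_linear_diff[OF f] cay_linear_smult[OF f] cay_closed cay_diff_closed f1 tr)
    also have "\<dots> = cay_norm R (f x) \<cdot> \<one>\<^bsub>cay R\<^esub>"
      by (rule cay_mult_conj[OF fc[OF x]])
    finally have "(cay_norm R x \<cdot> \<one>\<^bsub>cay R\<^esub>) CE1 = (cay_norm R (f x) \<cdot> \<one>\<^bsub>cay R\<^esub>) CE1"
      by (rule arg_cong)
    then show ?thesis
      using n by simp
  qed
  then show ?thesis
    using bij m f by (simp add: cay_Aut_def cay_automorphisms_def cay_linear_def)
qed

end

section \<open>Base change\<close>

text \<open>The matrix of \<open>f\<close> with \<open>h\<close> applied to its entries. For the
  structure map of an algebra this is \<open>cay_extend\<close>.\<close>

definition base_change :: "'r ring \<Rightarrow> 's ring \<Rightarrow> ('r \<Rightarrow> 's) \<Rightarrow> 'r cay_map \<Rightarrow> 's cay_map" where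
  "base_change R S h f =
    (\<lambda>x\<in>carrier (cay S). \<lambda>a. \<Oplus>\<^bsub>S\<^esub>b\<in>UNIV. h (f (cb R b) a) \<otimes>\<^bsub>S\<^esub> x b)"

locale cay_hom = ring_hom_cring R S h
  for R :: "'r ring" and S :: "'s ring" and h
begin

sublocale CR: cay_ring R
  by unfold_locales

sublocale CS: cay_ring S
  by unfold_locales

lemma push_closed [simp]: "x \<in> carrier (cay R) \<Longrightarrow> h \<circ> x \<in> carrier (cay S)"
  by (simp add: CS.cay_carrier_iff)

lemma push_cb [simp]: "h \<circ> cb R b = cb S b"
  by (auto simp: cb_def fun_eq_iff)

lemma push_add:
  "x \<in> carrier (cay R) \<Longrightarrow> y \<in> carrier (cay R) \<Longrightarrow> h \<circ> (x \<boxplus>\<^bsub>R\<^esub> y) = (h \<circ> x) \<oplus>\<^bsub>cay S\<^esub> (h \<circ> y)"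
  by (simp add: fun_eq_iff)

lemma push_smult:
  "r \<in> carrier R \<Longrightarrow> x \<in> carrier (cay R) \<Longrightarrow> h \<circ> (r \<cdot>\<^bsub>R\<^esub> x) = h r \<odot>\<^bsub>cay S\<^esub> (h \<circ> x)"
  by (simp add: fun_eq_iff)

lemma push_uminus: "x \<in> carrier (cay R) \<Longrightarrow> h \<circ> (\<ominus>\<^bsub>cay R\<^esub> x) = \<ominus>\<^bsub>cay S\<^esub> (h \<circ> x)"
  by (simp add: fun_eq_iff)

lemma push_diff:
  "x \<in> carrier (cay R) \<Longrightarrow> y \<in> carrier (cay R) \<Longrightarrow> h \<circ> (x \<ominus>\<^bsub>cay R\<^esub> y) = (h \<circ> x) \<ominus>\<^bsub>cay S\<^esub> (h \<circ> y)"
  by (simp add: a_minus_def push_add push_uminus)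

lemma push_mult:
  assumes "x \<in> carrier (cay R)" "y \<in> carrier (cay R)"
  shows "h \<circ> (x \<boxtimes>\<^bsub>R\<^esub> y) = (h \<circ> x) \<otimes>\<^bsub>cay S\<^esub> (h \<circ> y)"
  unfolding CS.cay_eqI using assms by (simp add: CS.cay_mult_coord CR.cay_mult_coord a_minus_def)

lemma base_change_linear:
  assumes f: "cay_linear R f"
  shows "cay_linear S (base_change R S h f)"
proof -
  have c: "h (f (cb R b) a) \<in> carrier S" for a b
    using cay_linear_closed[OF f] by simp
  show ?thesis
    unfolding cay_linear_def base_change_def
    by (auto simp: CS.cay_carrier_iff fun_eq_iff c Pi_def S.r_distr S.m_lcomm S.finsum_addf S.finsum_rdistr
        intro!: S.finsum_closed)
qed

lemma base_change_apply:
  assumes f: "cay_linear R f" and x: "x \<in> carrier (cay R)"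
  shows "base_change R S h f (h \<circ> x) = h \<circ> f x"
proof
  fix a
  have [simp]: "f (cb R b) a \<in> carrier R" for b
    using cay_linear_closed[OF f] by simp
  have "h (f x a) = (\<Oplus>\<^bsub>S\<^esub>b\<in>UNIV. h (f (cb R b) a \<otimes>\<^bsub>R\<^esub> x b))"
    unfolding CR.cay_linear_expand[OF f x, of a] using x by (subst hom_finsum) (auto simp: o_def)
  then show "base_change R S h f (h \<circ> x) a = (h \<circ> f x) a"
    using x by (simp add: base_change_def)
qed

lemma base_change_cb:
  assumes f: "cay_linear R f"
  shows "base_change R S h f (cb S b) = h \<circ> f (cb R b)"
  using base_change_apply[OF f CR.cay_closed(3)[of b]] by simp

text \<open>The base change of the inverse is the inverse, and products and traces of basis vectors
  over \<open>S\<close> are images of those over \<open>R\<close>, so the criterion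
  \<open>cay_AutI\<close> can be applied.\<close>

lemma base_change_Aut:
  assumes f: "f \<in> carrier (cay_Aut R)"
  shows "base_change R S h f \<in> carrier (cay_Aut S)"
proof -
  let ?g = "Inv\<^bsub>R\<^esub> f"
  have g: "?g \<in> carrier (cay_Aut R)"
    using f by simp
  note fl = cay_Aut_linear[OF f] and gl = cay_Aut_linear[OF g]
  note fc = cay_Aut_closed[OF f] and gc = cay_Aut_closed[OF g]
  note bf = base_change_apply[OF fl] and bg = base_change_apply[OF gl]
  have cb: "cb R b \<in> carrier (cay R)" for b
    by simp
  show ?thesis
  proof (rule CS.cay_AutI[OF base_change_linear[OF fl] base_change_linear[OF gl]])
    show "base_change R S h f \<in> extensional (carrier (cay S))"
      by (simp add: base_change_def)
    fix b c
    show "base_change R S h ?g (base_change R S h f (cb S b)) = cb S b"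
      by (simp add: base_change_cb[OF fl] bg[OF fc[OF cb]] f)
    show "base_change R S h f (base_change R S h ?g (cb S b)) = cb S b"
      by (simp add: base_change_cb[OF gl] bf[OF gc[OF cb]] f)
    have "base_change R S h f (cb S b \<otimes>\<^bsub>cay S\<^esub> cb S c) = base_change R S h f (h \<circ> (cb R b \<boxtimes>\<^bsub>R\<^esub> cb R c))"
      by (simp add: push_mult)
    also have "\<dots> = h \<circ> (f (cb R b) \<boxtimes>\<^bsub>R\<^esub> f (cb R c))"
      by (simp add: bf cay_Aut_mult[OF f])
    also have "\<dots> = base_change R S h f (cb S b) \<otimes>\<^bsub>cay S\<^esub> base_change R S h f (cb S c)"
      by (simp add: push_mult fc base_change_cb[OF fl])
    finally show "base_change R S h f (cb S b \<otimes>\<^bsub>cay S\<^esub> cb S c)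
        = base_change R S h f (cb S b) \<otimes>\<^bsub>cay S\<^esub> base_change R S h f (cb S c)" .
    have tr: "cay_trace S (h \<circ> x) = h (cay_trace R x)" if "x \<in> carrier (cay R)" for x
      using that by (simp add: cay_trace_def)
    have "cay_trace S (base_change R S h f (cb S b)) = h (cay_trace R (cb R b))"
      by (simp add: base_change_cb[OF fl] tr fc CR.cay_Aut_trace[OF f])
    also have "\<dots> = cay_trace S (cb S b)"
      using tr[OF cb, of b] by simp
    finally show "cay_trace S (base_change R S h f (cb S b)) = cay_trace S (cb S b)" .
  qed
qed

lemma base_change_mult:
  assumes f: "f \<in> carrier (cay_Aut R)" and g: "g \<in> carrier (cay_Aut R)"
  shows "base_change R S h (f \<bullet>\<^bsub>R\<^esub> g) = base_change R S h f \<otimes>\<^bsub>cay_Aut S\<^esub> base_change R S h g"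
proof (rule CS.cay_Aut_eqI)
  fix b
  have fg: "f \<bullet>\<^bsub>R\<^esub> g \<in> carrier (cay_Aut R)"
    using f g by simp
  show "base_change R S h (f \<bullet>\<^bsub>R\<^esub> g) (cb S b)
      = (base_change R S h f \<otimes>\<^bsub>cay_Aut S\<^esub> base_change R S h g) (cb S b)"
    by (simp only: base_change_cb[OF cay_Aut_linear[OF fg]] base_change_cb[OF cay_Aut_linear[OF g]]
        CR.cay_Aut_comp_apply[OF f g] CS.cay_Aut_comp_apply base_change_Aut[OF f] base_change_Aut[OF g]
        base_change_apply[OF cay_Aut_linear[OF f]] cay_Aut_closed[OF g] CR.cay_closed CS.cay_closed)
qed (use f g base_change_Aut in auto)

lemma base_change_one: "base_change R S h \<one>\<^bsub>cay_Aut R\<^esub> = \<one>\<^bsub>cay_Aut S\<^esub>"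
  by (rule CS.cay_Aut_eqI)
    (simp_all add: base_change_Aut base_change_cb[OF cay_Aut_linear[OF CR.A.one_closed]])

end

section \<open>Evaluation of polynomials, test rings and localization\<close>

lemma ring_of_type_algebra_simps [simp]:
  "carrier ring_of_type_algebra = UNIV"
  "monoid.mult ring_of_type_algebra x y = x * y"
  "monoid.one ring_of_type_algebra = 1"
  "ring.zero ring_of_type_algebra = 0"
  "ring.add ring_of_type_algebra x y = x + y"
  by (simp_all add: ring_of_type_algebra_def)

lemma ring_of_type_algebra_minus [simp]:
  "\<ominus>\<^bsub>ring_of_type_algebra\<^esub> x = - (x :: 'a::comm_ring_1)"
  "x \<ominus>\<^bsub>ring_of_type_algebra\<^esub> y = x - (y :: 'a::comm_ring_1)"
proof -
  interpret cring "ring_of_type_algebra :: 'a ring"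
    by (rule cring_from_type_algebra)
  show m: "\<ominus>\<^bsub>ring_of_type_algebra\<^esub> y = - y" for y :: 'a
    by (rule minus_equality) simp_all
  show "x \<ominus>\<^bsub>ring_of_type_algebra\<^esub> y = x - y"
    by (simp add: a_minus_def m)
qed

definition monom_eval :: "'r ring \<Rightarrow> ('x \<Rightarrow> 'r) \<Rightarrow> ('x \<Rightarrow>\<^sub>0 nat) \<Rightarrow> 'r" where
  "monom_eval R a m = (\<Otimes>\<^bsub>R\<^esub>x\<in>Poly_Mapping.keys m. a x [^]\<^bsub>R\<^esub> Poly_Mapping.lookup m x)"

lemma mpoly_eval_monom:
  "mpoly_eval R \<phi> a p =
    (\<Oplus>\<^bsub>R\<^esub>m\<in>Poly_Mapping.keys p. \<phi> (Poly_Mapping.lookup p m) \<otimes>\<^bsub>R\<^esub> monom_eval R a m)"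
  by (simp add: mpoly_eval_def monom_eval_def)

context cay_ring
begin

lemma monom_eval_closed [simp]: "(\<And>x. a x \<in> carrier R) \<Longrightarrow> monom_eval R a m \<in> carrier R"
  by (simp add: monom_eval_def)

lemma monom_eval_superset:
  assumes "\<And>x. a x \<in> carrier R" "finite A" "Poly_Mapping.keys m \<subseteq> A"
  shows "monom_eval R a m = (\<Otimes>x\<in>A. a x [^] Poly_Mapping.lookup m x)"
  unfolding monom_eval_def
  by (rule finprod_mono_neutral_cong_left) (use assms in \<open>auto simp: in_keys_iff\<close>)

lemma monom_eval_0 [simp]: "monom_eval R a 0 = \<one>"
  by (simp add: monom_eval_def)

lemma monom_eval_add:
  assumes a: "\<And>x. a x \<in> carrier R"
  shows "monom_eval R a (m + n) = monom_eval R a m \<otimes> monom_eval R a n"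
proof -
  let ?A = "Poly_Mapping.keys m \<union> Poly_Mapping.keys n"
  have "monom_eval R a (m + n) = (\<Otimes>x\<in>?A. a x [^] Poly_Mapping.lookup (m + n) x)"
    by (rule monom_eval_superset) (use a keys_add[of m n] in auto)
  also have "\<dots> = (\<Otimes>x\<in>?A. a x [^] Poly_Mapping.lookup m x \<otimes> a x [^] Poly_Mapping.lookup n x)"
    by (rule finprod_cong') (use a in \<open>auto simp: lookup_add nat_pow_mult\<close>)
  also have "\<dots> = (\<Otimes>x\<in>?A. a x [^] Poly_Mapping.lookup m x) \<otimes> (\<Otimes>x\<in>?A. a x [^] Poly_Mapping.lookup n x)"
    by (rule finprod_multf) (use a in auto)
  also have "\<dots> = monom_eval R a m \<otimes> monom_eval R a n"
    using a by (subst (1 2) monom_eval_superset[of a ?A]) auto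
  finally show ?thesis .
qed

end

locale alg_point = cay_ring R for R :: "'r ring" (structure) +
  fixes \<phi> :: "'f::field \<Rightarrow> 'r" and a :: "'x \<Rightarrow> 'r"
  assumes comm_alg: "comm_alg R \<phi>" and point [simp]: "a x \<in> carrier R"
begin

lemma alg_hom [simp]: "\<phi> c \<in> carrier R" "\<phi> 0 = \<zero>" "\<phi> 1 = \<one>"
  "\<phi> (c + d) = \<phi> c \<oplus> \<phi> d" "\<phi> (c * d) = \<phi> c \<otimes> \<phi> d"
proof -
  interpret h: ring_hom_cring base_ring R \<phi> by (rule comm_alg)
  show "\<phi> c \<in> carrier R" "\<phi> 0 = \<zero>" "\<phi> 1 = \<one>"
    "\<phi> (c + d) = \<phi> c \<oplus> \<phi> d" "\<phi> (c * d) = \<phi> c \<otimes> \<phi> d"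
    using h.hom_closed[of c] h.hom_zero h.hom_one h.hom_add[of c d] h.hom_mult[of c d] by simp_all
qed

lemma mpoly_eval_closed [simp]: "mpoly_eval R \<phi> a p \<in> carrier R"
  by (simp add: mpoly_eval_monom)

lemma mpoly_eval_superset:
  assumes "finite A" "Poly_Mapping.keys p \<subseteq> A"
  shows "mpoly_eval R \<phi> a p = (\<Oplus>m\<in>A. \<phi> (Poly_Mapping.lookup p m) \<otimes> monom_eval R a m)"
  unfolding mpoly_eval_monom
  by (rule add.finprod_mono_neutral_cong_left) (use assms in \<open>auto simp: in_keys_iff\<close>)

lemma mpoly_eval_0 [simp]: "mpoly_eval R \<phi> a 0 = \<zero>"
  by (simp add: mpoly_eval_monom)

lemma mpoly_eval_add: "mpoly_eval R \<phi> a (p + q) = mpoly_eval R \<phi> a p \<oplus> mpoly_eval R \<phi> a q"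
proof -
  let ?A = "Poly_Mapping.keys p \<union> Poly_Mapping.keys q"
  have "mpoly_eval R \<phi> a (p + q) = (\<Oplus>m\<in>?A. \<phi> (Poly_Mapping.lookup (p + q) m) \<otimes> monom_eval R a m)"
    by (rule mpoly_eval_superset) (use keys_add[of p q] in auto)
  also have "\<dots> = (\<Oplus>m\<in>?A. \<phi> (Poly_Mapping.lookup p m) \<otimes> monom_eval R a m
      \<oplus> \<phi> (Poly_Mapping.lookup q m) \<otimes> monom_eval R a m)"
    by (rule finsum_cong') (auto simp: lookup_add l_distr)
  also have "\<dots> = mpoly_eval R \<phi> a p \<oplus> mpoly_eval R \<phi> a q"
    by (subst (1 2) mpoly_eval_superset[of ?A]) (auto intro: finsum_addf)
  finally show ?thesis .
qed

lemma mpoly_eval_single [simp]: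
  "mpoly_eval R \<phi> a (Poly_Mapping.single m c) = \<phi> c \<otimes> monom_eval R a m"
  by (subst mpoly_eval_superset[of "{m}"]) (auto simp: lookup_single)

lemma mpoly_induct [case_names 0 add]:
  fixes p :: "('x \<Rightarrow>\<^sub>0 nat) \<Rightarrow>\<^sub>0 'f"
  assumes "P 0" "\<And>p m c. P p \<Longrightarrow> P (p + Poly_Mapping.single m c)"
  shows "P p"
proof (induction p rule: update_induct)
  case (update f k v)
  then have "Poly_Mapping.update k v f = f + Poly_Mapping.single k v"
    by (intro poly_mapping_eqI) (auto simp: lookup_update lookup_add lookup_single in_keys_iff)
  then show ?case
    using assms(2) update by simp
qed (use assms in simp)

lemma mpoly_eval_mult: "mpoly_eval R \<phi> a (p * q) = mpoly_eval R \<phi> a p \<otimes> mpoly_eval R \<phi> a q"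
proof (induction p rule: mpoly_induct)
  case (add p m c)
  have "mpoly_eval R \<phi> a (Poly_Mapping.single m c * q)
      = mpoly_eval R \<phi> a (Poly_Mapping.single m c) \<otimes> mpoly_eval R \<phi> a q"
  proof (induction q rule: mpoly_induct)
    case (add q n d)
    then show ?case
      by (simp add: distrib_left mpoly_eval_add mult_single monom_eval_add r_distr m_ac)
  qed simp
  with add show ?case
    by (simp add: distrib_right mpoly_eval_add l_distr)
qed simp

lemma mpoly_eval_1 [simp]: "mpoly_eval R \<phi> a 1 = \<one>"
  by (simp flip: single_one)

lemma mpoly_eval_hom: "ring_hom_cring ring_of_type_algebra R (mpoly_eval R \<phi> a)"
  by (intro ring_hom_cring.intro ring_hom_cring_axioms.intro cring_from_type_algebra is_cring ring_hom_memI)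
    (simp_all add: mpoly_eval_add mpoly_eval_mult)

end

lemma (in cay_hom) push_mpoly_eval:
  assumes "comm_alg R \<phi>" "\<And>x. a x \<in> carrier R"
  shows "h (mpoly_eval R \<phi> a p) = mpoly_eval S (h \<circ> \<phi>) (\<lambda>x. h (a x)) p"
proof -
  interpret alg_point R \<phi> a
    by (intro alg_point.intro alg_point_axioms.intro CR.cay_ring_axioms assms)
  have [simp]: "(\<lambda>x. a x [^]\<^bsub>R\<^esub> (f x :: nat)) \<in> A \<rightarrow> carrier R" for f A
    by simp
  have m: "h (monom_eval R a m) = monom_eval S (\<lambda>x. h (a x)) m" for m
    unfolding monom_eval_def by (subst hom_finprod) (simp_all add: o_def)
  show ?thesis
    unfolding mpoly_eval_monom by (subst hom_finsum) (simp_all add: o_def m)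
qed

lemma comm_alg_comp:
  assumes "comm_alg R \<phi>" "ring_hom_cring R S h"
  shows "comm_alg S (h \<circ> \<phi>)"
proof -
  interpret f: ring_hom_cring base_ring R \<phi> by fact
  interpret h: ring_hom_cring R S h by fact
  show ?thesis
    by (intro ring_hom_cring.intro ring_hom_cring_axioms.intro f.R.is_cring h.S.is_cring
        ring_hom_trans[OF f.homh h.homh])
qed

section \<open>Polynomial rings, realization of subalgebras in the type of test rings, localization
  at one element\<close>

abbreviation mpoly_ring :: "('f::field mpoly) ring" where
  "mpoly_ring \<equiv> ring_of_type_algebra"

abbreviation mpoly_const :: "'f::field \<Rightarrow> 'f mpoly" where
  "mpoly_const \<equiv> Poly_Mapping.single 0"

abbreviation mpoly_var :: "nat \<Rightarrow> 'f::field mpoly" where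
  "mpoly_var i \<equiv> Poly_Mapping.single (Poly_Mapping.single i 1) 1"

lemma comm_alg_mpoly: "comm_alg mpoly_ring mpoly_const"
  by (intro ring_hom_cring.intro ring_hom_cring_axioms.intro cring_from_type_algebra ring_hom_memI)
    (simp_all add: mult_single single_add)

lemma mpoly_universal:
  fixes R :: "'r ring" and \<phi> :: "'f::field \<Rightarrow> 'r"
  assumes \<phi>: "comm_alg R \<phi>" and x: "\<And>i :: nat. x i \<in> carrier R"
  shows "ring_hom_cring mpoly_ring R (mpoly_eval R \<phi> x)" "mpoly_eval R \<phi> x \<circ> mpoly_const = \<phi>"
    "mpoly_eval R \<phi> x (mpoly_var i) = x i"
proof -
  interpret R: cring R
    using \<phi> by (rule ring_hom_cring.axioms)
  interpret ev: alg_point R \<phi> x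
    by (intro alg_point.intro alg_point_axioms.intro cay_ring.intro R.is_cring \<phi> x)
  show "ring_hom_cring mpoly_ring R (mpoly_eval R \<phi> x)"
    by (rule ev.mpoly_eval_hom)
  show "mpoly_eval R \<phi> x \<circ> mpoly_const = \<phi>"
    by (simp add: fun_eq_iff)
  show "mpoly_eval R \<phi> x (mpoly_var i) = x i"
    by (simp add: monom_eval_def)
qed

text \<open>The subalgebra of R generated by the values x i, realised in the type of test rings.\<close>

lemma test_ring_exists:
  fixes R :: "'r ring" and \<phi> :: "'f::field \<Rightarrow> 'r"
  assumes \<phi>: "comm_alg R \<phi>" and x: "\<And>i :: nat. x i \<in> carrier R"
  obtains T :: "'f test ring" and \<psi> h y
  where "comm_alg T \<psi>" "ring_hom_cring T R h" "h \<circ> \<psi> = \<phi>"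
    "\<And>i. y i \<in> carrier T" "\<And>i. h (y i) = x i"
proof -
  interpret R: cring R
    using \<phi> by (rule ring_hom_cring.axioms)
  let ?P = "mpoly_ring :: 'f mpoly ring"
  let ?ev = "mpoly_eval R \<phi> x"
  interpret e: ring_hom_cring ?P R ?ev
    by (rule mpoly_universal[OF \<phi> x])
  have er: "ring_hom_ring ?P R ?ev"
    by (rule ring_hom_ringI2[OF e.R.ring_axioms R.ring_axioms e.homh])
  define K where "K = a_kernel ?P R ?ev"
  interpret K: ideal K ?P
    unfolding K_def by (rule ring_hom_ring.kernel_is_ideal[OF er])
  \<comment> \<open>The elements of the quotient are cosets, hence sets of polynomials, so that
    \<open>T\<close> is a test ring. The map \<open>h\<close> is induced by evaluation.\<close>
  define T where "T = ?P Quot K"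
  define h where "h = (\<lambda>C. the_elem (?ev ` C))"
  define q where "q = (+>\<^bsub>?P\<^esub>) K"
  interpret q: ring_hom_cring ?P T q
    unfolding T_def q_def by (rule K.rcos_ring_hom_cring[OF e.R.is_cring])
  have hq: "h (q p) = ?ev p" for p
    using ring_hom_ring.the_elem_simp[OF er, of p] by (simp add: h_def q_def K_def)
  have h: "ring_hom_cring T R h"
    using ring_hom_ring.the_elem_hom[OF er] q.S.is_cring R.is_cring
    by (intro ring_hom_cring.intro ring_hom_cring_axioms.intro) (simp_all add: T_def K_def h_def)
  show thesis
  proof (rule that[OF comm_alg_comp[OF comm_alg_mpoly q.ring_hom_cring_axioms] h])
    show "h \<circ> (q \<circ> mpoly_const) = \<phi>"
      using mpoly_universal(2)[OF \<phi> x] by (simp add: fun_eq_iff hq)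
    fix i
    show "q (mpoly_var i) \<in> carrier T"
      by (rule q.hom_closed) simp
    show "h (q (mpoly_var i)) = x i"
      by (simp only: hq mpoly_universal(3)[OF \<phi> x])
  qed
qed

text \<open>The witness is R[X] modulo aX - 1.\<close>

lemma (in cring) localization_exists:
  assumes a: "a \<in> carrier R"
  obtains L :: "(nat \<Rightarrow> 'a) set ring" and h
  where "ring_hom_cring R L h" "h a \<in> Units L"
    "\<And>r. r \<in> carrier R \<Longrightarrow> h r = \<zero>\<^bsub>L\<^esub> \<Longrightarrow> \<exists>n :: nat. a [^] n \<otimes> r = \<zero>"
proof -
  define P where "P = UP R"
  interpret U: UP_cring R P
    unfolding P_def by unfold_locales
  define aX where "aX = up_ring.monom P a 1"
  have aX: "aX \<in> carrier P"
    using a by (simp add: aX_def)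
  define g where "g = aX \<ominus>\<^bsub>P\<^esub> \<one>\<^bsub>P\<^esub>"
  have g: "g \<in> carrier P"
    using aX by (simp add: g_def)
  define I where "I = PIdl\<^bsub>P\<^esub> g"
  interpret I: ideal I P
    unfolding I_def by (rule U.P.cgenideal_ideal[OF g])
  define L where "L = P Quot I"
  interpret q: ring_hom_cring P L "(+>\<^bsub>P\<^esub>) I"
    unfolding L_def by (rule I.rcos_ring_hom_cring[OF U.P.is_cring])
  define h where "h = (+>\<^bsub>P\<^esub>) I \<circ> (\<lambda>r. up_ring.monom P r 0)"
  have "(\<lambda>r. up_ring.monom P r 0) \<in> ring_hom R P"
    by (rule U.const_ring_hom)
  then have "h \<in> ring_hom R L"
    unfolding h_def using q.homh by (rule ring_hom_trans)
  then have hom: "ring_hom_cring R L h"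
    by (intro ring_hom_cring.intro ring_hom_cring_axioms.intro is_cring q.S.is_cring)
  have zero: "\<zero>\<^bsub>L\<^esub> = I"
    unfolding L_def FactRing_def by simp
  have gI: "I +>\<^bsub>P\<^esub> g = \<zero>\<^bsub>L\<^esub>"
    unfolding zero I_def using U.P.cgenideal_self[OF g] U.P.cgenideal_ideal[OF g] by (metis U.P.a_rcos_zero)
  \<comment> \<open>The class of X is inverse to \<open>h a\<close>, because aX - 1 lies in the
    ideal.\<close>
  have "up_ring.monom P \<one> 1 \<otimes>\<^bsub>P\<^esub> up_ring.monom P a 0 = aX"
    unfolding aX_def using U.monom_mult[of \<one> a 1 0] a by simp
  then have "(I +>\<^bsub>P\<^esub> up_ring.monom P \<one> 1) \<otimes>\<^bsub>L\<^esub> h a = I +>\<^bsub>P\<^esub> aX"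
    using a by (simp add: h_def flip: q.hom_mult)
  also have "aX = g \<oplus>\<^bsub>P\<^esub> \<one>\<^bsub>P\<^esub>"
    using aX by (simp add: g_def U.P.minus_eq U.P.a_assoc U.P.l_neg)
  also have "I +>\<^bsub>P\<^esub> (g \<oplus>\<^bsub>P\<^esub> \<one>\<^bsub>P\<^esub>) = \<one>\<^bsub>L\<^esub>"
    using g gI by (simp del: q.hom_one add: q.hom_one[symmetric])
  finally have "(I +>\<^bsub>P\<^esub> up_ring.monom P \<one> 1) \<otimes>\<^bsub>L\<^esub> h a = \<one>\<^bsub>L\<^esub>" .
  moreover have "I +>\<^bsub>P\<^esub> up_ring.monom P \<one> 1 \<in> carrier L" "h a \<in> carrier L"
    using ring_hom_closed[OF \<open>h \<in> ring_hom R L\<close> a] by simp_all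
  ultimately have unit: "h a \<in> Units L"
    by (metis q.S.Units_one_closed q.S.m_comm q.S.unit_factor)
  have tors: "\<exists>n :: nat. a [^] n \<otimes> r = \<zero>" if r: "r \<in> carrier R" and hr: "h r = \<zero>\<^bsub>L\<^esub>" for r
  proof -
    have mr: "up_ring.monom P r 0 \<in> carrier P"
      using r by simp
    have "up_ring.monom P r 0 \<in> I"
      using I.a_rcos_self[OF mr] hr by (simp add: h_def zero)
    then obtain p where p: "p \<in> carrier P" and pr: "up_ring.monom P r 0 = p \<otimes>\<^bsub>P\<^esub> g"
      unfolding I_def cgenideal_def by blast
    have pg: "p \<otimes>\<^bsub>P\<^esub> g = aX \<otimes>\<^bsub>P\<^esub> p \<ominus>\<^bsub>P\<^esub> p"
      unfolding g_def using p aX by (simp add: U.P.minus_eq U.P.r_distr U.P.r_minus U.P.m_comm)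
    \<comment> \<open>Comparing coefficients in r = p (aX - 1): the constant coefficient of
      \<open>p\<close> is - r and each further one is \<open>a\<close> times its predecessor. As
      \<open>p\<close> has finite degree, some power of \<open>a\<close> kills
      \<open>r\<close>.\<close>
    have coeff: "up_ring.coeff P (up_ring.monom P r 0) n = up_ring.coeff P (aX \<otimes>\<^bsub>P\<^esub> p) n \<ominus> up_ring.coeff P p n" for n
      unfolding pr pg using p aX by simp
    have 0: "r = \<ominus> up_ring.coeff P p 0"
      using coeff[of 0] p a r by (simp add: aX_def minus_eq)
    have Suc: "up_ring.coeff P p (Suc n) = a \<otimes> up_ring.coeff P p n" for n
    proof -
      have "up_ring.coeff P (aX \<otimes>\<^bsub>P\<^esub> p) (Suc n) = a \<otimes> up_ring.coeff P p n"
        unfolding aX_def using U.coeff_monom_mult[OF a p, of 1 n] by simp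
      then have "a \<otimes> up_ring.coeff P p n \<ominus> up_ring.coeff P p (Suc n) = \<zero>"
        using coeff[of "Suc n"] r by simp
      then show ?thesis
        using a p by (metis U.coeff_closed m_closed r_right_minus_eq)
    qed
    have pow: "up_ring.coeff P p n = a [^] n \<otimes> up_ring.coeff P p 0" for n
      by (induction n) (use a p in \<open>simp_all add: Suc m_assoc m_lcomm m_comm[of "_ [^] _" a]\<close>)
    have "up_ring.coeff P p (Suc (UnivPoly.deg R p)) = \<zero>"
      by (rule U.deg_aboveD) (use p in simp_all)
    then have "a [^] Suc (UnivPoly.deg R p) \<otimes> r = \<zero>"
      unfolding 0 using pow[of "Suc (UnivPoly.deg R p)"] a p by (simp add: r_minus)
    then show ?thesis ..
  qed
  show thesis
    by (rule that[OF hom unit tors])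
qed

section \<open>Root elements\<close>

text \<open>An integral form of the root elements: 2 is replaced by - 1, so that this agrees with the
  exponential in characteristic 3 only.\<close>

fun root_map :: "'r ring \<Rightarrow> root \<Rightarrow> 'r \<Rightarrow> 'r cay_map" where
  "root_map R (PosEps i) t y = (\<lambda>c. case c of
      CE1 \<Rightarrow> y CE1 \<ominus>\<^bsub>R\<^esub> t \<otimes>\<^bsub>R\<^esub> y (CV i)
    | CE2 \<Rightarrow> y CE2 \<oplus>\<^bsub>R\<^esub> t \<otimes>\<^bsub>R\<^esub> y (CV i)
    | CU k \<Rightarrow> if k = i then y (CU i) \<oplus>\<^bsub>R\<^esub> t \<otimes>\<^bsub>R\<^esub> (y CE2 \<ominus>\<^bsub>R\<^esub> y CE1) \<oplus>\<^bsub>R\<^esub> t \<otimes>\<^bsub>R\<^esub> t \<otimes>\<^bsub>R\<^esub> y (CV i)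
        else y (CU k)
    | CV k \<Rightarrow> if k = i + 1 then y (CV k) \<oplus>\<^bsub>R\<^esub> t \<otimes>\<^bsub>R\<^esub> y (CU (i + 2))
        else if k = i + 2 then y (CV k) \<ominus>\<^bsub>R\<^esub> t \<otimes>\<^bsub>R\<^esub> y (CU (i + 1)) else y (CV k))"
| "root_map R (NegEps i) t y = (\<lambda>c. case c of
      CE1 \<Rightarrow> y CE1 \<ominus>\<^bsub>R\<^esub> t \<otimes>\<^bsub>R\<^esub> y (CU i)
    | CE2 \<Rightarrow> y CE2 \<oplus>\<^bsub>R\<^esub> t \<otimes>\<^bsub>R\<^esub> y (CU i)
    | CU k \<Rightarrow> if k = i + 1 then y (CU k) \<ominus>\<^bsub>R\<^esub> t \<otimes>\<^bsub>R\<^esub> y (CV (i + 2))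
        else if k = i + 2 then y (CU k) \<oplus>\<^bsub>R\<^esub> t \<otimes>\<^bsub>R\<^esub> y (CV (i + 1)) else y (CU k)
    | CV k \<Rightarrow> if k = i then y (CV i) \<oplus>\<^bsub>R\<^esub> t \<otimes>\<^bsub>R\<^esub> (y CE2 \<ominus>\<^bsub>R\<^esub> y CE1) \<oplus>\<^bsub>R\<^esub> t \<otimes>\<^bsub>R\<^esub> t \<otimes>\<^bsub>R\<^esub> y (CU i)
        else y (CV k))"
| "root_map R (EpsDiff i j) t y = (\<lambda>c. case c of
      CE1 \<Rightarrow> y CE1
    | CE2 \<Rightarrow> y CE2
    | CU k \<Rightarrow> if k = i then y (CU k) \<oplus>\<^bsub>R\<^esub> t \<otimes>\<^bsub>R\<^esub> y (CU j) else y (CU k)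
    | CV k \<Rightarrow> if k = j then y (CV k) \<ominus>\<^bsub>R\<^esub> t \<otimes>\<^bsub>R\<^esub> y (CV i) else y (CV k))"

fun valid_root :: "root \<Rightarrow> bool" where
  "valid_root (EpsDiff i j) \<longleftrightarrow> i \<noteq> j"
| "valid_root _ \<longleftrightarrow> True"

text \<open>The torus element with parameter 1 at the index \<open>p\<close> and - 1 at the two
  others; the three parameters have product 1.\<close>

definition sign_map :: "'r ring \<Rightarrow> 3 \<Rightarrow> 'r cay_map" where
  "sign_map R p y = (\<lambda>c. case c of
      CE1 \<Rightarrow> y CE1
    | CE2 \<Rightarrow> y CE2
    | CU k \<Rightarrow> if k = p then y (CU k) else \<ominus>\<^bsub>R\<^esub> y (CU k)
    | CV k \<Rightarrow> if k = p then y (CV k) else \<ominus>\<^bsub>R\<^esub> y (CV k))"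

text \<open>A root takes the value - 1 at the sign map of its index.\<close>

fun sign_index :: "root \<Rightarrow> 3" where
  "sign_index (PosEps i) = i + 1"
| "sign_index (NegEps i) = i + 1"
| "sign_index (EpsDiff i j) = j"

definition root_elt :: "'r ring \<Rightarrow> ('f::field \<Rightarrow> 'r) \<Rightarrow> root \<Rightarrow> 'r \<Rightarrow> 'r cay_map" where
  "root_elt R \<phi> \<alpha> t = cay_exp R \<phi> (\<lambda>y. t \<cdot>\<^bsub>R\<^esub> root_vector R \<alpha> y)"

text \<open>Rings given by a type class, in record form. Coordinates of products become ordinary
  arithmetic expressions there, and \<open>algebra_simps\<close> settles the identities between
  them.\<close>

abbreviation tring :: "'a::comm_ring_1 ring" where
  "tring \<equiv> ring_of_type_algebra"

lemma cay_ring_type: "cay_ring (tring :: 'a::comm_ring_1 ring)"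
  by (simp add: cay_ring_def cring_from_type_algebra)

lemma carrier_cay_type [simp]: "carrier (cay tring) = UNIV"
  by (auto simp: cay_def)

lemmas cay_mult_coord_type =
  cay_ring.cay_mult_coord [OF cay_ring_type, unfolded carrier_cay_type, OF UNIV_I UNIV_I,
    unfolded ring_of_type_algebra_simps ring_of_type_algebra_minus]

lemmas cay_coord_type =
  cay_ring.cay_add_coord [OF cay_ring_type, unfolded ring_of_type_algebra_simps]
  cay_ring.cay_smult_coord [OF cay_ring_type, unfolded ring_of_type_algebra_simps]
  cay_ring.cay_minus_coord [OF cay_ring_type, unfolded carrier_cay_type, OF UNIV_I,
    unfolded ring_of_type_algebra_minus]
  cay_ring.cay_diff_coord [OF cay_ring_type, unfolded carrier_cay_type, OF UNIV_I,
    unfolded ring_of_type_algebra_minus]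

lemmas root_map_type_simps = cay_ring.cay_eqI[OF cay_ring_type] cay_mult_coord_type cay_coord_type index_3_reduce

lemma root_type_cases [case_names PosEps NegEps EpsDiff]:
  assumes "valid_root \<alpha>"
    and "P (PosEps 1)" "P (PosEps 2)" "P (PosEps 3)" "P (NegEps 1)" "P (NegEps 2)" "P (NegEps 3)"
    and "P (EpsDiff 1 2)" "P (EpsDiff 1 3)" "P (EpsDiff 2 1)" "P (EpsDiff 2 3)" "P (EpsDiff 3 1)" "P (EpsDiff 3 2)"
  shows "P \<alpha>"
proof (cases \<alpha>)
  case (PosEps i) then show ?thesis using assms index_3_cases[of i] by auto
next
  case (NegEps i) then show ?thesis using assms index_3_cases[of i] by auto
next
  case (EpsDiff i j) then show ?thesis using assms index_3_cases[of i] index_3_cases[of j] by auto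
qed

text \<open>The coefficients of the integral form fit over every commutative ring, without any
  assumption on the characteristic. The proof compares coordinates for each of the twelve
  roots.\<close>

lemma root_map_mult:
  assumes "valid_root \<alpha>"
  shows "root_map tring \<alpha> t (x \<otimes>\<^bsub>cay tring\<^esub> y)
    = root_map tring \<alpha> t x \<otimes>\<^bsub>cay tring\<^esub> root_map tring \<alpha> t (y :: cay_basis \<Rightarrow> 'a::comm_ring_1)"
  using assms by (rule root_type_cases; simp add: root_map_type_simps; simp add: algebra_simps)

lemma root_map_add:
  assumes "valid_root \<alpha>"
  shows "root_map tring \<alpha> s (root_map tring \<alpha> t x) = root_map tring \<alpha> (s + t :: 'a::comm_ring_1) x"
  using assms by (rule root_type_cases; simp add: root_map_type_simps; simp add: algebra_simps)

lemma root_map_0: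
  assumes "valid_root \<alpha>"
  shows "root_map tring \<alpha> (0 :: 'a::comm_ring_1) x = x"
  using assms by (rule root_type_cases; simp add: root_map_type_simps)

lemma root_map_Aut:
  assumes "valid_root \<alpha>"
  shows "root_map tring \<alpha> (t :: 'a::comm_ring_1) \<in> carrier (cay_Aut tring)"
proof (rule cay_ring.cay_AutI[OF cay_ring_type])
  show "cay_linear tring (root_map tring \<alpha> s)" for s :: 'a
    unfolding cay_linear_def using assms
    by (rule root_type_cases; simp add: root_map_type_simps; simp add: algebra_simps)
  then show "cay_linear tring (root_map tring \<alpha> (- t))" .
  show "cay_trace tring (root_map tring \<alpha> t (cb tring b)) = cay_trace tring (cb tring b)" for b
    using assms by (rule root_type_cases; simp add: cay_trace_def)
qed (simp_all add: root_map_mult root_map_add root_map_0 assms)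

text \<open>The factors 2 that become - 1 here arise when \<open>cay_ad\<close> of one u (or v)
  meets another one: the product changes sign with the order, so the commutator doubles it. In the
  quadratic term the factor 2 of the squared derivation cancels against the half.\<close>

lemma root_map_exp:
  fixes \<phi> :: "'f::field \<Rightarrow> 'a::comm_ring_1"
  assumes "valid_root \<alpha>" and \<phi>: "\<phi> (1 / 2) = - 1" and 3: "(3 :: 'a) = 0"
  shows "root_elt tring \<phi> \<alpha> t = root_map tring \<alpha> t"
proof
  fix y :: "cay_basis \<Rightarrow> 'a"
  have 2: "(2 :: 'a) = - 1"
    using 3 by (simp add: eq_neg_iff_add_eq_0)
  have twice: "z + z = - z" "z + (z + w) = - z + w" for z w :: 'a
    using 2 by (simp_all flip: mult_2 add.assoc)
  show "root_elt tring \<phi> \<alpha> t y = root_map tring \<alpha> t y"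
    using assms(1)
    by (rule root_type_cases; simp add: root_elt_def cay_exp_def cay_ad_def root_map_type_simps \<phi> cb_def;
        simp add: algebra_simps twice 2 3)
qed

lemma sign_map_Aut: "sign_map tring p \<in> carrier (cay_Aut (tring :: 'a::comm_ring_1 ring))"
proof (rule cay_ring.cay_AutI[OF cay_ring_type])
  have p: "p = 1 \<or> p = 2 \<or> p = 3"
    by (rule index_3_cases)
  show "cay_linear tring (sign_map (tring :: 'a ring) p)"
    unfolding cay_linear_def using p
    by (auto simp: root_map_type_simps sign_map_def)
  then show "cay_linear tring (sign_map (tring :: 'a ring) p)" .
  show "sign_map tring p (cb tring b \<otimes>\<^bsub>cay tring\<^esub> cb tring c)
      = sign_map tring p (cb tring b) \<otimes>\<^bsub>cay tring\<^esub> sign_map (tring :: 'a ring) p (cb tring c)" for b c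
    using p by (elim disjE; simp add: root_map_type_simps sign_map_def)
qed (auto simp: sign_map_def cay_trace_def fun_eq_iff split: cay_basis.splits)

lemma sign_map_root_map:
  assumes "valid_root \<alpha>"
  shows "sign_map tring (sign_index \<alpha>) (root_map tring \<alpha> (t :: 'a::comm_ring_1) x)
    = root_map tring \<alpha> (- t) (sign_map tring (sign_index \<alpha>) x)"
  using assms by (rule root_type_cases; simp add: root_map_type_simps sign_map_def; simp add: algebra_simps)

section \<open>Naturality of root elements and transfer from polynomial rings to all algebras in
  characteristic 3\<close>

context cay_hom
begin

lemma push_root_map:
  assumes "t \<in> carrier R" "y \<in> carrier (cay R)"
  shows "h \<circ> root_map R \<alpha> t y = root_map S \<alpha> (h t) (h \<circ> y)"
  using assms by (cases \<alpha>) (auto simp: fun_eq_iff a_minus_def split: cay_basis.splits)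

lemma push_sign_map:
  assumes "y \<in> carrier (cay R)"
  shows "h \<circ> sign_map R p y = sign_map S p (h \<circ> y)"
  using assms by (auto simp: fun_eq_iff sign_map_def split: cay_basis.splits)

lemma push_root_vector:
  assumes "y \<in> carrier (cay R)"
  shows "h \<circ> root_vector R \<alpha> y = root_vector S \<alpha> (h \<circ> y)" "root_vector R \<alpha> y \<in> carrier (cay R)"
  using assms by (cases \<alpha>; simp add: push_mult push_diff push_uminus cay_ad_def)+

lemma push_root_elt:
  assumes "comm_alg R \<psi>" "t \<in> carrier R" "y \<in> carrier (cay R)"
  shows "h \<circ> root_elt R \<psi> \<alpha> t y = root_elt S (h \<circ> \<psi>) \<alpha> (h t) (h \<circ> y)"
proof -
  have "\<psi> c \<in> carrier R" for c
    using ring_hom_cring.homh[OF assms(1)] by (auto simp: ring_hom_def)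
  then show ?thesis
    using assms(2,3)
    by (simp add: root_elt_def cay_exp_def push_add push_smult push_root_vector)
qed

end

text \<open>The values 1 to 8 leave the residue 0 modulo 9 free; in \<open>universal\<close> the
  variable 9 n stands for the n-th scalar and the next eight for the coordinates of the n-th
  vector.\<close>

fun coord_index :: "cay_basis \<Rightarrow> nat" where
  "coord_index CE1 = 1"
| "coord_index CE2 = 2"
| "coord_index (CU i) = (if i = 1 then 3 else if i = 2 then 4 else 5)"
| "coord_index (CV i) = (if i = 1 then 6 else if i = 2 then 7 else 8)"

locale cay_alg = cay_ring R for R :: "'r ring" (structure) +
  fixes \<phi> :: "'f::field \<Rightarrow> 'r"
  assumes comm_alg: "comm_alg R \<phi>" and char3: "CHAR('f) = 3"
begin

text \<open>Any points and vectors over R are images of points and vectors over a polynomial ring, so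
  that polynomial identities need only be verified in a type of class \<^class>\<open>comm_ring_1\<close>.\<close>

lemma universal:
  assumes t: "\<And>n :: nat. t n \<in> carrier R" and y: "\<And>n :: nat. y n \<in> \<C>"
  obtains h :: "'f mpoly \<Rightarrow> 'r" and t' Y
  where "cay_hom mpoly_ring R h" "h \<circ> mpoly_const = \<phi>" "\<And>n. h (t' n) = t n" "\<And>n. h \<circ> Y n = y n"
proof -
  define d where "d k = (THE c. coord_index c = k)" for k
  have d: "d (coord_index c) = c" for c
    unfolding d_def
  proof (rule the_equality)
    fix b assume "coord_index b = coord_index c"
    moreover have "\<forall>b c. coord_index b = coord_index c \<longrightarrow> b = c"
      unfolding all_cay_basis by simp
    ultimately show "b = c" by blast
  qed simp
  have lt: "\<forall>c. coord_index c < 9 \<and> coord_index c \<noteq> 0"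
    unfolding all_cay_basis by simp
  \<comment> \<open>One sequence interleaves all scalars and all coordinates of vectors, since
    \<open>mpoly_universal\<close> takes a single family of values.\<close>
  define x where "x m = (if m mod 9 = 0 then t (m div 9) else y (m div 9) (d (m mod 9)))" for m
  have x: "x m \<in> carrier R" for m
    using t y by (simp add: x_def)
  note u = mpoly_universal[where x = x, OF comm_alg x]
  show thesis
  proof (rule that)
    show "cay_hom mpoly_ring R (mpoly_eval R \<phi> x)"
      unfolding cay_hom_def by (rule u(1))
    show "mpoly_eval R \<phi> x \<circ> mpoly_const = \<phi>"
      by (rule u(2))
    fix n
    show "mpoly_eval R \<phi> x (mpoly_var (9 * n)) = t n"
      unfolding u(3) by (simp add: x_def)
    show "mpoly_eval R \<phi> x \<circ> (\<lambda>c. mpoly_var (9 * n + coord_index c)) = y n"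
    proof
      fix c
      have "x (9 * n + coord_index c) = y n c"
        using lt[THEN spec, of c] d[of c] by (simp add: x_def)
      then show "(mpoly_eval R \<phi> x \<circ> (\<lambda>c. mpoly_var (9 * n + coord_index c))) c = y n c"
        using u(3)[of "9 * n + coord_index c"] by simp
    qed
  qed
qed

lemma universal2:
  assumes "s \<in> carrier R" "t \<in> carrier R" "x \<in> \<C>" "y \<in> \<C>"
  obtains h :: "'f mpoly \<Rightarrow> 'r" and s' t' X' Y'
  where "cay_hom mpoly_ring R h" "h \<circ> mpoly_const = \<phi>" "h s' = s" "h t' = t" "h \<circ> X' = x" "h \<circ> Y' = y"
proof -
  have "(if n = 0 then s else t) \<in> carrier R" "(if n = 0 then x else y) \<in> \<C>" for n :: nat
    using assms by auto
  note assms' = this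
  obtain h :: "'f mpoly \<Rightarrow> 'r" and t' Y where
    u: "cay_hom mpoly_ring R h" "h \<circ> mpoly_const = \<phi>"
    "\<And>n :: nat. h (t' n) = (if n = 0 then s else t)" "\<And>n :: nat. h \<circ> Y n = (if n = 0 then x else y)"
    by (rule universal[of "\<lambda>n. if n = 0 then s else t" "\<lambda>n. if n = 0 then x else y", OF assms']) metis
  show thesis
    using that[OF u(1,2), of "t' 0" "t' 1" "Y 0" "Y 1"] u(3)[of 0] u(3)[of 1] u(4)[of 0] u(4)[of 1] by simp
qed

lemma char3_base: "(3 :: 'f) = 0" "(1 / 2 :: 'f) = - 1"
proof -
  show 3: "(3 :: 'f) = 0"
    using of_nat_CHAR[where 'a = 'f] char3 by simp
  have "(2 :: 'f) * (- 1) = 1 - 3"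
    by simp
  then have "(2 :: 'f) * (- 1) = 1"
    unfolding 3 by simp
  moreover from this have "(2 :: 'f) \<noteq> 0"
    by (metis mult_zero_left zero_neq_one)
  ultimately show "(1 / 2 :: 'f) = - 1"
    by (metis divide_eq_eq mult.commute)
qed

lemma root_elt_mpoly:
  assumes "valid_root \<alpha>"
  shows "root_elt mpoly_ring mpoly_const \<alpha> t = root_map mpoly_ring \<alpha> (t :: 'f mpoly)"
proof (rule root_map_exp[OF assms])
  show "(mpoly_const (1 / 2) :: 'f mpoly) = - 1"
    by (simp add: char3_base single_uminus)
  have "(3 :: 'f mpoly) = mpoly_const 3"
    by (rule single_numeral[symmetric])
  then show "(3 :: 'f mpoly) = 0"
    by (simp add: char3_base)
qed

text \<open>Both sides are natural in the algebra, and the data are images of data over a polynomial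
  ring, where \<open>root_elt_mpoly\<close> gives the equality.\<close>

lemma root_elt_apply:
  assumes \<alpha>: "valid_root \<alpha>" and t: "t \<in> carrier R" and y: "y \<in> \<C>"
  shows "root_elt R \<phi> \<alpha> t y = root_map R \<alpha> t y"
proof -
  obtain h :: "'f mpoly \<Rightarrow> 'r" and t' Y where
    u: "cay_hom mpoly_ring R h" "h \<circ> mpoly_const = \<phi>" "h t' = t" "h \<circ> Y = y"
    by (rule universal2[OF t t y y])
  interpret h: cay_hom mpoly_ring R h
    by (rule u)
  have "root_elt R \<phi> \<alpha> t y = h \<circ> root_elt mpoly_ring mpoly_const \<alpha> t' Y"
    using h.push_root_elt[OF comm_alg_mpoly, of t' Y \<alpha>] by (simp add: u)
  also have "\<dots> = root_map R \<alpha> t y"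
    using h.push_root_map[of t' Y \<alpha>] by (simp add: u root_elt_mpoly[OF \<alpha>])
  finally show ?thesis .
qed

lemma root_elt_linear:
  assumes \<alpha>: "valid_root \<alpha>" and t: "t \<in> carrier R"
  shows "cay_linear R (root_elt R \<phi> \<alpha> t)"
proof -
  have 1: "root_map R \<alpha> t x \<in> \<C>
      \<and> root_map R \<alpha> t (x \<boxplus> y) = root_map R \<alpha> t x \<boxplus> root_map R \<alpha> t y
      \<and> root_map R \<alpha> t (r \<cdot> x) = r \<cdot> root_map R \<alpha> t x"
    if x: "x \<in> \<C>" and y: "y \<in> \<C>" and r: "r \<in> carrier R" for x y r
  proof -
    obtain h :: "'f mpoly \<Rightarrow> 'r" and r' t' X' Y where
      u: "cay_hom mpoly_ring R h" "h \<circ> mpoly_const = \<phi>" "h r' = r" "h t' = t" "h \<circ> X' = x" "h \<circ> Y = y"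
      by (rule universal2[OF r t x y])
    interpret h: cay_hom mpoly_ring R h
      by (rule u)
    note l = cay_Aut_linear[OF root_map_Aut[OF \<alpha>, of t']]
    have p: "h \<circ> root_map mpoly_ring \<alpha> t' Z = root_map R \<alpha> t (h \<circ> Z)" for Z
      using h.push_root_map[of t' Z \<alpha>] by (simp add: u)
    have "root_map R \<alpha> t x \<in> \<C>"
      using h.push_closed[of "root_map mpoly_ring \<alpha> t' X'"] by (simp add: p u)
    moreover have "root_map R \<alpha> t (x \<boxplus> y) = root_map R \<alpha> t x \<boxplus> root_map R \<alpha> t y"
      using p[of "X' \<oplus>\<^bsub>cay mpoly_ring\<^esub> Y"] cay_linear_add[OF l, of X' Y] by (simp add: h.push_add p u)
    moreover have "root_map R \<alpha> t (r \<cdot> x) = r \<cdot> root_map R \<alpha> t x"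
      using p[of "r' \<odot>\<^bsub>cay mpoly_ring\<^esub> X'"] cay_linear_smult[OF l, of r' X'] by (simp add: h.push_smult p u)
    ultimately show ?thesis
      by simp
  qed
  show ?thesis
    using 1 \<alpha> t by (auto simp: cay_linear_def root_elt_apply)
qed

lemma root_elt_base_change:
  assumes \<alpha>: "valid_root \<alpha>" and t: "t \<in> carrier T"
    and T: "cay_alg T \<psi>" and h: "cay_hom T R h" and \<psi>: "h \<circ> \<psi> = \<phi>"
  shows "base_change T R h (root_elt T \<psi> \<alpha> t) = root_elt R \<phi> \<alpha> (h t)"
proof -
  interpret T: cay_alg T \<psi> by (rule T)
  interpret h: cay_hom T R h by (rule h)
  have ht: "h t \<in> carrier R"
    using t by simp
  note l = T.root_elt_linear[OF \<alpha> t]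
  have "base_change T R h (root_elt T \<psi> \<alpha> t) y = root_elt R \<phi> \<alpha> (h t) y" if y: "y \<in> \<C>" for y
  proof (rule cay_linear_eq[OF h.base_change_linear[OF l] root_elt_linear[OF \<alpha> ht] _ y])
    fix b
    show "base_change T R h (root_elt T \<psi> \<alpha> t) (cb R b) = root_elt R \<phi> \<alpha> (h t) (cb R b)"
      using h.push_root_elt[OF T.comm_alg t, of "cb T b" \<alpha>] h.base_change_cb[OF l, of b]
      by (simp add: \<psi>)
  qed
  then show ?thesis
    by (intro extensionalityI[of _ "\<C>"]) (simp_all add: base_change_def root_elt_def cay_exp_def)
qed

lemma mpoly_cay_alg: "cay_alg (mpoly_ring :: 'f mpoly ring) mpoly_const"
  by (intro cay_alg.intro cay_alg_axioms.intro cay_ring_type comm_alg_mpoly char3)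

text \<open>A single \<open>h\<close> serves all parameters \<open>u\<close>, so that a relation
  between root elements over the polynomial ring is carried over by
  \<open>base_change_mult\<close>.\<close>

lemma root_elt_universal:
  assumes \<alpha>: "valid_root \<alpha>" and t: "t \<in> carrier R" and s: "s \<in> carrier R"
  obtains h :: "'f mpoly \<Rightarrow> 'r" and s' t'
  where "cay_hom mpoly_ring R h" "h \<circ> mpoly_const = \<phi>" "h s' = s" "h t' = t"
    "\<And>u. root_elt R \<phi> \<alpha> (h u) = base_change mpoly_ring R h (root_map mpoly_ring \<alpha> u)"
proof -
  obtain h :: "'f mpoly \<Rightarrow> 'r" and s' t' X' Y where
    u: "cay_hom mpoly_ring R h" "h \<circ> mpoly_const = \<phi>" "h s' = s" "h t' = t"
    "h \<circ> X' = \<zero>\<^bsub>cay R\<^esub>" "h \<circ> Y = \<zero>\<^bsub>cay R\<^esub>"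
    by (rule universal2[OF s t cay_closed(1) cay_closed(1)])
  have "root_elt R \<phi> \<alpha> (h w) = base_change mpoly_ring R h (root_map mpoly_ring \<alpha> w)" for w
    using root_elt_base_change[OF \<alpha> _ mpoly_cay_alg u(1,2), of w] by (simp add: root_elt_mpoly[OF \<alpha>])
  with u(1-4) show thesis
    by (rule that)
qed

lemma root_elt_Aut [simp, intro]:
  assumes \<alpha>: "valid_root \<alpha>" and t: "t \<in> carrier R"
  shows "root_elt R \<phi> \<alpha> t \<in> \<A>"
proof -
  obtain h :: "'f mpoly \<Rightarrow> 'r" and s' t' where
    u: "cay_hom mpoly_ring R h" "h \<circ> mpoly_const = \<phi>" "h s' = t" "h t' = t"
    "\<And>u. root_elt R \<phi> \<alpha> (h u) = base_change mpoly_ring R h (root_map mpoly_ring \<alpha> u)"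
    using root_elt_universal[OF \<alpha> t t] by metis
  show ?thesis
    using cay_hom.base_change_Aut[OF u(1) root_map_Aut[OF \<alpha>, of t']] u(5)[of t'] u(4) by simp
qed

lemma root_elt_mult:
  assumes \<alpha>: "valid_root \<alpha>" and s: "s \<in> carrier R" and t: "t \<in> carrier R"
  shows "root_elt R \<phi> \<alpha> s \<bullet> root_elt R \<phi> \<alpha> t = root_elt R \<phi> \<alpha> (s \<oplus> t)"
proof -
  obtain h :: "'f mpoly \<Rightarrow> 'r" and s' t' where
    u: "cay_hom mpoly_ring R h" "h \<circ> mpoly_const = \<phi>" "h s' = s" "h t' = t"
    "\<And>u. root_elt R \<phi> \<alpha> (h u) = base_change mpoly_ring R h (root_map mpoly_ring \<alpha> u)"
    using root_elt_universal[OF \<alpha> t s] by metis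
  interpret h: cay_hom mpoly_ring R h
    by (rule u)
  have "root_map mpoly_ring \<alpha> s' \<otimes>\<^bsub>cay_Aut mpoly_ring\<^esub> root_map mpoly_ring \<alpha> t' = root_map mpoly_ring \<alpha> (s' + t')"
    by (rule h.CR.cay_Aut_ext) (simp_all add: root_map_Aut \<alpha> root_map_add)
  then show ?thesis
    using h.base_change_mult[OF root_map_Aut[OF \<alpha>, of s'] root_map_Aut[OF \<alpha>, of t']]
      h.hom_add[of s' t'] u(3,4) by (simp flip: u(5))
qed

text \<open>By additivity in the parameter this element is idempotent, and a group has no idempotent
  besides its unit.\<close>

lemma root_elt_zero:
  assumes \<alpha>: "valid_root \<alpha>"
  shows "root_elt R \<phi> \<alpha> \<zero> = \<one>\<^bsub>cay_Aut R\<^esub>"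
proof -
  have "root_elt R \<phi> \<alpha> \<zero> \<bullet> root_elt R \<phi> \<alpha> \<zero> = root_elt R \<phi> \<alpha> \<zero>"
    by (simp add: root_elt_mult \<alpha>)
  then show ?thesis
    using \<alpha> by (meson A.l_cancel_one root_elt_Aut zero_closed)
qed

lemma root_elt_inv:
  assumes \<alpha>: "valid_root \<alpha>" and t: "t \<in> carrier R"
  shows "Inv root_elt R \<phi> \<alpha> t = root_elt R \<phi> \<alpha> (\<ominus> t)"
  by (rule A.inv_equality) (simp_all add: root_elt_mult root_elt_zero l_neg \<alpha> t)

lemma char3_ring:
  assumes t: "t \<in> carrier R"
  shows "t \<oplus> t = \<ominus> t"
proof -
  interpret f: ring_hom_cring base_ring R \<phi>
    by (rule comm_alg)
  have "\<one> \<oplus> \<one> = \<phi> (1 + 1)"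
    using f.hom_add[of 1 1] f.hom_one by simp
  also have "1 + 1 = (3 - 1 :: 'f)"
    by simp
  also have "\<dots> = - 1"
    unfolding char3_base(1) by simp
  also have "\<phi> (- 1) = \<ominus> \<one>"
    using f.hom_a_inv[of 1] f.hom_one by simp
  finally have "(\<one> \<oplus> \<one>) \<otimes> t = \<ominus> \<one> \<otimes> t"
    by simp
  then show ?thesis
    using t by (simp add: l_distr l_minus)
qed

lemma root_elt_commutator:
  assumes \<alpha>: "valid_root \<alpha>" and t: "t \<in> carrier R"
  obtains f where "f \<in> torus R"
    "f \<bullet> root_elt R \<phi> \<alpha> t \<bullet> Inv f
      \<bullet> Inv (root_elt R \<phi> \<alpha> t) = root_elt R \<phi> \<alpha> t"
proof -
  obtain h :: "'f mpoly \<Rightarrow> 'r" and s' t' where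
    u: "cay_hom mpoly_ring R h" "h \<circ> mpoly_const = \<phi>" "h s' = t" "h t' = t"
    "\<And>u. root_elt R \<phi> \<alpha> (h u) = base_change mpoly_ring R h (root_map mpoly_ring \<alpha> u)"
    using root_elt_universal[OF \<alpha> t t] by metis
  interpret h: cay_hom mpoly_ring R h
    by (rule u)
  let ?p = "sign_index \<alpha>"
  define f where "f = base_change mpoly_ring R h (sign_map mpoly_ring ?p)"
  have f: "f \<in> \<A>"
    unfolding f_def by (rule h.base_change_Aut[OF sign_map_Aut])
  have f_cb: "f (cb R b) = sign_map R ?p (cb R b)" for b
    using h.base_change_cb[OF cay_Aut_linear[OF sign_map_Aut], of ?p b]
      h.push_sign_map[of "cb mpoly_ring b" ?p] by (simp add: f_def)
  have torus: "f \<in> torus R"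
  proof -
    \<comment> \<open>These are the parameters of the torus element. As - 1 is its own inverse, the
      vectors \<open>CU i\<close> and \<open>CV i\<close> are scaled alike.\<close>
    let ?a = "\<lambda>k. if k = ?p then \<one> else \<ominus> \<one>"
    have "\<ominus> \<one> \<otimes> \<ominus> \<one> = \<one>"
      by (simp add: l_minus)
    then have m1: "\<ominus> \<one> \<in> Units R" "inv (\<ominus> \<one>) = \<ominus> \<one>"
      using comm_inv_char[of "\<ominus> \<one>" "\<ominus> \<one>"] by (auto simp: Units_def)
    have "?a 1 \<otimes> ?a 2 \<otimes> ?a 3 = \<one>"
      using index_3_cases[of ?p] by (auto simp: l_minus)
    moreover have "f (cb R (CU i)) = ?a i \<cdot> cb R (CU i)"
      "f (cb R (CV i)) = ?a i \<cdot> cb R (CV i)"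
      "f (cb R CE1) = cb R CE1" "f (cb R CE2) = cb R CE2" for i
      unfolding f_cb by (auto simp: fun_eq_iff sign_map_def cb_def l_minus split: cay_basis.splits)
    ultimately show ?thesis
      unfolding torus_def using f m1 by (auto intro!: exI[of _ ?a])
  qed
  let ?x = "root_elt R \<phi> \<alpha>"
  note x = root_elt_Aut[OF \<alpha> t]
  have "sign_map mpoly_ring ?p \<otimes>\<^bsub>cay_Aut mpoly_ring\<^esub> root_map mpoly_ring \<alpha> t'
      = root_map mpoly_ring \<alpha> (- t') \<otimes>\<^bsub>cay_Aut mpoly_ring\<^esub> sign_map mpoly_ring ?p"
    by (rule h.CR.cay_Aut_ext) (simp_all add: root_map_Aut sign_map_Aut \<alpha> sign_map_root_map)
  then have "f \<bullet> ?x (h t') = ?x (h (- t')) \<bullet> f"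
    unfolding u(5) f_def
    by (metis h.base_change_mult root_map_Aut[OF \<alpha>] sign_map_Aut)
  moreover have "h (- t') = \<ominus> t"
    using h.hom_a_inv[of t'] u(4) by simp
  ultimately have "f \<bullet> ?x t \<bullet> Inv f = ?x (\<ominus> t)"
    using f x t \<alpha> by (simp add: u(4) A.m_assoc)
  then have "f \<bullet> ?x t \<bullet> Inv f \<bullet> Inv (?x t) = ?x t"
    using t by (simp add: root_elt_inv \<alpha> root_elt_mult char3_ring)
  with torus show thesis
    by (rule that)
qed

end

section \<open>Products of root elements\<close>

text \<open>Products are indexed by lists of roots with parameters: a homomorphism acts on the
  parameters alone, and a list has only finitely many of them to lift.\<close>

definition word :: "'r ring \<Rightarrow> ('f::field \<Rightarrow> 'r) \<Rightarrow> (root \<times> 'r) list \<Rightarrow> 'r cay_map" where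
  "word R \<phi> L = foldr (\<lambda>(\<alpha>, t) g. root_elt R \<phi> \<alpha> t \<bullet>\<^bsub>R\<^esub> g) L \<one>\<^bsub>cay_Aut R\<^esub>"

definition words :: "root set \<Rightarrow> 'r ring \<Rightarrow> ('f::field \<Rightarrow> 'r) \<Rightarrow> 'r cay_map set" where
  "words \<Phi> R \<phi> = word R \<phi> ` {L. set L \<subseteq> \<Phi> \<times> carrier R}"

lemma word_simps:
  "word R \<phi> [] = \<one>\<^bsub>cay_Aut R\<^esub>"
  "word R \<phi> ((\<alpha>, t) # L) = root_elt R \<phi> \<alpha> t \<bullet>\<^bsub>R\<^esub> word R \<phi> L"
  by (simp_all add: word_def)

context cay_alg
begin

lemma word_closed:
  assumes "set L \<subseteq> Collect valid_root \<times> carrier R"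
  shows "word R \<phi> L \<in> \<A>"
  using assms by (induction L) (auto simp: word_simps)

lemma words_closed:
  assumes "\<Phi> \<subseteq> Collect valid_root" "w \<in> words \<Phi> R \<phi>"
  shows "w \<in> \<A>"
  using assms word_closed unfolding words_def by blast

lemma one_in_words: "\<one>\<^bsub>cay_Aut R\<^esub> \<in> words \<Phi> R \<phi>"
  unfolding words_def by (rule image_eqI[of _ _ "[]"]) (simp_all add: word_simps)

lemma root_elt_mult_in_words:
  assumes "\<alpha> \<in> \<Phi>" "t \<in> carrier R" "w \<in> words \<Phi> R \<phi>"
  shows "root_elt R \<phi> \<alpha> t \<bullet> w \<in> words \<Phi> R \<phi>"
proof -
  obtain L where "w = word R \<phi> L" "set L \<subseteq> \<Phi> \<times> carrier R"
    using assms(3) by (auto simp: words_def)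
  then show ?thesis
    unfolding words_def using assms(1,2)
    by (intro image_eqI[of _ _ "(\<alpha>, t) # L"]) (simp_all add: word_simps)
qed

lemma root_elt_in_words:
  assumes "\<Phi> \<subseteq> Collect valid_root" "\<alpha> \<in> \<Phi>" "t \<in> carrier R"
  shows "root_elt R \<phi> \<alpha> t \<in> words \<Phi> R \<phi>"
proof -
  have "root_elt R \<phi> \<alpha> t \<in> \<A>"
    using assms by auto
  then show ?thesis
    using root_elt_mult_in_words[OF assms(2,3) one_in_words] by simp
qed

lemma words_mult:
  assumes \<Phi>: "\<Phi> \<subseteq> Collect valid_root" and "v \<in> words \<Phi> R \<phi>" and w: "w \<in> words \<Phi> R \<phi>"
  shows "v \<bullet> w \<in> words \<Phi> R \<phi>"
proof -
  note wc = words_closed[OF \<Phi> w]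
  have "word R \<phi> L \<bullet> w \<in> words \<Phi> R \<phi>" if "set L \<subseteq> \<Phi> \<times> carrier R" for L
    using that
  proof (induction L)
    case Nil
    then show ?case
      using w wc by (simp add: word_simps)
  next
    case (Cons a L)
    obtain \<alpha> t where a: "a = (\<alpha>, t)" "\<alpha> \<in> \<Phi>" "t \<in> carrier R"
      using Cons.prems by (cases a) auto
    have "word R \<phi> L \<in> \<A>" "root_elt R \<phi> \<alpha> t \<in> \<A>"
      using Cons.prems \<Phi> a by (auto intro!: word_closed)
    then show ?case
      using Cons root_elt_mult_in_words[OF a(2,3)] wc by (simp add: a(1) word_simps A.m_assoc)
  qed
  then show ?thesis
    using assms(2) by (auto simp: words_def)
qed

lemma words_inv:
  assumes \<Phi>: "\<Phi> \<subseteq> Collect valid_root" and "w \<in> words \<Phi> R \<phi>"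
  shows "Inv w \<in> words \<Phi> R \<phi>"
proof -
  have "Inv word R \<phi> L \<in> words \<Phi> R \<phi>" if "set L \<subseteq> \<Phi> \<times> carrier R" for L
    using that
  proof (induction L)
    case Nil
    then show ?case
      using one_in_words by (simp add: word_simps)
  next
    case (Cons a L)
    obtain \<alpha> t where a: "a = (\<alpha>, t)" "\<alpha> \<in> \<Phi>" "t \<in> carrier R"
      using Cons.prems by (cases a) auto
    have v: "valid_root \<alpha>"
      using a \<Phi> by auto
    have "word R \<phi> L \<in> \<A>" "root_elt R \<phi> \<alpha> t \<in> \<A>"
      using Cons.prems \<Phi> a by (auto intro!: word_closed)
    then have "Inv word R \<phi> (a # L) = Inv word R \<phi> L \<bullet> root_elt R \<phi> \<alpha> (\<ominus> t)"
      using a v by (simp add: word_simps A.inv_mult_group root_elt_inv)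
    then show ?case
      using words_mult[OF \<Phi> _ root_elt_in_words[OF \<Phi> a(2)]] Cons a by simp
  qed
  then show ?thesis
    using assms(2) by (auto simp: words_def)
qed

lemma base_change_word:
  assumes L: "set L \<subseteq> Collect valid_root \<times> carrier T"
    and T: "cay_alg T \<psi>" and h: "cay_hom T R h" and \<psi>: "h \<circ> \<psi> = \<phi>"
  shows "base_change T R h (word T \<psi> L) = word R \<phi> (map (apsnd h) L)"
proof -
  interpret T: cay_alg T \<psi> by (rule T)
  interpret h: cay_hom T R h by (rule h)
  show ?thesis
    using L
  proof (induction L)
    case Nil
    then show ?case
      by (simp add: word_simps h.base_change_one)
  next
    case (Cons a L)
    obtain \<alpha> t where a: "a = (\<alpha>, t)" "valid_root \<alpha>" "t \<in> carrier T"
      using Cons.prems by (cases a) auto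
    have "word T \<psi> L \<in> carrier (cay_Aut T)" "root_elt T \<psi> \<alpha> t \<in> carrier (cay_Aut T)"
      using Cons.prems a by (auto intro!: T.word_closed)
    then show ?case
      using Cons a by (simp add: word_simps h.base_change_mult root_elt_base_change[OF a(2,3) T h \<psi>])
  qed
qed

lemma base_change_words:
  assumes \<Phi>: "\<Phi> \<subseteq> Collect valid_root" and "w \<in> words \<Phi> T \<psi>"
    and T: "cay_alg T \<psi>" and h: "cay_hom T R h" and \<psi>: "h \<circ> \<psi> = \<phi>"
  shows "base_change T R h w \<in> words \<Phi> R \<phi>"
proof -
  interpret h: cay_hom T R h by (rule h)
  obtain L where L: "w = word T \<psi> L" "set L \<subseteq> \<Phi> \<times> carrier T"
    using assms(2) by (auto simp: words_def)
  have "base_change T R h w = word R \<phi> (map (apsnd h) L)"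
    unfolding L(1) by (rule base_change_word[OF _ T h \<psi>]) (use L(2) \<Phi> in auto)
  moreover have "set (map (apsnd h) L) \<subseteq> \<Phi> \<times> carrier R"
    using L(2) by auto
  ultimately show ?thesis
    by (auto simp: words_def)
qed

end

lemma (in cay_hom) mpoly_eval_base_change:
  assumes f: "f \<in> carrier (cay_Aut R)" and \<phi>: "comm_alg R \<phi>"
  shows "mpoly_eval S (h \<circ> \<phi>) (\<lambda>(a, b). base_change R S h f (cb S b) a) p
    = h (mpoly_eval R \<phi> (\<lambda>(a, b). f (cb R b) a) p)"
proof -
  have "(\<lambda>(a, b). base_change R S h f (cb S b) a) = (\<lambda>x. h ((\<lambda>(a, b). f (cb R b) a) x))"
    by (auto simp: base_change_cb[OF cay_Aut_linear[OF f]])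
  moreover have "(\<lambda>(a, b). f (cb R b) a) x \<in> carrier R" for x
    using cay_Aut_closed[OF f] by (cases x) simp
  ultimately show ?thesis
    by (simp add: push_mpoly_eval[OF \<phi>])
qed

lemma (in cay_hom) base_change_points:
  assumes f: "f \<in> points I R \<phi>" and \<phi>: "comm_alg R \<phi>"
  shows "base_change R S h f \<in> points I S (h \<circ> \<phi>)"
  using f base_change_Aut mpoly_eval_base_change[OF _ \<phi>] by (auto simp: points_def)

section \<open>From test algebras to arbitrary algebras, and gluing along two localizations\<close>

context cay_alg
begin

text \<open>The hypotheses on \<open>I\<close> only concern algebras in the type of test rings,
  whereas \<open>R\<close> may have any type. The parameters of a word lift to a test algebra
  mapping to \<open>R\<close>; the lifted word satisfies the equations there, and base change
  carries them to \<open>R\<close>.\<close>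

lemma words_subset_points:
  fixes I :: "'f cay_eqns"
  assumes \<Phi>: "\<Phi> \<subseteq> Collect valid_root" and I: "closed_subgroup I"
    and roots: "\<And>(T :: 'f test ring) \<psi> \<alpha>. comm_alg T \<psi> \<Longrightarrow> \<alpha> \<in> \<Phi> \<Longrightarrow> root_subgroup \<alpha> T \<psi> \<subseteq> points I T \<psi>"
  shows "words \<Phi> R \<phi> \<subseteq> points I R \<phi>"
proof
  fix w assume "w \<in> words \<Phi> R \<phi>"
  then obtain L where L: "w = word R \<phi> L" "set L \<subseteq> \<Phi> \<times> carrier R"
    by (auto simp: words_def)
  \<comment> \<open>The parameters of the word, continued by zeros because
    \<open>test_ring_exists\<close> expects an infinite sequence.\<close>
  define x where "x i = (if i < length L then snd (L ! i) else \<zero>)" for i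
  have "L ! i \<in> \<Phi> \<times> carrier R" if "i < length L" for i
    using L(2) that nth_mem by blast
  then have L_nth: "fst (L ! i) \<in> \<Phi>" "snd (L ! i) \<in> carrier R" if "i < length L" for i
    using that by (metis mem_Times_iff)+
  then have x: "x i \<in> carrier R" for i
    by (simp add: x_def)
  obtain T :: "'f test ring" and \<psi> h y
    where T: "comm_alg T \<psi>" "ring_hom_cring T R h" "h \<circ> \<psi> = \<phi>"
      and y: "\<And>i. y i \<in> carrier T" "\<And>i. h (y i) = x i"
    using test_ring_exists[where x = x, OF comm_alg x] by metis
  interpret h: cay_hom T R h
    unfolding cay_hom_def by (rule T)
  interpret T: cay_alg T \<psi>
    by (intro cay_alg.intro cay_alg_axioms.intro h.CR.cay_ring_axioms T(1) char3)
  have sub: "subgroup (points I T \<psi>) (cay_Aut T)"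
    using I T(1) by (simp add: closed_subgroup_def)
  define M where "M = map (\<lambda>i. (fst (L ! i), y i)) [0..<length L]"
  have M: "set M \<subseteq> \<Phi> \<times> carrier T"
    using y L_nth by (auto simp: M_def)
  then have "word T \<psi> M \<in> points I T \<psi>"
  proof (induction M)
    case Nil
    then show ?case
      using subgroup.one_closed[OF sub] by (simp add: word_simps)
  next
    case (Cons a M)
    obtain \<alpha> t where a: "a = (\<alpha>, t)" "\<alpha> \<in> \<Phi>" "t \<in> carrier T"
      using Cons.prems by (cases a) auto
    have "root_elt T \<psi> \<alpha> t \<in> root_subgroup \<alpha> T \<psi>"
      using a by (auto simp: root_subgroup_def root_elt_def)
    then show ?case
      using Cons a roots[OF T(1) a(2)] subgroup.m_closed[OF sub] by (auto simp: word_simps)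
  qed
  then have "base_change T R h (word T \<psi> M) \<in> points I R \<phi>"
    using h.base_change_points[OF _ T(1)] T(3) by blast
  moreover have "map (apsnd h) M = L"
    by (rule nth_equalityI) (simp_all add: M_def y x_def)
  then have "base_change T R h (word T \<psi> M) = w"
    using base_change_word[OF _ T.cay_alg_axioms h.cay_hom_axioms T(3), of M] M \<Phi> L(1) by auto
  ultimately show "w \<in> points I R \<phi>"
    by simp
qed

text \<open>Powers of \<open>a\<close> and \<open>c\<close> still generate the unit ideal. The proof
  avoids this ideal and removes one factor at a time: \<open>base\<close> treats first powers,
  \<open>step\<close> any power of \<open>c\<close>, the last induction any power of
  \<open>a\<close>.\<close>

lemma unimodular_torsion:
  assumes "a \<in> carrier R" "c \<in> carrier R" "u \<in> carrier R" "v \<in> carrier R"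
    and uv: "u \<otimes> a \<oplus> v \<otimes> c = \<one>"
    and "r \<in> carrier R" "a [^] (n :: nat) \<otimes> r = \<zero>" "c [^] (m :: nat) \<otimes> r = \<zero>"
  shows "r = \<zero>"
proof -
  have base: "r = \<zero>" if "r \<in> carrier R" "a \<otimes> r = \<zero>" "c \<otimes> r = \<zero>" for r
  proof -
    have "r = (u \<otimes> a \<oplus> v \<otimes> c) \<otimes> r"
      using that uv by simp
    also have "\<dots> = \<zero>"
      using assms(1-4) that by (simp add: l_distr m_assoc)
    finally show ?thesis .
  qed
  have step: "r = \<zero>" if "r \<in> carrier R" "a \<otimes> r = \<zero>" "c [^] m \<otimes> r = \<zero>" for r
    using that(2,3,1)
  proof (induction m arbitrary: r)
    case (Suc m)
    have "c \<otimes> r = \<zero>"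
      by (rule Suc.IH) (use Suc.prems assms(1,2) in \<open>simp_all add: m_assoc m_lcomm[of a c]\<close>)
    with Suc.prems base show ?case
      by blast
  qed simp
  show ?thesis
    using assms(7,8,6)
  proof (induction n arbitrary: r)
    case (Suc n)
    have "a \<otimes> r = \<zero>"
      by (rule Suc.IH) (use Suc.prems assms(1,2) in \<open>simp_all add: m_assoc m_lcomm[of _ a]\<close>)
    with Suc.prems step show ?case
      by blast
  qed simp
qed

text \<open>The value of each equation at \<open>f\<close> is killed by powers of both
  \<open>a\<close> and \<open>c\<close>, hence zero. The hypothesis ranges over rings in the type in
  which \<open>localization_exists\<close> builds its localizations, and this is why the later
  assumptions on words have the same form.\<close>

lemma points_local:
  fixes I :: "'f cay_eqns"
  assumes f: "f \<in> \<A>"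
    and uni: "a \<in> carrier R" "c \<in> carrier R" "u \<in> carrier R" "v \<in> carrier R" "u \<otimes> a \<oplus> v \<otimes> c = \<one>"
    and local: "\<And>(L :: (nat \<Rightarrow> 'r) set ring) h. cay_hom R L h \<Longrightarrow> h a \<in> Units L \<or> h c \<in> Units L \<Longrightarrow>
      base_change R L h f \<in> points I L (h \<circ> \<phi>)"
  shows "f \<in> points I R \<phi>"
  unfolding points_def
proof (intro CollectI conjI ballI f)
  fix p assume p: "p \<in> I"
  define r where "r = mpoly_eval R \<phi> (\<lambda>(a, b). f (cb R b) a) p"
  interpret ev: alg_point R \<phi> "\<lambda>(a, b). f (cb R b) a"
    by (intro alg_point.intro alg_point_axioms.intro cay_ring_axioms comm_alg)
      (use cay_Aut_closed[OF f] in auto)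
  have r: "r \<in> carrier R"
    unfolding r_def by (rule ev.mpoly_eval_closed)
  have tors: "\<exists>n :: nat. b [^] n \<otimes> r = \<zero>" if b: "b \<in> carrier R" "b = a \<or> b = c" for b
  proof -
    obtain L :: "(nat \<Rightarrow> 'r) set ring" and h where L: "ring_hom_cring R L h" "h b \<in> Units L"
      "\<And>r. r \<in> carrier R \<Longrightarrow> h r = \<zero>\<^bsub>L\<^esub> \<Longrightarrow> \<exists>n :: nat. b [^] n \<otimes> r = \<zero>"
      using localization_exists[OF b(1)] by metis
    interpret h: cay_hom R L h
      unfolding cay_hom_def by (rule L)
    have "base_change R L h f \<in> points I L (h \<circ> \<phi>)"
      by (rule local[OF h.cay_hom_axioms]) (use L(2) b(2) in auto)
    then have "h r = \<zero>\<^bsub>L\<^esub>"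
      using p h.mpoly_eval_base_change[OF f comm_alg] by (simp add: points_def r_def)
    then show ?thesis
      by (rule L(3)[OF r])
  qed
  obtain n m :: nat where "a [^] n \<otimes> r = \<zero>" "c [^] m \<otimes> r = \<zero>"
    using tors uni(1,2) by blast
  then show "mpoly_eval R \<phi> (\<lambda>(a, b). f (cb R b) a) p = \<zero>"
    unfolding r_def[symmetric] by (rule unimodular_torsion[OF uni r])
qed

end

section \<open>Reduction to products of root elements\<close>

context cay_ring
begin

lemma cay_linear_zero:
  assumes f: "cay_linear R f"
  shows "f \<zero>\<^bsub>cay R\<^esub> = \<zero>\<^bsub>cay R\<^esub>"
proof -
  have z: "x = \<zero>\<^bsub>cay R\<^esub>" if "x = \<zero> \<cdot> y" "y \<in> \<C>" for x y
    unfolding that(1) using that(2) by (auto simp: fun_eq_iff)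
  have "\<zero> \<cdot> \<zero>\<^bsub>cay R\<^esub> = \<zero>\<^bsub>cay R\<^esub>"
    by (auto simp: fun_eq_iff)
  then have "f \<zero>\<^bsub>cay R\<^esub> = \<zero> \<cdot> f \<zero>\<^bsub>cay R\<^esub>"
    by (metis cay_closed(1) cay_linear_smult[OF f] zero_closed)
  then show ?thesis
    by (rule z) (simp add: cay_linear_closed[OF f])
qed

text \<open>The u vectors generate the algebra: each v is the product of two of them, and - e1 and -
  e2 are the products of u1 and v1 in the two orders.\<close>

lemma cay_Aut_eq_one:
  assumes g: "g \<in> \<A>" and u: "\<And>i. g (cb R (CU i)) = cb R (CU i)"
  shows "g = \<one>\<^bsub>cay_Aut R\<^esub>"
proof (rule cay_Aut_eqI[OF g A.one_closed])
  note t = cay_mult_table[OF is_cring]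
  have m: "g (x \<boxtimes> y) = x \<boxtimes> y"
    if "g x = x" "g y = y" "x \<in> \<C>" "y \<in> \<C>" for x y
    using that by (simp add: cay_Aut_mult[OF g])
  have v: "g (cb R (CV i)) = cb R (CV i)" for i
  proof -
    \<comment> \<open>Indices are taken modulo 3, so the product of the vectors
      \<open>CU (i + 1)\<close> and \<open>CU (i + 2)\<close> is \<open>CV i\<close>.\<close>
    have "i + 1 + 2 = i"
      using index_3_cases[of i] by auto
    then show ?thesis
      using m[OF u u cay_closed(3) cay_closed(3), of "i + 1" "i + 1 + 1"] by (simp only: t(14)[of "i + 1"])
  qed
  have n: "g x = x" if "g ((\<ominus> \<one>) \<cdot> x) = (\<ominus> \<one>) \<cdot> x" "x \<in> \<C>" for x
  proof -
    have "(\<ominus> \<one>) \<cdot> g x = (\<ominus> \<one>) \<cdot> x"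
      using that by (metis a_inv_closed cay_Aut_smult[OF g] one_closed)
    then have "\<ominus> \<one> \<otimes> g x c = \<ominus> \<one> \<otimes> x c" for c
      by (metis cay_smult_coord)
    then have "\<ominus> g x c = \<ominus> x c" for c
      using that(2) cay_Aut_closed[OF g that(2)] by (simp add: l_minus)
    then have "g x c = x c" for c
      using that(2) cay_Aut_closed[OF g that(2)] by (metis cay_coord_closed minus_minus)
    then show ?thesis by blast
  qed
  have e: "g (cb R CE1) = cb R CE1" "g (cb R CE2) = cb R CE2"
    using n m[OF u v, of 1 1] m[OF v u, of 1 1] t(20,21)[of 1] by simp_all
  fix b
  show "g (cb R b) = \<one>\<^bsub>cay_Aut R\<^esub> (cb R b)"
    using u v e by (cases b) simp_all
qed

text \<open>Applying \<open>g\<close> to e1 v3 = 0 and v3 e1 = v3 gives the same relations for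
  \<open>e\<close>, and their coordinates yield these values. The coordinates at
  \<open>CU 1\<close>, \<open>CU 2\<close> and \<open>CV 3\<close> stay free;
  \<open>reduce_CE1\<close> clears them.\<close>

lemma fix_CV3_idempotent:
  assumes g: "g \<in> \<A>" and v3: "g (cb R (CV 3)) = cb R (CV 3)"
  defines "e \<equiv> g (cb R CE1)"
  shows "e CE1 = \<one>" "e CE2 = \<zero>" "e (CU 3) = \<zero>" "e (CV 1) = \<zero>" "e (CV 2) = \<zero>"
proof -
  note t = cay_mult_table[OF is_cring]
  have e: "e \<in> \<C>"
    unfolding e_def by (rule cay_Aut_closed[OF g]) simp
  have "e \<boxtimes> cb R (CV 3) = g \<zero>\<^bsub>cay R\<^esub>"
    using cay_Aut_mult[OF g, of "cb R CE1" "cb R (CV 3)"] t(12)[of 3] by (simp add: v3 e_def)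
  moreover have "g \<zero>\<^bsub>cay R\<^esub> = \<zero>\<^bsub>cay R\<^esub>"
    by (rule cay_linear_zero[OF cay_Aut_linear[OF g]])
  ultimately have 1: "(e \<boxtimes> cb R (CV 3)) c = \<zero>" for c
    by simp
  show "e (CU 3) = \<zero>" "e CE2 = \<zero>" "e (CV 2) = \<zero>" "e (CV 1) = \<zero>"
    using 1[of CE1] 1[of "CV 3"] 1[of "CU 1"] 1[of "CU 2"] e
    by (simp_all add: cay_mult_coord minus_eq; simp add: cb_def)+
  have "cb R (CV 3) \<boxtimes> e = cb R (CV 3)"
    using cay_Aut_mult[OF g, of "cb R (CV 3)" "cb R CE1"] t(9)[of 3] by (simp add: v3 e_def)
  then have "(cb R (CV 3) \<boxtimes> e) (CV 3) = cb R (CV 3) (CV 3)"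
    by (rule arg_cong)
  then show "e CE1 = \<one>"
    using e by (simp add: cay_mult_coord minus_eq; simp add: cb_def)
qed

text \<open>The span of the u vectors is a Peirce component of e1, cut out by e1 y = y and y e1 = 0,
  and \<open>g\<close> preserves both relations.\<close>

lemma fix_CE1_coord:
  assumes g: "g \<in> \<A>" and e1: "g (cb R CE1) = cb R CE1"
  defines "y \<equiv> \<lambda>i. g (cb R (CU i))"
  shows "y i CE1 = \<zero>" "y i CE2 = \<zero>" "y i (CV k) = \<zero>"
proof -
  note t = cay_mult_table[OF is_cring]
  have y: "y i \<in> \<C>"
    unfolding y_def by (rule cay_Aut_closed[OF g]) simp
  have "cb R CE1 \<boxtimes> y i = y i"
    using cay_Aut_mult[OF g, of "cb R CE1" "cb R (CU i)"] t(6)[of i] by (simp add: e1 y_def)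
  then have 1: "(cb R CE1 \<boxtimes> y i) c = y i c" for c
    by simp
  have "(cb R CE1 \<boxtimes> y i) CE2 = \<zero>" "(cb R CE1 \<boxtimes> y i) (CV 1) = \<zero>"
    "(cb R CE1 \<boxtimes> y i) (CV 2) = \<zero>" "(cb R CE1 \<boxtimes> y i) (CV 3) = \<zero>"
    using y by (simp_all add: cay_mult_coord minus_eq; simp add: cb_def)+
  then show "y i CE2 = \<zero>" "y i (CV k) = \<zero>"
    using 1 index_3_cases[of k] by auto
  have "y i \<boxtimes> cb R CE1 = g \<zero>\<^bsub>cay R\<^esub>"
    using cay_Aut_mult[OF g, of "cb R (CU i)" "cb R CE1"] t(11)[of i] by (simp add: e1 y_def)
  moreover have "g \<zero>\<^bsub>cay R\<^esub> = \<zero>\<^bsub>cay R\<^esub>"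
    by (rule cay_linear_zero[OF cay_Aut_linear[OF g]])
  ultimately have "(y i \<boxtimes> cb R CE1) CE1 = \<zero>"
    by simp
  then show "y i CE1 = \<zero>"
    using y by (simp add: cay_mult_coord minus_eq; simp add: cb_def)
qed

text \<open>The coordinate at \<open>CU 3\<close> is the polar pairing with v3, which is fixed by
  the isometry \<open>g\<close>.\<close>

lemma fix_CV3_coord:
  assumes g: "g \<in> \<A>" and v3: "g (cb R (CV 3)) = cb R (CV 3)"
  shows "g (cb R b) (CU 3) = cb R b (CU 3)"
proof -
  have c: "g (cb R b) \<in> \<C>"
    by (rule cay_Aut_closed[OF g]) simp
  have "g (cb R b) (CU 3) = cay_polar R (cb R (CV 3)) (g (cb R b))"
    using cay_polar_cb[OF c, of "CV 3"] by simp
  also have "\<dots> = cay_polar R (cb R (CV 3)) (cb R b)"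
    using cay_Aut_polar[OF g, of "cb R (CV 3)" "cb R b"] by (simp add: v3)
  also have "\<dots> = cb R b (CU 3)"
    using cay_polar_cb[of "cb R b" "CV 3"] by simp
  finally show ?thesis .
qed

end

context cay_alg
begin

text \<open>Gaussian elimination for a matrix of determinant 1 whose first column contains a unit.\<close>

lemma sl2_elimination:
  assumes \<Phi>: "\<Phi> \<subseteq> Collect valid_root" and f: "f \<in> \<A>"
    and x: "x \<in> \<C>" and y: "y \<in> \<C>" and z: "z \<in> \<C>"
    and upper: "\<And>t. t \<in> carrier R \<Longrightarrow> \<exists>w\<in>words \<Phi> R \<phi>. w z = z \<and> w x = x \<and> w y = y \<boxplus> t \<cdot> x"
    and lower: "\<And>t. t \<in> carrier R \<Longrightarrow> \<exists>w\<in>words \<Phi> R \<phi>. w z = z \<and> w y = y \<and> w x = x \<boxplus> t \<cdot> y"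
    and abcd: "a \<in> carrier R" "b \<in> carrier R" "c \<in> carrier R" "d \<in> carrier R"
    and fz: "f z = z" and fx: "f x = a \<cdot> x \<boxplus> c \<cdot> y"
    and fy: "f y = b \<cdot> x \<boxplus> d \<cdot> y"
    and det: "a \<otimes> d \<ominus> b \<otimes> c = \<one>" and unit: "a \<in> Units R \<or> c \<in> Units R"
  obtains w where "w \<in> words \<Phi> R \<phi>" "(w \<bullet> f) z = z" "(w \<bullet> f) x = x" "(w \<bullet> f) y = y"
proof -
  define V where "V a c = a \<cdot> x \<boxplus> c \<cdot> y" for a c
  have Vc: "V a c \<in> \<C>" if "a \<in> carrier R" "c \<in> carrier R" for a c
    unfolding V_def using that x y by simp
  \<comment> \<open>Some word brings \<open>f\<close> to the matrix with rows (a, b) and (c, d) on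
    \<open>x\<close> and \<open>y\<close> while \<open>z\<close> stays fixed. Left multiplication by
    words amounts to row operations, so the goal is M for the identity matrix.\<close>
  define M where "M a b c d \<longleftrightarrow> (\<exists>w\<in>words \<Phi> R \<phi>. (w \<bullet> f) z = z
    \<and> (w \<bullet> f) x = V a c \<and> (w \<bullet> f) y = V b d)" for a b c d
  have step: "M a' b' c' d'"
    if M: "M a b c d" and w: "w \<in> words \<Phi> R \<phi>" "w z = z" "w (V a c) = V a' c'" "w (V b d) = V b' d'"
      and "a \<in> carrier R" "b \<in> carrier R" "c \<in> carrier R" "d \<in> carrier R"
    for a b c d a' b' c' d' w
  proof -
    obtain v where v: "v \<in> words \<Phi> R \<phi>" "(v \<bullet> f) z = z"
      "(v \<bullet> f) x = V a c" "(v \<bullet> f) y = V b d"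
      using M unfolding M_def by blast
    have vf: "v \<bullet> f \<in> \<A>" and wc: "w \<in> \<A>"
      and vc: "v \<in> \<A>"
      using words_closed[OF \<Phi>] v(1) w(1) f by auto
    have "w \<bullet> v \<bullet> f = w \<bullet> (v \<bullet> f)"
      using wc vc f by (rule A.m_assoc)
    moreover have "(w \<bullet> (v \<bullet> f)) z = z"
      "(w \<bullet> (v \<bullet> f)) x = V a' c'"
      "(w \<bullet> (v \<bullet> f)) y = V b' d'"
      using cay_Aut_comp_apply[OF wc vf z] cay_Aut_comp_apply[OF wc vf x] cay_Aut_comp_apply[OF wc vf y] v(2-4) w(2-4)
      by simp_all
    ultimately show ?thesis
      unfolding M_def using words_mult[OF \<Phi> w(1) v(1)] by (intro bexI[of _ "w \<bullet> v"]) simp_all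
  qed
  have up: "M (a \<oplus> t \<otimes> c) (b \<oplus> t \<otimes> d) c d"
    if M: "M a b c d" and t: "t \<in> carrier R"
      and abcd: "a \<in> carrier R" "b \<in> carrier R" "c \<in> carrier R" "d \<in> carrier R" for a b c d t
  proof -
    obtain w where w: "w \<in> words \<Phi> R \<phi>" "w z = z" "w x = x" "w y = y \<boxplus> t \<cdot> x"
      using upper[OF t] by blast
    have l: "cay_linear R w"
      by (rule cay_Aut_linear[OF words_closed[OF \<Phi> w(1)]])
    have "w (V r s) = V (r \<oplus> t \<otimes> s) s" if "r \<in> carrier R" "s \<in> carrier R" for r s
    proof -
      have "w (V r s) = r \<cdot> x \<boxplus> s \<cdot> (y \<boxplus> t \<cdot> x)"
        unfolding V_def using that x y by (simp only: cay_linear_add[OF l] cay_linear_smult[OF l] cay_closed w(3,4))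
      then show ?thesis
        unfolding V_def using that x y t by (auto simp: fun_eq_iff r_distr l_distr m_ac a_ac)
    qed
    then show ?thesis
      using step[OF M w(1,2) _ _ abcd] abcd by blast
  qed
  have low: "M a b (c \<oplus> t \<otimes> a) (d \<oplus> t \<otimes> b)"
    if M: "M a b c d" and t: "t \<in> carrier R"
      and abcd: "a \<in> carrier R" "b \<in> carrier R" "c \<in> carrier R" "d \<in> carrier R" for a b c d t
  proof -
    obtain w where w: "w \<in> words \<Phi> R \<phi>" "w z = z" "w y = y" "w x = x \<boxplus> t \<cdot> y"
      using lower[OF t] by blast
    have l: "cay_linear R w"
      by (rule cay_Aut_linear[OF words_closed[OF \<Phi> w(1)]])
    have "w (V r s) = V r (s \<oplus> t \<otimes> r)" if "r \<in> carrier R" "s \<in> carrier R" for r s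
    proof -
      have "w (V r s) = r \<cdot> (x \<boxplus> t \<cdot> y) \<boxplus> s \<cdot> y"
        unfolding V_def using that x y by (simp only: cay_linear_add[OF l] cay_linear_smult[OF l] cay_closed w(3,4))
      then show ?thesis
        unfolding V_def using that x y t by (auto simp: fun_eq_iff r_distr l_distr m_ac a_ac)
    qed
    then show ?thesis
      using step[OF M w(1,2) _ _ abcd] abcd by blast
  qed
  have c_unit: "M \<one> \<zero> \<zero> \<one>"
    if M: "M a b c d" and c: "c \<in> Units R" and det: "a \<otimes> d \<ominus> b \<otimes> c = \<one>"
      and abcd: "a \<in> carrier R" "b \<in> carrier R" "c \<in> carrier R" "d \<in> carrier R" for a b c d
  proof -
    \<comment> \<open>Chosen so that adding \<open>t\<close> times the second row to the first turns
      the entry \<open>a\<close> into 1.\<close>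
    define t where "t = (\<one> \<ominus> a) \<otimes> inv c"
    have ic: "inv c \<in> carrier R" "inv c \<otimes> c = \<one>"
      using c by simp_all
    have t: "t \<in> carrier R"
      using abcd ic by (simp add: t_def)
    have "t \<otimes> c = \<one> \<ominus> a"
      using abcd ic by (simp add: t_def m_assoc)
    then have a': "a \<oplus> t \<otimes> c = \<one>"
      using abcd by (simp add: minus_eq a_lcomm[of a] r_neg)
    define b' where "b' = b \<oplus> t \<otimes> d"
    have b': "b' \<in> carrier R"
      using abcd t by (simp add: b'_def)
    have M1: "M \<one> b' c d"
      using up[OF M t abcd] by (simp add: a' b'_def)
    have "d \<ominus> b' \<otimes> c = (a \<oplus> t \<otimes> c) \<otimes> d \<ominus> b' \<otimes> c"
      using abcd by (simp add: a')
    also have "\<dots> = a \<otimes> d \<ominus> b \<otimes> c"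
      unfolding b'_def using abcd t by algebra
    finally have d: "d \<ominus> b' \<otimes> c = \<one>"
      by (simp add: det)
    \<comment> \<open>Subtracting \<open>c\<close> times the first row clears \<open>c\<close>; the
      determinant, which row operations preserve, makes the remaining diagonal entry 1.\<close>
    have "c \<oplus> \<ominus> c \<otimes> \<one> = \<zero>" "d \<oplus> \<ominus> c \<otimes> b' = \<one>"
      using abcd b' d by (simp_all add: r_neg l_minus r_minus minus_eq m_comm)
    then have M2: "M \<one> b' \<zero> \<one>"
      using low[OF M1 _ _ b' abcd(3,4), of "\<ominus> c"] abcd by simp
    have "\<one> \<oplus> \<ominus> b' \<otimes> \<zero> = \<one>" "b' \<oplus> \<ominus> b' \<otimes> \<one> = \<zero>"
      using b' by (simp_all add: r_neg l_minus)
    then show ?thesis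
      using up[OF M2 _ _ b', of "\<ominus> b'"] b' by simp
  qed
  have M0: "M a b c d"
    unfolding M_def using one_in_words f fx fy fz x y z
    by (intro bexI[of _ "\<one>\<^bsub>cay_Aut R\<^esub>"]) (simp_all add: V_def)
  have "M \<one> \<zero> \<zero> \<one>"
  proof (cases "c \<in> Units R")
    case True
    then show ?thesis
      using c_unit[OF M0 _ det abcd] by blast
  next
    case False
    then have a: "a \<in> Units R"
      using unit by blast
    \<comment> \<open>Chosen so that the lower left entry becomes 1, a unit; this reduces to the
      case already treated.\<close>
    define t where "t = (\<one> \<ominus> c) \<otimes> inv a"
    have ia: "inv a \<in> carrier R" "inv a \<otimes> a = \<one>"
      using a by simp_all
    have t: "t \<in> carrier R"
      using abcd ia by (simp add: t_def)
    have "t \<otimes> a = \<one> \<ominus> c"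
      using abcd ia by (simp add: t_def m_assoc)
    then have c': "c \<oplus> t \<otimes> a = \<one>"
      using abcd by (simp add: minus_eq a_lcomm[of c] r_neg)
    have d': "d \<oplus> t \<otimes> b \<in> carrier R"
      using abcd t by simp
    have M1: "M a b \<one> (d \<oplus> t \<otimes> b)"
      using low[OF M0 t abcd] by (simp add: c')
    have "a \<otimes> (d \<oplus> t \<otimes> b) \<ominus> b \<otimes> \<one> = a \<otimes> (d \<oplus> t \<otimes> b) \<ominus> b \<otimes> (c \<oplus> t \<otimes> a)"
      by (simp add: c')
    also have "\<dots> = a \<otimes> d \<ominus> b \<otimes> c"
      using abcd t by algebra
    finally show ?thesis
      using c_unit[OF M1 _ _ abcd(1,2) _ d'] det by simp
  qed
  moreover have "V \<one> \<zero> = x" "V \<zero> \<one> = y"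
    unfolding V_def using x y by (simp_all add: fun_eq_iff)
  ultimately show thesis
    using that unfolding M_def by auto
qed

end

section \<open>Clearing coordinates by root elements\<close>

context cay_alg
begin

lemma positive_roots_valid: "positive_roots \<subseteq> Collect valid_root"
  by (auto simp: positive_roots_def)

lemma root_elt_mult_apply:
  assumes "valid_root \<alpha>" "t \<in> carrier R" "g \<in> \<A>" "x \<in> \<C>"
  shows "(root_elt R \<phi> \<alpha> t \<bullet> g) x = root_map R \<alpha> t (g x)"
  using assms by (simp add: root_elt_apply cay_Aut_closed)

lemma words_cancel:
  assumes \<Phi>: "\<Phi> \<subseteq> Collect valid_root" and w: "w \<in> words \<Phi> R \<phi>"
    and f: "f \<in> \<A>" and wf: "w \<bullet> f \<in> words \<Phi> R \<phi>"
  shows "f \<in> words \<Phi> R \<phi>"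
proof -
  have "f = Inv w \<bullet> (w \<bullet> f)"
    using words_closed[OF \<Phi> w] f by (simp add: A.m_assoc[symmetric])
  then show ?thesis
    using words_mult[OF \<Phi> words_inv[OF \<Phi> w] wf] by simp
qed

text \<open>Each of three positive root elements clears one of the coordinates of the image of e1
  that \<open>fix_CV3_idempotent\<close> leaves free; all three fix v3. The last clause serves the
  case where u2 is fixed as well and must remain so.\<close>

lemma reduce_CE1:
  assumes f: "f \<in> \<A>" and v3: "f (cb R (CV 3)) = cb R (CV 3)"
  obtains w where "w \<in> words positive_roots R \<phi>"
    "(w \<bullet> f) (cb R (CV 3)) = cb R (CV 3)" "(w \<bullet> f) (cb R CE1) = cb R CE1"
    "f (cb R (CU 2)) = cb R (CU 2) \<Longrightarrow> (w \<bullet> f) (cb R (CU 2)) = cb R (CU 2)"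
proof -
  define e where "e = f (cb R CE1)"
  have e: "e \<in> \<C>"
    unfolding e_def by (rule cay_Aut_closed[OF f]) simp
  note ec = fix_CV3_idempotent[OF f v3, folded e_def]
  \<comment> \<open>The root element for \<open>PosEps 1\<close> acts first and shifts the
    coordinate at \<open>CV 3\<close> by minus the product of those at \<open>CU 1\<close> and
    \<open>CU 2\<close>; the rest is what the root element for \<open>NegEps 3\<close> has to
    clear.\<close>
  define n where "n = e (CV 3) \<ominus> e (CU 1) \<otimes> e (CU 2)"
  have c: "e (CU 1) \<in> carrier R" "e (CU 2) \<in> carrier R" "e (CV 3) \<in> carrier R" "n \<in> carrier R"
    using e by (simp_all add: n_def)
  let ?x = "root_elt R \<phi> (PosEps 1) (e (CU 1))" and ?y = "root_elt R \<phi> (PosEps 2) (e (CU 2))"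
    and ?z = "root_elt R \<phi> (NegEps 3) n"
  have A: "?x \<in> \<A>" "?y \<in> \<A>" "?z \<in> \<A>"
    using c by auto
  define w where "w = ?z \<bullet> (?y \<bullet> ?x)"
  have w: "w \<in> words positive_roots R \<phi>"
    unfolding w_def using c
    by (intro root_elt_mult_in_words root_elt_in_words positive_roots_valid) (simp_all add: positive_roots_def)
  have wf: "(w \<bullet> f) x
      = root_map R (NegEps 3) n (root_map R (PosEps 2) (e (CU 2)) (root_map R (PosEps 1) (e (CU 1)) (f x)))"
    if "x \<in> \<C>" for x
  proof -
    have "w \<bullet> f = ?z \<bullet> (?y \<bullet> (?x \<bullet> f))"
      unfolding w_def using A f by (simp add: A.m_assoc)
    then show ?thesis
      using A f c that by (simp only: root_elt_mult_apply A.m_closed valid_root.simps)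
  qed
  show thesis
  proof (rule that[OF w])
    show "(w \<bullet> f) (cb R (CV 3)) = cb R (CV 3)"
      unfolding wf[OF cay_closed(3)] v3 using c by (simp add: cay_eqI index_3_reduce) (simp add: cb_def minus_eq)
    show "(w \<bullet> f) (cb R CE1) = cb R CE1"
      unfolding wf[OF cay_closed(3)] e_def[symmetric]
      using c ec by (simp add: cay_eqI index_3_reduce minus_eq r_minus r_neg n_def) (simp add: cb_def)
    assume u2: "f (cb R (CU 2)) = cb R (CU 2)"
    \<comment> \<open>Of the three factors only the one for \<open>PosEps 1\<close> can move u2. The
      relation e1 u2 = u2, read at \<open>CV 3\<close>, shows that its parameter is zero.\<close>
    have "e \<boxtimes> cb R (CU 2) = cb R (CU 2)"
      using cay_Aut_mult[OF f, of "cb R CE1" "cb R (CU 2)"] cay_mult_table(6)[OF is_cring, of 2]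
      by (simp add: u2 e_def)
    then have "(e \<boxtimes> cb R (CU 2)) (CV 3) = cb R (CU 2) (CV 3)"
      by (rule arg_cong)
    then have "e (CU 1) = \<zero>"
      using e by (simp add: cay_mult_coord minus_eq; simp add: cb_def)
    then show "(w \<bullet> f) (cb R (CU 2)) = cb R (CU 2)"
      unfolding wf[OF cay_closed(3)] u2 using c by (simp add: cay_eqI index_3_reduce) (simp add: cb_def minus_eq)
  qed
qed

text \<open>Fixing e1 preserves the span of the u vectors and fixing v3 determines the third row on
  it. The last identity is u1 u2 = v3: the coordinate at \<open>CV 3\<close> of a product in this
  span is a 2 by 2 minor.\<close>

lemma fix_CE1_CV3:
  assumes g: "g \<in> \<A>" and v3: "g (cb R (CV 3)) = cb R (CV 3)" and e1: "g (cb R CE1) = cb R CE1"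
  defines "y \<equiv> \<lambda>i. g (cb R (CU i))"
  shows "y i \<in> \<C>" "y i CE1 = \<zero>" "y i CE2 = \<zero>" "y i (CV k) = \<zero>"
    "y 1 (CU 3) = \<zero>" "y 2 (CU 3) = \<zero>" "y 3 (CU 3) = \<one>"
    "y 1 (CU 1) \<otimes> y 2 (CU 2) \<ominus> y 2 (CU 1) \<otimes> y 1 (CU 2) = \<one>"
proof -
  show c: "y i \<in> \<C>" for i
    unfolding y_def by (rule cay_Aut_closed[OF g]) simp
  show "y i CE1 = \<zero>" "y i CE2 = \<zero>" "y i (CV k) = \<zero>"
    unfolding y_def by (rule fix_CE1_coord[OF g e1])+
  show "y 1 (CU 3) = \<zero>" "y 2 (CU 3) = \<zero>" "y 3 (CU 3) = \<one>"
    unfolding y_def fix_CV3_coord[OF g v3] by (simp_all add: cb_def)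
  have "y 1 \<boxtimes> y 2 = cb R (CV 3)"
    using cay_Aut_mult[OF g, of "cb R (CU 1)" "cb R (CU 2)"] cay_mult_table(14)[OF is_cring, of 1]
    by (simp add: v3 y_def)
  then have "(y 1 \<boxtimes> y 2) (CV 3) = cb R (CV 3) (CV 3)"
    by (rule arg_cong)
  moreover have "y 1 CE2 = \<zero>" "y 1 (CV 3) = \<zero>"
    unfolding y_def by (rule fix_CE1_coord[OF g e1])+
  ultimately show "y 1 (CU 1) \<otimes> y 2 (CU 2) \<ominus> y 2 (CU 1) \<otimes> y 1 (CU 2) = \<one>"
    using c by (simp add: cay_mult_coord m_comm) (simp add: cb_def)
qed

text \<open>The image of u3 is u3 plus multiples of u1 and u2, which two long root elements remove.
  On the span of the u vectors these depend only on the coordinate at \<open>CU 3\<close>, and this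
  vanishes for the images of u1 and u2, so the 2 by 2 block is untouched.\<close>

lemma reduce_CU3:
  assumes g: "g \<in> \<A>" and v3: "g (cb R (CV 3)) = cb R (CV 3)" and e1: "g (cb R CE1) = cb R CE1"
  obtains w where "w \<in> words positive_roots R \<phi>"
    "(w \<bullet> g) (cb R (CV 3)) = cb R (CV 3)" "(w \<bullet> g) (cb R CE1) = cb R CE1"
    "(w \<bullet> g) (cb R (CU 3)) = cb R (CU 3)"
    "(w \<bullet> g) (cb R (CU 1)) = g (cb R (CU 1))" "(w \<bullet> g) (cb R (CU 2)) = g (cb R (CU 2))"
proof -
  note y = fix_CE1_CV3[OF g v3 e1]
  define r s where "r = g (cb R (CU 3)) (CU 1)" and "s = g (cb R (CU 3)) (CU 2)"
  have c: "r \<in> carrier R" "s \<in> carrier R"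
    using y(1)[of 3] by (simp_all add: r_def s_def)
  let ?x = "root_elt R \<phi> (EpsDiff 1 3) (\<ominus> r)" and ?y = "root_elt R \<phi> (EpsDiff 2 3) (\<ominus> s)"
  have A: "?x \<in> \<A>" "?y \<in> \<A>"
    using c by auto
  define w where "w = ?y \<bullet> ?x"
  have w: "w \<in> words positive_roots R \<phi>"
    unfolding w_def using c
    by (intro root_elt_mult_in_words root_elt_in_words positive_roots_valid) (simp_all add: positive_roots_def)
  have wg: "(w \<bullet> g) x = root_map R (EpsDiff 2 3) (\<ominus> s) (root_map R (EpsDiff 1 3) (\<ominus> r) (g x))"
    if "x \<in> \<C>" for x
  proof -
    have "w \<bullet> g = ?y \<bullet> (?x \<bullet> g)"
      unfolding w_def using A g by (simp add: A.m_assoc)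
    moreover have "valid_root (EpsDiff 1 3)" "valid_root (EpsDiff 2 3)"
      by simp_all
    ultimately show ?thesis
      using A g c that by (simp only: root_elt_mult_apply A.m_closed a_inv_closed)
  qed
  show thesis
  proof (rule that[OF w])
    show "(w \<bullet> g) (cb R (CV 3)) = cb R (CV 3)" "(w \<bullet> g) (cb R CE1) = cb R CE1"
      unfolding wg[OF cay_closed(3)] v3 e1 using c
      by (simp_all add: cay_eqI) (simp_all add: cb_def minus_eq)
    show "(w \<bullet> g) (cb R (CU 3)) = cb R (CU 3)"
      unfolding wg[OF cay_closed(3)] using c y
      by (simp add: cay_eqI r_neg minus_eq flip: r_def s_def) (simp add: cb_def)
    show "(w \<bullet> g) (cb R (CU 1)) = g (cb R (CU 1))" "(w \<bullet> g) (cb R (CU 2)) = g (cb R (CU 2))"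
      unfolding wg[OF cay_closed(3)] using c y
      by (simp_all add: cay_eqI minus_eq)
  qed
qed

text \<open>The pointwise stabilizer of the plane is unipotent: once e1 is fixed too, determinant 1
  leaves for u1 and u3 only off-diagonal entries, and positive root elements clear them over any
  ring, without units.\<close>

lemma fix_CU2_CV3_in_words:
  assumes f: "f \<in> \<A>" and v3: "f (cb R (CV 3)) = cb R (CV 3)"
    and u2: "f (cb R (CU 2)) = cb R (CU 2)"
  shows "f \<in> words positive_roots R \<phi>"
proof -
  note P = positive_roots_valid
  obtain w where w: "w \<in> words positive_roots R \<phi>"
    "(w \<bullet> f) (cb R (CV 3)) = cb R (CV 3)" "(w \<bullet> f) (cb R CE1) = cb R CE1"
    "(w \<bullet> f) (cb R (CU 2)) = cb R (CU 2)"
    using reduce_CE1[OF f v3] u2 by metis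
  define g where "g = w \<bullet> f"
  have g: "g \<in> \<A>"
    unfolding g_def using words_closed[OF P w(1)] f by simp
  note y = fix_CE1_CV3[OF g w(2,3)[folded g_def]]
  define q where "q = g (cb R (CU 1)) (CU 2)"
  have q: "q \<in> carrier R"
    using y(1)[of 1] by (simp add: q_def)
  \<comment> \<open>As u2 is fixed, the determinant reduces to this diagonal entry.\<close>
  have u1: "g (cb R (CU 1)) (CU 1) = \<one>"
    using y(8) y(1)[of 1] w(4) by (simp add: minus_eq flip: g_def) (simp add: cb_def)
  let ?x = "root_elt R \<phi> (EpsDiff 2 1) (\<ominus> q)"
  have x: "?x \<in> words positive_roots R \<phi>"
    using q by (intro root_elt_in_words P) (simp_all add: positive_roots_def)
  define k where "k = ?x \<bullet> g"
  have k: "k \<in> \<A>"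
    unfolding k_def using words_closed[OF P x] g by simp
  have kx: "k z = root_map R (EpsDiff 2 1) (\<ominus> q) (g z)" if "z \<in> \<C>" for z
    unfolding k_def by (rule root_elt_mult_apply) (use q g that in simp_all)
  have k_fix: "k (cb R (CV 3)) = cb R (CV 3)" "k (cb R CE1) = cb R CE1" "k (cb R (CU 2)) = cb R (CU 2)"
    unfolding kx[OF cay_closed(3)] w(2-4)[folded g_def] using q
    by (simp_all add: cay_eqI) (simp_all add: cb_def minus_eq)
  have k1: "k (cb R (CU 1)) = cb R (CU 1)"
    unfolding kx[OF cay_closed(3)] using q y u1
    by (simp add: cay_eqI r_neg minus_eq flip: q_def) (simp add: cb_def)
  obtain v where v: "v \<in> words positive_roots R \<phi>"
    "(v \<bullet> k) (cb R (CU 3)) = cb R (CU 3)"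
    "(v \<bullet> k) (cb R (CU 1)) = k (cb R (CU 1))" "(v \<bullet> k) (cb R (CU 2)) = k (cb R (CU 2))"
    using reduce_CU3[OF k k_fix(1,2)] by metis
  have "v \<bullet> k = \<one>\<^bsub>cay_Aut R\<^esub>"
  proof (rule cay_Aut_eq_one)
    show "v \<bullet> k \<in> \<A>"
      using words_closed[OF P v(1)] k by simp
    show "(v \<bullet> k) (cb R (CU i)) = cb R (CU i)" for i
      using index_3_cases[of i] v(2-4) k1 k_fix(3) by auto
  qed
  then have "v \<bullet> k \<in> words positive_roots R \<phi>"
    by (simp add: one_in_words)
  then have "k \<in> words positive_roots R \<phi>"
    by (rule words_cancel[OF P v(1) k])
  then have "g \<in> words positive_roots R \<phi>"
    unfolding k_def by (rule words_cancel[OF P x g])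
  then show ?thesis
    unfolding g_def by (rule words_cancel[OF P w(1) f])
qed

lemma words_mono: "\<Phi> \<subseteq> \<Psi> \<Longrightarrow> words \<Phi> R \<phi> \<subseteq> words \<Psi> R \<phi>"
  unfolding words_def by blast

lemma push_cay_alg: "cay_hom R L h \<Longrightarrow> cay_alg L (h \<circ> \<phi>)"
proof -
  assume "cay_hom R L h"
  then interpret h: cay_hom R L h .
  show "cay_alg L (h \<circ> \<phi>)"
    by (intro cay_alg.intro cay_alg_axioms.intro h.CS.cay_ring_axioms char3
        comm_alg_comp[OF comm_alg h.ring_hom_cring_axioms])
qed

text \<open>The root elements for \<open>PosEps 1\<close> and \<open>NegEps 1\<close> act on the
  plane of u2 and v3 as the two kinds of elementary matrices. After localization they reduce
  \<open>f\<close> to an automorphism fixing both vectors, and \<open>fix_CU2_CV3_in_words\<close>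
  finishes. The determinant condition is the unimodularity that \<open>points_local\<close>
  requires.\<close>

lemma plane_stabilizer_in_points:
  fixes I :: "'f cay_eqns"
  assumes f: "f \<in> \<A>"
    and c: "p \<in> carrier R" "q \<in> carrier R" "r \<in> carrier R" "s \<in> carrier R"
    and u2: "f (cb R (CU 2)) = p \<cdot> cb R (CU 2) \<boxplus> q \<cdot> cb R (CV 3)"
    and v3: "f (cb R (CV 3)) = r \<cdot> cb R (CU 2) \<boxplus> s \<cdot> cb R (CV 3)"
    and det: "p \<otimes> s \<ominus> r \<otimes> q = \<one>"
    and words: "\<And>(L :: (nat \<Rightarrow> 'r) set ring) h. cay_hom R L h \<Longrightarrow>
      words (insert (NegEps 1) positive_roots) L (h \<circ> \<phi>) \<subseteq> points I L (h \<circ> \<phi>)"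
  shows "f \<in> points I R \<phi>"
proof (rule points_local[OF f c(1,2) c(4) a_inv_closed[OF c(3)]])
  show "s \<otimes> p \<oplus> \<ominus> r \<otimes> q = \<one>"
    using det c by (simp add: minus_eq l_minus r_minus m_comm)
  fix L :: "(nat \<Rightarrow> 'r) set ring" and h
  assume hom: "cay_hom R L h" and unit: "h p \<in> Units L \<or> h q \<in> Units L"
  interpret h: cay_hom R L h by (rule hom)
  interpret L: cay_alg L "h \<circ> \<phi>" by (rule push_cay_alg[OF hom])
  let ?\<Phi> = "insert (NegEps 1) positive_roots"
  let ?f = "base_change R L h f"
  have \<Phi>: "?\<Phi> \<subseteq> Collect valid_root"
    using positive_roots_valid by simp
  have bf: "?f \<in> carrier (cay_Aut L)"
    by (rule h.base_change_Aut[OF f])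
  note bcb = h.base_change_cb[OF cay_Aut_linear[OF f]]
  obtain w where w: "w \<in> words ?\<Phi> L (h \<circ> \<phi>)"
    "(w \<bullet>\<^bsub>L\<^esub> ?f) (cb L (CU 2)) = cb L (CU 2)" "(w \<bullet>\<^bsub>L\<^esub> ?f) (cb L (CV 3)) = cb L (CV 3)"
  proof (rule L.sl2_elimination[OF \<Phi> bf])
    \<comment> \<open>Only two vectors have to be controlled here, so the third one of
      \<open>sl2_elimination\<close> is taken to be zero.\<close>
    show "?f \<zero>\<^bsub>cay L\<^esub> = \<zero>\<^bsub>cay L\<^esub>"
      by (rule h.CS.cay_linear_zero[OF cay_Aut_linear[OF bf]])
    show "?f (cb L (CU 2)) = h p \<cdot>\<^bsub>L\<^esub> cb L (CU 2) \<boxplus>\<^bsub>L\<^esub> h q \<cdot>\<^bsub>L\<^esub> cb L (CV 3)"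
      unfolding bcb u2 using c by (simp add: h.push_add h.push_smult)
    show "?f (cb L (CV 3)) = h r \<cdot>\<^bsub>L\<^esub> cb L (CU 2) \<boxplus>\<^bsub>L\<^esub> h s \<cdot>\<^bsub>L\<^esub> cb L (CV 3)"
      unfolding bcb v3 using c by (simp add: h.push_add h.push_smult)
    have "h (p \<otimes> s \<ominus> r \<otimes> q) = \<one>\<^bsub>L\<^esub>"
      by (simp add: det)
    then show "h p \<otimes>\<^bsub>L\<^esub> h s \<ominus>\<^bsub>L\<^esub> h r \<otimes>\<^bsub>L\<^esub> h q = \<one>\<^bsub>L\<^esub>"
      using c by (simp add: a_minus_def)
    fix t assume t: "t \<in> carrier L"
    have valid: "valid_root (NegEps 1)" "valid_root (PosEps 1)"
      by simp_all
    have mem: "PosEps 1 \<in> ?\<Phi>"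
      by (simp add: positive_roots_def)
    have m: "\<ominus>\<^bsub>L\<^esub> t \<in> carrier L"
      using t by simp
    \<comment> \<open>The root elements with parameter t send v3 to v3 - t u2 and u2 to u2 - t v3;
      hence the opposite parameter in both witnesses.\<close>
    show "\<exists>w\<in>words ?\<Phi> L (h \<circ> \<phi>). w \<zero>\<^bsub>cay L\<^esub> = \<zero>\<^bsub>cay L\<^esub> \<and> w (cb L (CU 2)) = cb L (CU 2) \<and>
        w (cb L (CV 3)) = cb L (CV 3) \<boxplus>\<^bsub>L\<^esub> t \<cdot>\<^bsub>L\<^esub> cb L (CU 2)"
    proof (intro bexI[of _ "root_elt L (h \<circ> \<phi>) (NegEps 1) (\<ominus>\<^bsub>L\<^esub> t)"] conjI)
      show "root_elt L (h \<circ> \<phi>) (NegEps 1) (\<ominus>\<^bsub>L\<^esub> t) \<zero>\<^bsub>cay L\<^esub> = \<zero>\<^bsub>cay L\<^esub>"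
        by (rule h.CS.cay_linear_zero[OF L.root_elt_linear[OF valid(1) m]])
    qed (use t in \<open>auto intro!: L.root_elt_in_words[OF \<Phi>] simp: L.root_elt_apply\<close>,
        (simp add: h.CS.cay_eqI; simp add: cb_def a_minus_def)+)
    show "\<exists>w\<in>words ?\<Phi> L (h \<circ> \<phi>). w \<zero>\<^bsub>cay L\<^esub> = \<zero>\<^bsub>cay L\<^esub> \<and> w (cb L (CV 3)) = cb L (CV 3) \<and>
        w (cb L (CU 2)) = cb L (CU 2) \<boxplus>\<^bsub>L\<^esub> t \<cdot>\<^bsub>L\<^esub> cb L (CV 3)"
    proof (intro bexI[of _ "root_elt L (h \<circ> \<phi>) (PosEps 1) (\<ominus>\<^bsub>L\<^esub> t)"] conjI)
      show "root_elt L (h \<circ> \<phi>) (PosEps 1) (\<ominus>\<^bsub>L\<^esub> t) \<zero>\<^bsub>cay L\<^esub> = \<zero>\<^bsub>cay L\<^esub>"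
        by (rule h.CS.cay_linear_zero[OF L.root_elt_linear[OF valid(2) m]])
    qed (use t mem in \<open>auto intro!: L.root_elt_in_words[OF \<Phi>] simp: L.root_elt_apply\<close>,
        (simp add: h.CS.cay_eqI; simp add: cb_def a_minus_def)+)
  qed (use c unit in auto)
  have "w \<bullet>\<^bsub>L\<^esub> ?f \<in> words positive_roots L (h \<circ> \<phi>)"
    by (rule L.fix_CU2_CV3_in_words) (use w bf L.words_closed[OF \<Phi> w(1)] in auto)
  then have "?f \<in> words ?\<Phi> L (h \<circ> \<phi>)"
    using L.words_cancel[OF \<Phi> w(1) bf] L.words_mono[of positive_roots ?\<Phi>] by blast
  then show "?f \<in> points I L (h \<circ> \<phi>)"
    using words[OF hom] by blast
qed

end

context cay_alg
begin

text \<open>Over \<open>R\<close> itself positive root elements reduce \<open>f\<close> to an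
  automorphism \<open>k\<close> that fixes e1, u3 and v3. What remains is its block of determinant 1
  on u1 and u2, for which the root elements for \<open>EpsDiff 1 2\<close> and
  \<open>EpsDiff 2 1\<close> are elementary matrices; only this block needs localization.\<close>

lemma fix_CV3_in_points:
  fixes I :: "'f cay_eqns"
  assumes f: "f \<in> \<A>" and v3: "f (cb R (CV 3)) = cb R (CV 3)"
    and words: "\<And>(L :: (nat \<Rightarrow> 'r) set ring) h. cay_hom R L h \<Longrightarrow>
      words (insert (EpsDiff 1 2) positive_roots) L (h \<circ> \<phi>) \<subseteq> points I L (h \<circ> \<phi>)"
  shows "f \<in> points I R \<phi>"
proof -
  note P = positive_roots_valid
  obtain w where w: "w \<in> words positive_roots R \<phi>"
    "(w \<bullet> f) (cb R (CV 3)) = cb R (CV 3)" "(w \<bullet> f) (cb R CE1) = cb R CE1"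
    using reduce_CE1[OF f v3] by metis
  define g where "g = w \<bullet> f"
  have g: "g \<in> \<A>"
    unfolding g_def using words_closed[OF P w(1)] f by simp
  obtain v where v: "v \<in> words positive_roots R \<phi>"
    "(v \<bullet> g) (cb R (CV 3)) = cb R (CV 3)" "(v \<bullet> g) (cb R CE1) = cb R CE1"
    "(v \<bullet> g) (cb R (CU 3)) = cb R (CU 3)"
    using reduce_CU3[OF g w(2,3)[folded g_def]] by metis
  define k where "k = v \<bullet> g"
  have vw: "v \<in> \<A>" "w \<in> \<A>"
    using words_closed[OF P] v(1) w(1) by auto
  have k: "k \<in> \<A>"
    unfolding k_def using vw g by simp
  note y = fix_CE1_CV3[OF k v(2,3)[folded k_def]]
  define i where "i = Inv (v \<bullet> w)"
  have i: "i \<in> words positive_roots R \<phi>" "i \<in> \<A>"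
    unfolding i_def using words_inv[OF P words_mult[OF P v(1) w(1)]] vw by simp_all
  have f_eq: "f = i \<bullet> k"
  proof -
    have "k = (v \<bullet> w) \<bullet> f"
      unfolding k_def g_def using vw f by (simp add: A.m_assoc)
    then show ?thesis
      unfolding i_def using A.inv_solve_left[OF f, of "v \<bullet> w" k] vw k by simp
  qed
  define a b c d where "a = k (cb R (CU 1)) (CU 1)" and "b = k (cb R (CU 2)) (CU 1)"
    and "c = k (cb R (CU 1)) (CU 2)" and "d = k (cb R (CU 2)) (CU 2)"
  have abcd: "a \<in> carrier R" "b \<in> carrier R" "c \<in> carrier R" "d \<in> carrier R"
    using y(1) by (simp_all add: a_def b_def c_def d_def)
  have u1: "k (cb R (CU 1)) = a \<cdot> cb R (CU 1) \<boxplus> c \<cdot> cb R (CU 2)"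
    using y abcd by (simp add: cay_eqI a_def c_def) (simp add: cb_def)
  have u2: "k (cb R (CU 2)) = b \<cdot> cb R (CU 1) \<boxplus> d \<cdot> cb R (CU 2)"
    using y abcd by (simp add: cay_eqI b_def d_def) (simp add: cb_def)
  have det: "a \<otimes> d \<ominus> b \<otimes> c = \<one>"
    unfolding a_def b_def c_def d_def by (rule y(8))
  show ?thesis
  proof (rule points_local[OF f abcd(1,3,4) a_inv_closed[OF abcd(2)]])
    show "d \<otimes> a \<oplus> \<ominus> b \<otimes> c = \<one>"
      using det abcd by (simp add: minus_eq l_minus r_minus m_comm)
    fix L :: "(nat \<Rightarrow> 'r) set ring" and h
    assume hom: "cay_hom R L h" and unit: "h a \<in> Units L \<or> h c \<in> Units L"
    interpret h: cay_hom R L h by (rule hom)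
    interpret L: cay_alg L "h \<circ> \<phi>" by (rule push_cay_alg[OF hom])
    let ?\<Phi> = "insert (EpsDiff 1 2) positive_roots"
    let ?k = "base_change R L h k"
    have \<Phi>: "?\<Phi> \<subseteq> Collect valid_root"
      using positive_roots_valid by simp
    have bk: "?k \<in> carrier (cay_Aut L)"
      by (rule h.base_change_Aut[OF k])
    note bcb = h.base_change_cb[OF cay_Aut_linear[OF k]]
    obtain s where s: "s \<in> words ?\<Phi> L (h \<circ> \<phi>)" "(s \<bullet>\<^bsub>L\<^esub> ?k) (cb L (CU 3)) = cb L (CU 3)"
      "(s \<bullet>\<^bsub>L\<^esub> ?k) (cb L (CU 1)) = cb L (CU 1)" "(s \<bullet>\<^bsub>L\<^esub> ?k) (cb L (CU 2)) = cb L (CU 2)"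
    proof (rule L.sl2_elimination[OF \<Phi> bk])
      show "?k (cb L (CU 3)) = cb L (CU 3)"
        unfolding bcb using v(4) by (simp add: k_def)
      show "?k (cb L (CU 1)) = h a \<cdot>\<^bsub>L\<^esub> cb L (CU 1) \<boxplus>\<^bsub>L\<^esub> h c \<cdot>\<^bsub>L\<^esub> cb L (CU 2)"
        unfolding bcb u1 using abcd by (simp add: h.push_add h.push_smult)
      show "?k (cb L (CU 2)) = h b \<cdot>\<^bsub>L\<^esub> cb L (CU 1) \<boxplus>\<^bsub>L\<^esub> h d \<cdot>\<^bsub>L\<^esub> cb L (CU 2)"
        unfolding bcb u2 using abcd by (simp add: h.push_add h.push_smult)
      have "h (a \<otimes> d \<ominus> b \<otimes> c) = \<one>\<^bsub>L\<^esub>"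
        by (simp add: det)
      then show "h a \<otimes>\<^bsub>L\<^esub> h d \<ominus>\<^bsub>L\<^esub> h b \<otimes>\<^bsub>L\<^esub> h c = \<one>\<^bsub>L\<^esub>"
        using abcd by (simp add: a_minus_def)
      fix t assume t: "t \<in> carrier L"
      have mem: "EpsDiff 2 1 \<in> ?\<Phi>"
        by (simp add: positive_roots_def)
      show "\<exists>w\<in>words ?\<Phi> L (h \<circ> \<phi>). w (cb L (CU 3)) = cb L (CU 3) \<and> w (cb L (CU 1)) = cb L (CU 1) \<and>
          w (cb L (CU 2)) = cb L (CU 2) \<boxplus>\<^bsub>L\<^esub> t \<cdot>\<^bsub>L\<^esub> cb L (CU 1)"
        by (intro bexI[of _ "root_elt L (h \<circ> \<phi>) (EpsDiff 1 2) t"] conjI L.root_elt_in_words[OF \<Phi>])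
          (use t in \<open>auto simp: L.root_elt_apply\<close>, (simp add: h.CS.cay_eqI; simp add: cb_def a_minus_def)+)
      show "\<exists>w\<in>words ?\<Phi> L (h \<circ> \<phi>). w (cb L (CU 3)) = cb L (CU 3) \<and> w (cb L (CU 2)) = cb L (CU 2) \<and>
          w (cb L (CU 1)) = cb L (CU 1) \<boxplus>\<^bsub>L\<^esub> t \<cdot>\<^bsub>L\<^esub> cb L (CU 2)"
        by (intro bexI[of _ "root_elt L (h \<circ> \<phi>) (EpsDiff 2 1) t"] conjI L.root_elt_in_words[OF \<Phi>] mem)
          (use t in \<open>auto simp: L.root_elt_apply\<close>, (simp add: h.CS.cay_eqI; simp add: cb_def a_minus_def)+)
    qed (use abcd unit in auto)
    have sk: "s \<bullet>\<^bsub>L\<^esub> ?k \<in> carrier (cay_Aut L)"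
      using L.words_closed[OF \<Phi> s(1)] bk by simp
    have "s \<bullet>\<^bsub>L\<^esub> ?k = \<one>\<^bsub>cay_Aut L\<^esub>"
    proof (rule h.CS.cay_Aut_eq_one[OF sk])
      show "(s \<bullet>\<^bsub>L\<^esub> ?k) (cb L (CU i)) = cb L (CU i)" for i
        using index_3_cases[of i] s(2-4) by auto
    qed
    then have "s \<bullet>\<^bsub>L\<^esub> ?k \<in> words ?\<Phi> L (h \<circ> \<phi>)"
      by (simp add: L.one_in_words)
    then have k': "?k \<in> words ?\<Phi> L (h \<circ> \<phi>)"
      by (rule L.words_cancel[OF \<Phi> s(1) bk])
    have "base_change R L h i \<in> words positive_roots L (h \<circ> \<phi>)"
      by (rule L.base_change_words[OF P i(1) cay_alg_axioms hom]) simp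
    then have "base_change R L h i \<in> words ?\<Phi> L (h \<circ> \<phi>)"
      using L.words_mono[of positive_roots ?\<Phi>] by blast
    then have "base_change R L h f \<in> words ?\<Phi> L (h \<circ> \<phi>)"
      unfolding f_eq h.base_change_mult[OF i(2) k] by (rule L.words_mult[OF \<Phi> _ k'])
    then show "base_change R L h f \<in> points I L (h \<circ> \<phi>)"
      using words[OF hom] by blast
  qed
qed

end

section \<open>Closed subgroups\<close>

abbreviation entry :: "cay_basis \<Rightarrow> cay_basis \<Rightarrow> ((cay_basis \<times> cay_basis) \<Rightarrow>\<^sub>0 nat) \<Rightarrow>\<^sub>0 'f::field" where
  "entry a b \<equiv> Poly_Mapping.single (Poly_Mapping.single (a, b) 1) 1"

abbreviation scalar :: "'f::field \<Rightarrow> ((cay_basis \<times> cay_basis) \<Rightarrow>\<^sub>0 nat) \<Rightarrow>\<^sub>0 'f" where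
  "scalar c \<equiv> Poly_Mapping.single 0 c"

text \<open>The entries of the difference of the two products of \<open>f\<close> and \<tau>, with
  the entries of \<open>f\<close> as variables.\<close>

definition centralizer_eqns :: "'f::field cay_map \<Rightarrow> 'f cay_eqns" where
  "centralizer_eqns \<tau> = {(\<Sum>b\<in>UNIV. entry a b * scalar (\<tau> (cb base_ring c) b))
      - (\<Sum>b\<in>UNIV. scalar (\<tau> (cb base_ring b) a) * entry b c) | a c. True}"

text \<open>By the adjoint formula for the inverse, the second family of equations says that the inverse
  stabilizes the span of B, too.\<close>

definition stabilizer_eqns :: "cay_basis set \<Rightarrow> 'f::field cay_eqns" where
  "stabilizer_eqns B = {entry a b | a b. b \<in> B \<and> a \<notin> B} \<union> {entry (dual b) (dual a) | a b. b \<in> B \<and> a \<notin> B}"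

context alg_point
begin

lemma mpoly_eval_sum:
  assumes "finite A"
  shows "mpoly_eval R \<phi> a (\<Sum>i\<in>A. f i) = (\<Oplus>i\<in>A. mpoly_eval R \<phi> a (f i))"
  using assms by (induction A rule: finite_induct) (simp_all add: mpoly_eval_add Pi_def)

lemma mpoly_eval_diff: "mpoly_eval R \<phi> a (p - q) = mpoly_eval R \<phi> a p \<ominus> mpoly_eval R \<phi> a q"
proof -
  interpret e: ring_hom_cring ring_of_type_algebra R "mpoly_eval R \<phi> a"
    by (rule mpoly_eval_hom)
  have "mpoly_eval R \<phi> a (p + - q) = mpoly_eval R \<phi> a p \<ominus> mpoly_eval R \<phi> a q"
    using e.hom_a_inv[of q] by (simp add: mpoly_eval_add[of p "- q"] minus_eq del: add_uminus_conv_diff)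
  then show ?thesis by simp
qed

lemma mpoly_eval_var: "mpoly_eval R \<phi> a (Poly_Mapping.single (Poly_Mapping.single x 1) 1) = a x"
  by (simp add: monom_eval_def)

end

lemma points_centralizer_eqns:
  assumes \<tau>: "\<tau> \<in> carrier (cay_Aut base_ring)" and \<phi>: "comm_alg R \<phi>"
  shows "cay_extend R \<phi> \<tau> \<in> carrier (cay_Aut R)"
    "points (centralizer_eqns \<tau>) R \<phi> = centralizer_points \<tau> R \<phi>"
proof -
  interpret h: cay_hom base_ring R \<phi>
    unfolding cay_hom_def by (rule \<phi>)
  have ext: "cay_extend R \<phi> \<tau> = base_change base_ring R \<phi> \<tau>"
    by (simp add: cay_extend_def base_change_def)
  show t: "cay_extend R \<phi> \<tau> \<in> carrier (cay_Aut R)"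
    unfolding ext by (rule h.base_change_Aut[OF \<tau>])
  let ?t = "cay_extend R \<phi> \<tau>"
  note tl = cay_Aut_linear[OF t]
  have t_cb: "?t (cb R c) b = \<phi> (\<tau> (cb base_ring c) b)" for b c
    unfolding ext h.base_change_cb[OF cay_Aut_linear[OF \<tau>]] by simp
  have "(\<forall>p\<in>centralizer_eqns \<tau>. mpoly_eval R \<phi> (\<lambda>(a, b). f (cb R b) a) p = \<zero>\<^bsub>R\<^esub>) \<longleftrightarrow>
      f \<bullet>\<^bsub>R\<^esub> ?t = ?t \<bullet>\<^bsub>R\<^esub> f" if f: "f \<in> carrier (cay_Aut R)" for f
  proof -
    note fl = cay_Aut_linear[OF f] and fc = cay_Aut_closed[OF f h.CS.cay_closed(3)]
    interpret e: alg_point R \<phi> "\<lambda>(a, b). f (cb R b) a"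
      by (intro alg_point.intro alg_point_axioms.intro h.CS.cay_ring_axioms \<phi>) (use fc in auto)
    have eval: "mpoly_eval R \<phi> (\<lambda>(a, b). f (cb R b) a)
        ((\<Sum>b\<in>UNIV. entry a b * scalar (\<tau> (cb base_ring c) b)) - (\<Sum>b\<in>UNIV. scalar (\<tau> (cb base_ring b) a) * entry b c))
        = f (?t (cb R c)) a \<ominus>\<^bsub>R\<^esub> ?t (f (cb R c)) a" for a c
    proof -
      have "f (?t (cb R c)) a = (\<Oplus>\<^bsub>R\<^esub>b\<in>UNIV. f (cb R b) a \<otimes>\<^bsub>R\<^esub> \<phi> (\<tau> (cb base_ring c) b))"
        using h.CS.cay_linear_expand[OF fl cay_Aut_closed[OF t h.CS.cay_closed(3)], of c a] by (simp add: t_cb)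
      moreover have "?t (f (cb R c)) a = (\<Oplus>\<^bsub>R\<^esub>b\<in>UNIV. \<phi> (\<tau> (cb base_ring b) a) \<otimes>\<^bsub>R\<^esub> f (cb R c) b)"
        using h.CS.cay_linear_expand[OF tl fc, of c a] by (simp add: t_cb)
      moreover have "mpoly_eval R \<phi> (\<lambda>(a, b). f (cb R b) a) (scalar r) = \<phi> r" for r
        by simp
      ultimately show ?thesis
        by (simp only: e.mpoly_eval_diff e.mpoly_eval_sum[OF finite] e.mpoly_eval_mult e.mpoly_eval_var case_prod_conv)
    qed
    have cl: "f (?t (cb R c)) a \<in> carrier R" "?t (f (cb R c)) a \<in> carrier R" for a c
      using cay_Aut_closed[OF f cay_Aut_closed[OF t h.CS.cay_closed(3)]] cay_Aut_closed[OF t fc] by simp_all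
    have "(\<forall>p\<in>centralizer_eqns \<tau>. mpoly_eval R \<phi> (\<lambda>(a, b). f (cb R b) a) p = \<zero>\<^bsub>R\<^esub>)
        \<longleftrightarrow> (\<forall>a c. f (?t (cb R c)) a \<ominus>\<^bsub>R\<^esub> ?t (f (cb R c)) a = \<zero>\<^bsub>R\<^esub>)"
      unfolding centralizer_eqns_def eval[symmetric] by blast
    also have "\<dots> \<longleftrightarrow> (\<forall>c. f (?t (cb R c)) = ?t (f (cb R c)))"
      using cl by (simp add: fun_eq_iff) blast
    also have "\<dots> \<longleftrightarrow> f \<bullet>\<^bsub>R\<^esub> ?t = ?t \<bullet>\<^bsub>R\<^esub> f"
    proof
      assume eq: "\<forall>c. f (?t (cb R c)) = ?t (f (cb R c))"
      show "f \<bullet>\<^bsub>R\<^esub> ?t = ?t \<bullet>\<^bsub>R\<^esub> f"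
        by (rule h.CS.cay_Aut_eqI) (use f t eq in simp_all)
    next
      assume "f \<bullet>\<^bsub>R\<^esub> ?t = ?t \<bullet>\<^bsub>R\<^esub> f"
      then show "\<forall>c. f (?t (cb R c)) = ?t (f (cb R c))"
        using f t by (metis h.CS.cay_Aut_comp_apply h.CS.cay_closed(3))
    qed
    finally show ?thesis .
  qed
  then show "points (centralizer_eqns \<tau>) R \<phi> = centralizer_points \<tau> R \<phi>"
    unfolding points_def centralizer_points_def by blast
qed

lemma closed_subgroup_centralizer:
  fixes \<tau> :: "'f::field cay_map"
  assumes \<tau>: "\<tau> \<in> carrier (cay_Aut base_ring)"
  shows "closed_subgroup (centralizer_eqns \<tau>)"
  unfolding closed_subgroup_def
proof (intro allI impI)
  fix R :: "'f test ring" and \<phi> :: "'f \<Rightarrow> 'f test"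
  assume \<phi>: "comm_alg R \<phi>"
  interpret h: cay_hom base_ring R \<phi>
    unfolding cay_hom_def by (rule \<phi>)
  note t = points_centralizer_eqns[OF \<tau> \<phi>]
  show "subgroup (points (centralizer_eqns \<tau>) R \<phi>) (cay_Aut R)"
    unfolding t(2)
  proof (rule h.CS.A.subgroupI)
    show "centralizer_points \<tau> R \<phi> \<noteq> {}"
      using t(1) by (auto simp: centralizer_points_def intro!: exI[of _ "\<one>\<^bsub>cay_Aut R\<^esub>"])
    fix f assume f: "f \<in> centralizer_points \<tau> R \<phi>"
    then show "Inv\<^bsub>R\<^esub> f \<in> centralizer_points \<tau> R \<phi>"
      using t(1) by (auto simp: centralizer_points_def) (metis h.CS.A.inv_closed h.CS.A.inv_solve_left h.CS.A.inv_solve_right h.CS.A.m_assoc h.CS.A.m_closed)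
    fix g assume "g \<in> centralizer_points \<tau> R \<phi>"
    with f show "f \<bullet>\<^bsub>R\<^esub> g \<in> centralizer_points \<tau> R \<phi>"
      using t(1) by (auto simp: centralizer_points_def) (metis h.CS.A.m_assoc)
  qed (auto simp: centralizer_points_def)
qed

lemma points_stabilizer:
  assumes \<phi>: "comm_alg R \<phi>"
  shows "f \<in> points (stabilizer_eqns B) R \<phi> \<longleftrightarrow> f \<in> carrier (cay_Aut R) \<and>
    (\<forall>b\<in>B. \<forall>a. a \<notin> B \<longrightarrow> f (cb R b) a = \<zero>\<^bsub>R\<^esub> \<and> (Inv\<^bsub>R\<^esub> f) (cb R b) a = \<zero>\<^bsub>R\<^esub>)"
proof (cases "f \<in> carrier (cay_Aut R)")
  case f: True
  interpret h: cay_hom base_ring R \<phi>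
    unfolding cay_hom_def by (rule \<phi>)
  interpret e: alg_point R \<phi> "\<lambda>(a, b). f (cb R b) a"
    by (intro alg_point.intro alg_point_axioms.intro h.CS.cay_ring_axioms \<phi>)
      (use cay_Aut_closed[OF f h.CS.cay_closed(3)] in auto)
  have "mpoly_eval R \<phi> (\<lambda>(a, b). f (cb R b) a) (entry a b) = f (cb R b) a" for a b
    by (simp only: e.mpoly_eval_var case_prod_conv)
  note eval = this
  let ?e = "mpoly_eval R \<phi> (\<lambda>(a, b). f (cb R b) a)"
  have "(\<forall>p\<in>stabilizer_eqns B. ?e p = \<zero>\<^bsub>R\<^esub>) \<longleftrightarrow>
      (\<forall>b\<in>B. \<forall>a. a \<notin> B \<longrightarrow> ?e (entry a b) = \<zero>\<^bsub>R\<^esub> \<and> ?e (entry (dual b) (dual a)) = \<zero>\<^bsub>R\<^esub>)"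
    unfolding stabilizer_eqns_def by blast
  then show ?thesis
    unfolding points_def h.CS.cay_Aut_inv_coord[OF f] eval using f by blast
qed (simp add: points_def)

text \<open>In the expansion of an entry of a product one factor of each summand vanishes, depending
  on whether the middle index lies in \<open>B\<close>. Closure under inversion is built into the
  equations.\<close>

lemma closed_subgroup_stabilizer: "closed_subgroup (stabilizer_eqns B :: 'f::field cay_eqns)"
  unfolding closed_subgroup_def
proof (intro allI impI)
  fix R :: "'f test ring" and \<phi> :: "'f \<Rightarrow> 'f test"
  assume \<phi>: "comm_alg R \<phi>"
  interpret h: cay_hom base_ring R \<phi>
    unfolding cay_hom_def by (rule \<phi>)
  have prod: "(f \<bullet>\<^bsub>R\<^esub> g) (cb R b) a = \<zero>\<^bsub>R\<^esub>"
    if f: "f \<in> carrier (cay_Aut R)" "\<And>a b. b \<in> B \<Longrightarrow> a \<notin> B \<Longrightarrow> f (cb R b) a = \<zero>\<^bsub>R\<^esub>"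
      and g: "g \<in> carrier (cay_Aut R)" "\<And>a b. b \<in> B \<Longrightarrow> a \<notin> B \<Longrightarrow> g (cb R b) a = \<zero>\<^bsub>R\<^esub>"
      and b: "b \<in> B" and a: "a \<notin> B" for f g a b
  proof -
    note gc = cay_Aut_closed[OF g(1) h.CS.cay_closed(3)] and fc = cay_Aut_closed[OF f(1) h.CS.cay_closed(3)]
    have "(f \<bullet>\<^bsub>R\<^esub> g) (cb R b) a = (\<Oplus>\<^bsub>R\<^esub>c\<in>UNIV. f (cb R c) a \<otimes>\<^bsub>R\<^esub> g (cb R b) c)"
      using h.CS.cay_linear_expand[OF cay_Aut_linear[OF f(1)] gc] f(1) g(1) by simp
    also have "\<dots> = \<zero>\<^bsub>R\<^esub>"
    proof (rule h.S.add.finprod_one_eqI)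
      fix c
      show "f (cb R c) a \<otimes>\<^bsub>R\<^esub> g (cb R b) c = \<zero>\<^bsub>R\<^esub>"
        using f(2)[of c a] g(2)[of b c] a b fc gc by (cases "c \<in> B") simp_all
    qed
    finally show ?thesis .
  qed
  show "subgroup (points (stabilizer_eqns B) R \<phi>) (cay_Aut R)"
  proof (rule h.CS.A.subgroupI)
    have "\<one>\<^bsub>cay_Aut R\<^esub> \<in> points (stabilizer_eqns B) R \<phi>"
    proof -
      have "\<one>\<^bsub>cay_Aut R\<^esub> (cb R b) a = \<zero>\<^bsub>R\<^esub>" if "b \<in> B" "a \<notin> B" for a b
      proof -
        have "a \<noteq> b"
          using that by blast
        then show ?thesis
          unfolding h.CS.cay_Aut_one_apply[OF h.CS.cay_closed(3)] by (simp add: cb_def)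
      qed
      then show ?thesis
        unfolding points_stabilizer[OF \<phi>] by simp
    qed
    then show "points (stabilizer_eqns B) R \<phi> \<noteq> {}"
      by blast
    fix f assume f: "f \<in> points (stabilizer_eqns B) R \<phi>"
    then show "Inv\<^bsub>R\<^esub> f \<in> points (stabilizer_eqns B) R \<phi>"
      unfolding points_stabilizer[OF \<phi>] by simp
    fix g assume g: "g \<in> points (stabilizer_eqns B) R \<phi>"
    show "f \<bullet>\<^bsub>R\<^esub> g \<in> points (stabilizer_eqns B) R \<phi>"
    proof -
      have fg: "f \<in> carrier (cay_Aut R)" "g \<in> carrier (cay_Aut R)"
        "Inv\<^bsub>R\<^esub> f \<in> carrier (cay_Aut R)" "Inv\<^bsub>R\<^esub> g \<in> carrier (cay_Aut R)"
        using f g by (simp_all add: points_def)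
      have zero: "f (cb R b) a = \<zero>\<^bsub>R\<^esub>" "(Inv\<^bsub>R\<^esub> f) (cb R b) a = \<zero>\<^bsub>R\<^esub>"
        "g (cb R b) a = \<zero>\<^bsub>R\<^esub>" "(Inv\<^bsub>R\<^esub> g) (cb R b) a = \<zero>\<^bsub>R\<^esub>"
        if "b \<in> B" "a \<notin> B" for a b
        using f g that unfolding points_stabilizer[OF \<phi>] by blast+
      \<comment> \<open>The inverse of the product reverses the factors, so \<open>prod\<close> is
        used a second time for the two inverses.\<close>
      show ?thesis
        unfolding points_stabilizer[OF \<phi>] h.CS.A.inv_mult_group[OF fg(1,2)]
        using prod[OF fg(1) zero(1) fg(2) zero(3)] prod[OF fg(4) zero(4) fg(3) zero(2)] fg
        by simp
    qed
  qed (auto simp: points_def)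
qed

section \<open>Invariants of the parabolic subgroups\<close>

context cay_ring
begin

text \<open>\<open>S\<close> may be a linear map such as \<open>plane_map\<close> or a constant. The
  scalars of \<open>f\<close> and of its inverse need not be inverse to each other, as values of
  \<open>S\<close> may have torsion; but their product acts as the identity on these values, and the
  four scalars of the commutator cancel.\<close>

lemma commutator_invariant:
  assumes f: "f \<in> \<A>" and g: "g \<in> \<A>"
    and S: "\<And>x. x \<in> \<C> \<Longrightarrow> S x \<in> \<C>"
    and semi: "\<And>k. k \<in> {f, g, Inv f, Inv g} \<Longrightarrow>
      \<exists>d\<in>carrier R. \<forall>x\<in>\<C>. k (S x) = d \<cdot> S (k x)"
    and x: "x \<in> \<C>"
  defines "k \<equiv> f \<bullet> g \<bullet> Inv f \<bullet> Inv g"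
  shows "k (S x) = S (k x)"
proof -
  let ?f = "Inv f" and ?g = "Inv g"
  have i: "?f \<in> \<A>" "?g \<in> \<A>"
    using f g by simp_all
  note cl = cay_Aut_closed[OF f] cay_Aut_closed[OF g] cay_Aut_closed[OF i(1)] cay_Aut_closed[OF i(2)]
  obtain a where a: "a \<in> carrier R" "\<And>x. x \<in> \<C> \<Longrightarrow> f (S x) = a \<cdot> S (f x)"
    using semi[of f] by auto
  obtain b where b: "b \<in> carrier R" "\<And>x. x \<in> \<C> \<Longrightarrow> g (S x) = b \<cdot> S (g x)"
    using semi[of g] by auto
  obtain a' where a': "a' \<in> carrier R" "\<And>x. x \<in> \<C> \<Longrightarrow> ?f (S x) = a' \<cdot> S (?f x)"
    using semi[of ?f] by auto
  obtain b' where b': "b' \<in> carrier R" "\<And>x. x \<in> \<C> \<Longrightarrow> ?g (S x) = b' \<cdot> S (?g x)"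
    using semi[of ?g] by auto
  have smult: "r \<cdot> (s \<cdot> y) = (r \<otimes> s) \<cdot> y"
    if "r \<in> carrier R" "s \<in> carrier R" "y \<in> \<C>" for r s y
    using that by (simp add: fun_eq_iff m_assoc)
  \<comment> \<open>Obtained by moving \<open>S y\<close> through \<open>f\<close> and back through
    its inverse.\<close>
  have aa: "(a \<otimes> a') \<cdot> S y = S y" if y: "y \<in> \<C>" for y
  proof -
    have "S y = ?f (f (S y))"
      using f S[OF y] by simp
    also have "\<dots> = a \<cdot> (a' \<cdot> S (?f (f y)))"
      using a a' y S cl f by (simp only: cay_Aut_smult[OF i(1)])
    finally show ?thesis
      using f y a a' S by (simp only: cay_Aut_inv_apply smult)
  qed
  have bb: "(b \<otimes> b') \<cdot> S y = S y" if y: "y \<in> \<C>" for y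
  proof -
    have "S y = ?g (g (S y))"
      using g S[OF y] by simp
    also have "\<dots> = b \<cdot> (b' \<cdot> S (?g (g y)))"
      using b b' y S cl g by (simp only: cay_Aut_smult[OF i(2)])
    finally show ?thesis
      using g y b b' S by (simp only: cay_Aut_inv_apply smult)
  qed
  have k: "k y = f (g (?f (?g y)))" if "y \<in> \<C>" for y
    unfolding k_def using f g i that cl by simp
  have kx: "k x \<in> \<C>"
    using k[OF x] cl x by simp
  have "k (S x) = b' \<cdot> (a' \<cdot> (b \<cdot> (a \<cdot> S (k x))))"
    unfolding k[OF S[OF x]] k[OF x] using a b a' b' x S cl
    by (simp only: cay_Aut_smult[OF f] cay_Aut_smult[OF g] cay_Aut_smult[OF i(1)] cay_closed)
  also have "\<dots> = (a \<otimes> a') \<cdot> ((b \<otimes> b') \<cdot> S (k x))"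
    using a b a' b' S[OF kx] by (simp add: fun_eq_iff m_ac)
  also have "\<dots> = S (k x)"
    by (simp only: aa bb kx)
  finally show ?thesis .
qed

lemma cay_Aut_commute_iff:
  assumes f: "f \<in> \<A>" and g: "g \<in> \<A>"
    and D: "\<And>y. y \<in> \<C> \<Longrightarrow> D y \<in> \<C>"
      "\<And>y. y \<in> \<C> \<Longrightarrow> g y = y \<boxplus> D y"
  shows "f \<bullet> g = g \<bullet> f \<longleftrightarrow> (\<forall>y\<in>\<C>. f (D y) = D (f y))"
proof -
  interpret C: abelian_group "cay R"
    by (rule cay_abelian_group)
  note fc = cay_Aut_closed[OF f]
  have eq: "f (g y) = g (f y) \<longleftrightarrow> f (D y) = D (f y)" if y: "y \<in> \<C>" for y
  proof -
    have "f (g y) = f y \<boxplus> f (D y)"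
      unfolding D(2)[OF y] by (rule cay_Aut_add[OF f y D(1)[OF y]])
    moreover have "g (f y) = f y \<boxplus> D (f y)"
      by (rule D(2)[OF fc[OF y]])
    ultimately show ?thesis
      using C.add.l_cancel[OF _ fc[OF D(1)[OF y]] D(1)[OF fc[OF y]] fc[OF y]] by auto
  qed
  have "f \<bullet> g = g \<bullet> f \<longleftrightarrow> (\<forall>y\<in>\<C>. f (g y) = g (f y))"
  proof
    assume eq: "f \<bullet> g = g \<bullet> f"
    show "\<forall>y\<in>\<C>. f (g y) = g (f y)"
      using cay_Aut_comp_apply[OF f g] cay_Aut_comp_apply[OF g f] eq by simp
  next
    assume "\<forall>y\<in>\<C>. f (g y) = g (f y)"
    then show "f \<bullet> g = g \<bullet> f"
      using f g by (intro cay_Aut_ext) simp_all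
  qed
  then show ?thesis
    using eq by simp
qed

lemma cay_Aut_eq_on_CU:
  assumes f: "f \<in> \<A>" and g: "g \<in> \<A>"
    and u: "\<And>i. f (cb R (CU i)) = g (cb R (CU i))"
  shows "f = g"
proof -
  have "Inv g \<bullet> f = \<one>\<^bsub>cay_Aut R\<^esub>"
    by (rule cay_Aut_eq_one) (use f g in \<open>simp_all add: u\<close>)
  then show ?thesis
    using f g by (metis A.inv_closed A.inv_equality A.inv_inv)
qed

text \<open>The derivation given by the wedge product of the second u and the third v. Hence an automorphism that
  preserves the plane spanned by them scales it by the determinant.\<close>

definition plane_map :: "'r cay_map" where
  "plane_map y = y (CU 3) \<cdot> cb R (CU 2) \<ominus>\<^bsub>cay R\<^esub> y (CV 2) \<cdot> cb R (CV 3)"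

lemma plane_map_closed: "y \<in> \<C> \<Longrightarrow> plane_map y \<in> \<C>"
  by (simp add: plane_map_def)

text \<open>The coordinates at \<open>CU 3\<close> and \<open>CV 2\<close> are the polar pairings
  with v3 and u2, so \<open>plane_map\<close> is an alternating expression in these two vectors. The
  isometry \<open>f\<close> replaces them by their images, and the determinant factors out.\<close>

lemma plane_map_semi_invariant:
  assumes f: "f \<in> \<A>"
    and c: "p \<in> carrier R" "q \<in> carrier R" "r \<in> carrier R" "s \<in> carrier R"
    and u2: "f (cb R (CU 2)) = p \<cdot> cb R (CU 2) \<boxplus> q \<cdot> cb R (CV 3)"
    and v3: "f (cb R (CV 3)) = r \<cdot> cb R (CU 2) \<boxplus> s \<cdot> cb R (CV 3)"
    and x: "x \<in> \<C>"
  shows "f (plane_map x) = (p \<otimes> s \<ominus> r \<otimes> q) \<cdot> plane_map (f x)"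
proof -
  define z where "z = f x"
  have z: "z \<in> \<C>"
    unfolding z_def by (rule cay_Aut_closed[OF f x])
  define \<beta> \<gamma> where "\<beta> = z (CV 2)" and "\<gamma> = z (CU 3)"
  have zc: "\<beta> \<in> carrier R" "\<gamma> \<in> carrier R"
    using z by (simp_all add: \<beta>_def \<gamma>_def)
  have polar: "cay_polar R (a \<cdot> cb R (CU 2) \<boxplus> b \<cdot> cb R (CV 3)) z = a \<otimes> \<beta> \<oplus> b \<otimes> \<gamma>"
    if "a \<in> carrier R" "b \<in> carrier R" for a b
    using that z by (simp add: cay_polar_eq \<beta>_def \<gamma>_def) (simp add: cb_def m_comm)
  have x3: "x (CU 3) = r \<otimes> \<beta> \<oplus> s \<otimes> \<gamma>"
    using cay_polar_cb[OF x, of "CV 3"] cay_Aut_polar[OF f, of "cb R (CV 3)" x] x polar[OF c(3,4)]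
    by (simp add: v3 flip: z_def)
  have x2: "x (CV 2) = p \<otimes> \<beta> \<oplus> q \<otimes> \<gamma>"
    using cay_polar_cb[OF x, of "CU 2"] cay_Aut_polar[OF f, of "cb R (CU 2)" x] x polar[OF c(1,2)]
    by (simp add: u2 flip: z_def)
  have "f (plane_map x) = x (CU 3) \<cdot> f (cb R (CU 2)) \<ominus>\<^bsub>cay R\<^esub> x (CV 2) \<cdot> f (cb R (CV 3))"
    unfolding plane_map_def using x
    by (simp only: cay_linear_diff[OF cay_Aut_linear[OF f]] cay_Aut_smult[OF f] cay_closed cay_coord_closed)
  moreover have "(r \<otimes> \<beta> \<oplus> s \<otimes> \<gamma>) \<otimes> p \<ominus> (p \<otimes> \<beta> \<oplus> q \<otimes> \<gamma>) \<otimes> r = (p \<otimes> s \<ominus> r \<otimes> q) \<otimes> \<gamma>"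
    "(r \<otimes> \<beta> \<oplus> s \<otimes> \<gamma>) \<otimes> q \<ominus> (p \<otimes> \<beta> \<oplus> q \<otimes> \<gamma>) \<otimes> s = \<ominus> ((p \<otimes> s \<ominus> r \<otimes> q) \<otimes> \<beta>)"
    using c zc by algebra+
  ultimately show ?thesis
    unfolding u2 v3 x2 x3 z_def[symmetric] plane_map_def \<beta>_def[symmetric] \<gamma>_def[symmetric] using c zc
    by (simp add: cay_eqI; simp add: cb_def minus_eq r_minus)
qed

text \<open>The plane is the image of \<open>plane_map\<close>, so commuting with that map forces
  the plane to be preserved. The determinant is found as the pairing of the images of u2 and
  v2.\<close>

lemma plane_map_commute_imp:
  assumes f: "f \<in> \<A>"
    and comm: "\<And>y. y \<in> \<C> \<Longrightarrow> f (plane_map y) = plane_map (f y)"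
  obtains p q r s where "p \<in> carrier R" "q \<in> carrier R" "r \<in> carrier R" "s \<in> carrier R"
    "f (cb R (CU 2)) = p \<cdot> cb R (CU 2) \<boxplus> q \<cdot> cb R (CV 3)"
    "f (cb R (CV 3)) = r \<cdot> cb R (CU 2) \<boxplus> s \<cdot> cb R (CV 3)"
    "p \<otimes> s \<ominus> r \<otimes> q = \<one>"
proof -
  define y z where "y = f (cb R (CU 3))" and "z = f (cb R (CV 2))"
  have yz: "y \<in> \<C>" "z \<in> \<C>"
    unfolding y_def z_def by (simp_all add: cay_Aut_closed[OF f])
  \<comment> \<open>Preimages of u2 and v3: the images of these vectors are then
    \<open>plane_map\<close> of known vectors, which gives the four matrix entries below, signs
    included.\<close>
  have m: "plane_map (cb R (CU 3)) = cb R (CU 2)" "plane_map (\<ominus>\<^bsub>cay R\<^esub> cb R (CV 2)) = cb R (CV 3)"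
    unfolding plane_map_def by (simp_all add: cay_eqI) (simp_all add: cb_def minus_eq)
  define p q r s where "p = y (CU 3)" and "q = \<ominus> y (CV 2)" and "r = \<ominus> z (CU 3)" and "s = z (CV 2)"
  have c: "p \<in> carrier R" "q \<in> carrier R" "r \<in> carrier R" "s \<in> carrier R"
    using yz by (simp_all add: p_def q_def r_def s_def)
  have u2: "f (cb R (CU 2)) = p \<cdot> cb R (CU 2) \<boxplus> q \<cdot> cb R (CV 3)"
  proof -
    have "f (cb R (CU 2)) = plane_map y"
      using comm[OF cay_closed(3), of "CU 3"] unfolding m y_def .
    then show ?thesis
      using yz by (simp add: fun_eq_iff plane_map_def p_def q_def minus_eq l_minus)
  qed
  have "f (\<ominus>\<^bsub>cay R\<^esub> cb R (CV 2)) = \<ominus>\<^bsub>cay R\<^esub> z"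
    unfolding z_def by (rule cay_linear_uminus[OF cay_Aut_linear[OF f]]) simp
  then have v3: "f (cb R (CV 3)) = r \<cdot> cb R (CU 2) \<boxplus> s \<cdot> cb R (CV 3)"
  proof -
    assume "f (\<ominus>\<^bsub>cay R\<^esub> cb R (CV 2)) = \<ominus>\<^bsub>cay R\<^esub> z"
    then have "f (cb R (CV 3)) = plane_map (\<ominus>\<^bsub>cay R\<^esub> z)"
      using comm[OF cay_uminus_closed[OF cay_closed(3)], of "CV 2"] unfolding m by simp
    then show ?thesis
      using yz by (simp add: fun_eq_iff plane_map_def r_def s_def minus_eq l_minus)
  qed
  \<comment> \<open>The pairing of u2 and v2 is 1. Computed from the images, it is the determinant,
    because \<open>r\<close> and \<open>s\<close> are coordinates of the image of v2 up to
    sign.\<close>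
  have "cay_polar R (f (cb R (CU 2))) z = cay_polar R (cb R (CU 2)) (cb R (CV 2))"
    unfolding z_def by (rule cay_Aut_polar[OF f]) simp_all
  moreover have "cay_polar R (f (cb R (CU 2))) z = p \<otimes> z (CV 2) \<oplus> q \<otimes> z (CU 3)"
    unfolding u2 using c yz by (simp add: cay_polar_eq) (simp add: cb_def m_comm)
  moreover have "cay_polar R (cb R (CU 2)) (cb R (CV 2)) = \<one>"
    using cay_polar_cb[OF cay_closed(3), of "CU 2" "CV 2"] cb_def[of R "CV 2"] by simp
  ultimately have "p \<otimes> s \<ominus> r \<otimes> q = \<one>"
    using c yz by (simp add: s_def r_def minus_eq l_minus r_minus m_comm)
  with c u2 v3 show thesis
    by (rule that)
qed

end

section \<open>Commuting with the long and with the short root element; stabilizers containing the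
  generators\<close>

context cay_alg
begin

lemma long_root_elt_apply:
  assumes y: "y \<in> \<C>"
  shows "root_elt R \<phi> (EpsDiff 2 3) \<one> y = y \<boxplus> plane_map y"
  using y by (simp add: root_elt_apply plane_map_def cay_eqI; simp add: cb_def minus_eq)

lemma long_root_commute_iff:
  assumes f: "f \<in> \<A>"
  shows "f \<bullet> root_elt R \<phi> (EpsDiff 2 3) \<one> = root_elt R \<phi> (EpsDiff 2 3) \<one> \<bullet> f
    \<longleftrightarrow> (\<forall>y\<in>\<C>. f (plane_map y) = plane_map (f y))"
  by (rule cay_Aut_commute_iff[OF f _ plane_map_closed long_root_elt_apply]) auto

text \<open>The short root element for \<open>NegEps 3\<close> at parameter 1, minus the identity.
  The summand \<open>y (CU 3)\<close> at \<open>CV 3\<close> is the quadratic term of the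
  exponential, the other terms form the derivation.\<close>

definition point_map :: "'r cay_map" where
  "point_map y = (\<lambda>c. case c of CE1 \<Rightarrow> \<ominus> y (CU 3) | CE2 \<Rightarrow> y (CU 3)
    | CU k \<Rightarrow> if k = 1 then \<ominus> y (CV 2) else if k = 2 then y (CV 1) else \<zero>
    | CV k \<Rightarrow> if k = 3 then (y CE2 \<ominus> y CE1) \<oplus> y (CU 3) else \<zero>)"

lemma point_map_closed: "y \<in> \<C> \<Longrightarrow> point_map y \<in> \<C>"
  unfolding cay_carrier_iff[of "point_map y"] all_cay_basis by (simp add: point_map_def)

lemma short_root_elt_apply:
  assumes y: "y \<in> \<C>"
  shows "root_elt R \<phi> (NegEps 3) \<one> y = y \<boxplus> point_map y"
  using y by (simp add: root_elt_apply point_map_def cay_eqI index_3_reduce a_assoc minus_eq)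

text \<open>The square of \<open>point_map\<close> sends u3 to - v3 and kills the other basis
  vectors, so \<open>f\<close> scales v3 by some \<open>c\<close>. The polar form shows that
  \<open>c\<close> is its own inverse, and comparing both sides on e2, which
  \<open>point_map\<close> sends to v3, gives c = 1.\<close>

lemma short_root_commute_imp:
  assumes f: "f \<in> \<A>"
    and comm: "f \<bullet> root_elt R \<phi> (NegEps 3) \<one> = root_elt R \<phi> (NegEps 3) \<one> \<bullet> f"
  shows "f (cb R (CV 3)) = cb R (CV 3)"
proof -
  note t = cay_mult_table[OF is_cring]
  have N: "f (point_map y) = point_map (f y)" if "y \<in> \<C>" for y
    using cay_Aut_commute_iff[OF f _ point_map_closed short_root_elt_apply] comm that by auto
  define y z w where "y = f (cb R (CU 3))" and "z = f (cb R CE2)" and "w = f (cb R (CV 3))"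
  have yzw: "y \<in> \<C>" "z \<in> \<C>" "w \<in> \<C>"
    unfolding y_def z_def w_def by (simp_all add: cay_Aut_closed[OF f])
  define c where "c = y (CU 3)"
  have c: "c \<in> carrier R"
    using yzw by (simp add: c_def)
  \<comment> \<open>In characteristic 3 the doubled coordinate appearing here equals its
    negative.\<close>
  have NN: "point_map (point_map x) = \<ominus>\<^bsub>cay R\<^esub> (x (CU 3) \<cdot> cb R (CV 3))" if x: "x \<in> \<C>" for x
  proof -
    have "x (CU 3) \<ominus> \<ominus> x (CU 3) \<oplus> \<zero> = \<ominus> x (CU 3)"
      using x char3_ring[of "x (CU 3)"] by (simp add: minus_eq)
    then show ?thesis
      using x by (simp add: cay_eqI point_map_def; simp add: cb_def)
  qed
  have "f (\<ominus>\<^bsub>cay R\<^esub> (\<one> \<cdot> cb R (CV 3))) = \<ominus>\<^bsub>cay R\<^esub> (c \<cdot> cb R (CV 3))"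
  proof -
    have "f (point_map (point_map (cb R (CU 3)))) = point_map (point_map y)"
      unfolding y_def by (simp only: N cay_closed point_map_closed)
    then show ?thesis
      unfolding NN[OF cay_closed(3)] NN[OF yzw(1)] c_def by (simp add: cb_def)
  qed
  moreover have "\<one> \<cdot> cb R (CV 3) = cb R (CV 3)"
    by (simp add: fun_eq_iff)
  ultimately have "\<ominus>\<^bsub>cay R\<^esub> w = \<ominus>\<^bsub>cay R\<^esub> (c \<cdot> cb R (CV 3))"
    unfolding w_def by (simp only: cay_linear_uminus[OF cay_Aut_linear[OF f] cay_closed(3)])
  then have "\<ominus> w b = \<ominus> (c \<otimes> cb R (CV 3) b)" for b
    using yzw c by (metis cay_closed(3,6) cay_minus_coord cay_smult_coord)
  then have w: "w = c \<cdot> cb R (CV 3)"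
    using yzw c by (metis (no_types, lifting) cay_closed(3,6) cay_coord_closed cay_smult_coord ext minus_minus)
  have polar: "cay_polar R w x = c \<otimes> x (CU 3)" if "x \<in> \<C>" for x
    unfolding w using c that by (simp add: cay_polar_eq) (simp add: cb_def m_comm)
  have wf: "cay_polar R w (f (cb R b)) = cb R b (CU 3)" for b
    unfolding w_def using cay_Aut_polar[OF f, of "cb R (CV 3)" "cb R b"] cay_polar_cb[OF cay_closed(3), of "CV 3" b]
    by simp
  \<comment> \<open>The pairing of v3 with u3 is 1, and that of their images is the square of
    \<open>c\<close>. Hence multiplication by \<open>c\<close> can be cancelled.\<close>
  have cc: "c \<otimes> c = \<one>"
    using wf[of "CU 3"] polar[OF yzw(1)] by (simp add: c_def flip: y_def) (simp add: cb_def)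
  have cancel: "r = s" if "c \<otimes> r = c \<otimes> s" "r \<in> carrier R" "s \<in> carrier R" for r s
    using that c cc by (metis l_one m_assoc)
  \<comment> \<open>The value of \<open>point_map z\<close> at \<open>CV 3\<close> involves three
    coordinates of the image \<open>z\<close> of e2. They come from the polar form and from the
    relations e2 v3 = v3 and v3 e2 = 0.\<close>
  have "c \<otimes> z (CU 3) = \<zero>"
    using wf[of CE2] polar[OF yzw(2)] by (simp flip: z_def) (simp add: cb_def)
  then have z3: "z (CU 3) = \<zero>"
    using cancel[of "z (CU 3)" \<zero>] yzw c by simp
  have "z \<boxtimes> w = w"
    using cay_Aut_mult[OF f, of "cb R CE2" "cb R (CV 3)"] t(8)[of 3] by (simp add: z_def w_def)
  then have "(z \<boxtimes> w) (CV 3) = w (CV 3)"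
    by (rule arg_cong)
  then have "c \<otimes> z CE2 = c \<otimes> \<one>"
    using yzw c by (simp add: cay_mult_coord) (simp add: w cb_def minus_eq m_comm)
  then have z2: "z CE2 = \<one>"
    using cancel yzw by simp
  have "w \<boxtimes> z = \<zero>\<^bsub>cay R\<^esub>"
    using cay_Aut_mult[OF f, of "cb R (CV 3)" "cb R CE2"] t(13)[of 3] cay_linear_zero[OF cay_Aut_linear[OF f]]
    by (simp add: z_def w_def)
  then have "(w \<boxtimes> z) (CV 3) = \<zero>\<^bsub>cay R\<^esub> (CV 3)"
    by (rule arg_cong)
  then have "c \<otimes> z CE1 = \<zero>"
    using yzw c by (simp add: cay_mult_coord) (simp add: w cb_def minus_eq m_comm)
  then have z1: "z CE1 = \<zero>"
    using cancel[of "z CE1" \<zero>] yzw c by simp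
  \<comment> \<open>With the three coordinates 1, 0 and 0 of \<open>z\<close> the equation w =
    point_map z, read at \<open>CV 3\<close>, becomes c = 1.\<close>
  have "point_map (cb R CE2) = cb R (CV 3)"
    by (simp add: cay_eqI point_map_def; simp add: cb_def minus_eq)
  then have "w = point_map z"
    unfolding w_def z_def using N[OF cay_closed(3), of CE2] by simp
  then have "w (CV 3) = point_map z (CV 3)"
    by (rule arg_cong)
  then have "c = \<one>"
    using c by (simp add: w point_map_def z1 z2 z3 minus_eq) (simp add: cb_def)
  then show ?thesis
    using w unfolding w_def by (simp add: fun_eq_iff)
qed

text \<open>The derivation is the negative commutator with v3. An automorphism fixing v3 commutes
  with it and therefore with its exponential.\<close>

lemma fix_CV3_commutes:
  assumes f: "f \<in> \<A>" and v3: "f (cb R (CV 3)) = cb R (CV 3)"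
  shows "f \<bullet> root_elt R \<phi> (NegEps 3) \<one> = root_elt R \<phi> (NegEps 3) \<one> \<bullet> f"
proof (rule cay_Aut_ext)
  fix y assume y: "y \<in> \<C>"
  note l = cay_Aut_linear[OF f] and fc = cay_Aut_closed[OF f]
  let ?d = "\<lambda>y. \<one> \<cdot> root_vector R (NegEps 3) y"
  have d: "?d x \<in> \<C>" "f (?d x) = ?d (f x)" if x: "x \<in> \<C>" for x
  proof -
    show "?d x \<in> \<C>"
      using x by (simp add: cay_ad_def)
    show "f (?d x) = ?d (f x)"
      using x fc by (simp only: root_vector.simps cay_ad_def cay_linear_smult[OF l] cay_linear_uminus[OF l]
          cay_linear_diff[OF l] cay_Aut_mult[OF f] v3 cay_closed cay_diff_closed cay_uminus_closed one_closed)
  qed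
  have half: "\<phi> (1 / 2) \<in> carrier R"
    using ring_hom_cring.homh[OF comm_alg] by (auto simp: ring_hom_def)
  have "f (cay_exp R \<phi> ?d y) = cay_exp R \<phi> ?d (f y)"
    using y fc d half by (simp only: cay_exp_def restrict_apply if_True cay_linear_add[OF l] cay_linear_smult[OF l] cay_closed)
  then show "(f \<bullet> root_elt R \<phi> (NegEps 3) \<one>) y = (root_elt R \<phi> (NegEps 3) \<one> \<bullet> f) y"
    using y f by (simp add: root_elt_def[symmetric] del: root_vector.simps)
qed (use f in auto)

text \<open>Torus points are diagonal, so every coordinate subspace will do; injectivity of
  \<open>dual\<close> handles the inverse.\<close>

lemma torus_subset_stabilizer: "torus R \<subseteq> points (stabilizer_eqns B) R \<phi>"
proof
  fix f assume "f \<in> torus R"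
  then obtain \<alpha> where f: "f \<in> \<A>" and u: "\<forall>i. \<alpha> i \<in> Units R"
    and v: "f (cb R CE1) = cb R CE1" "f (cb R CE2) = cb R CE2"
    "\<forall>i. f (cb R (CU i)) = \<alpha> i \<cdot> cb R (CU i)" "\<forall>i. f (cb R (CV i)) = inv\<^bsub>R\<^esub> \<alpha> i \<cdot> cb R (CV i)"
    unfolding torus_def by blast
  have diag: "f (cb R b) a = \<zero>" if "a \<noteq> b" for a b
    using Units_closed[OF u[THEN spec]] Units_inv_closed[OF u[THEN spec]] v that
    by (cases b; simp; simp add: cb_def)
  have "dual a \<noteq> dual b" if "a \<noteq> b" for a b
    using that by (cases a; cases b) auto
  then show "f \<in> points (stabilizer_eqns B) R \<phi>"
    unfolding points_stabilizer[OF comm_alg] cay_Aut_inv_coord[OF f] using f diag by metis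
qed

text \<open>Inverses in a root subgroup are obtained by negating the parameter, so the hypothesis
  for all parameters covers them.\<close>

lemma root_subgroup_subset_stabilizer:
  assumes \<alpha>: "valid_root \<alpha>"
    and B: "\<And>t a b. t \<in> carrier R \<Longrightarrow> b \<in> B \<Longrightarrow> a \<notin> B \<Longrightarrow> root_map R \<alpha> t (cb R b) a = \<zero>"
  shows "root_subgroup \<alpha> R \<phi> \<subseteq> points (stabilizer_eqns B) R \<phi>"
proof
  fix f assume "f \<in> root_subgroup \<alpha> R \<phi>"
  then obtain t where f: "f = root_elt R \<phi> \<alpha> t" and t: "t \<in> carrier R"
    by (auto simp: root_subgroup_def root_elt_def)
  show "f \<in> points (stabilizer_eqns B) R \<phi>"
    unfolding points_stabilizer[OF comm_alg] f root_elt_inv[OF \<alpha> t]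
    using \<alpha> t B by (simp add: root_elt_apply)
qed

text \<open>The vectors u2 and v3 have weights \<open>\<epsilon>\<^sub>2\<close> and \<open>-
  \<epsilon>\<^sub>3 = \<epsilon>\<^sub>1 + \<epsilon>\<^sub>2\<close>. Adding a positive root or
  \<open>- \<epsilon>\<^sub>1\<close> to one of them gives the other or no weight of the
  algebra.\<close>

lemma root_subgroup_subset_plane_stabilizer:
  assumes "\<alpha> \<in> insert (NegEps 1) positive_roots"
  shows "root_subgroup \<alpha> R \<phi> \<subseteq> points (stabilizer_eqns {CU 2, CV 3}) R \<phi>"
proof (rule root_subgroup_subset_stabilizer)
  show "valid_root \<alpha>"
    using assms by (auto simp: positive_roots_def)
  fix t a b assume t: "t \<in> carrier R" and b: "b \<in> {CU 2, CV 3}" and a: "a \<notin> {CU 2, CV 3}"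
  have "\<forall>a. a \<notin> {CU 2, CV 3} \<longrightarrow> root_map R \<alpha> t (cb R b) a = \<zero>"
    unfolding all_cay_basis using assms b t
    by (auto simp: positive_roots_def index_3_reduce cb_def minus_eq)
  then show "root_map R \<alpha> t (cb R b) a = \<zero>"
    using a by blast
qed

text \<open>The vector v3 has the highest weight \<open>- \<epsilon>\<^sub>3\<close>, and adding
  \<open>\<epsilon>\<^sub>1 - \<epsilon>\<^sub>2\<close> does not lead to a weight either.\<close>

lemma root_subgroup_subset_point_stabilizer:
  assumes "\<alpha> \<in> insert (EpsDiff 1 2) positive_roots"
  shows "root_subgroup \<alpha> R \<phi> \<subseteq> points (stabilizer_eqns {CV 3}) R \<phi>"
proof (rule root_subgroup_subset_stabilizer)
  show "valid_root \<alpha>"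
    using assms by (auto simp: positive_roots_def)
  fix t a b assume t: "t \<in> carrier R" and b: "b \<in> {CV 3}" and a: "a \<notin> {CV 3}"
  have "\<forall>a. a \<notin> {CV 3} \<longrightarrow> root_map R \<alpha> t (cb R b) a = \<zero>"
    unfolding all_cay_basis using assms b t
    by (auto simp: positive_roots_def index_3_reduce cb_def minus_eq)
  then show "root_map R \<alpha> t (cb R b) a = \<zero>"
    using a by blast
qed

lemma root_subgroup_subset_Aut: "valid_root \<alpha> \<Longrightarrow> root_subgroup \<alpha> R \<phi> \<subseteq> \<A>"
  by (auto simp: root_subgroup_def simp flip: root_elt_def)

lemma plane_stabilizer_commutator:
  assumes "f \<in> points (stabilizer_eqns {CU 2, CV 3}) R \<phi>" "g \<in> points (stabilizer_eqns {CU 2, CV 3}) R \<phi>"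
  defines "k \<equiv> f \<bullet> g \<bullet> Inv f \<bullet> Inv g"
  shows "k \<bullet> root_elt R \<phi> (EpsDiff 2 3) \<one> = root_elt R \<phi> (EpsDiff 2 3) \<one> \<bullet> k"
proof -
  let ?B = "{CU 2, CV 3}"
  have fg: "f \<in> \<A>" "g \<in> \<A>"
    using assms by (simp_all add: points_def)
  have semi: "\<exists>d\<in>carrier R. \<forall>x\<in>\<C>. h (plane_map x) = d \<cdot> plane_map (h x)"
    if h: "h \<in> \<A>" "\<And>a b. b \<in> ?B \<Longrightarrow> a \<notin> ?B \<Longrightarrow> h (cb R b) a = \<zero>" for h
  proof -
    note hc = cay_Aut_closed[OF h(1) cay_closed(3)]
    have e: "h (cb R b) = h (cb R b) (CU 2) \<cdot> cb R (CU 2) \<boxplus> h (cb R b) (CV 3) \<cdot> cb R (CV 3)"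
      if "b \<in> ?B" for b
      using h(2)[OF that] hc[of b] by (auto simp: fun_eq_iff cb_def)
    show ?thesis
      using plane_map_semi_invariant[OF h(1) _ _ _ _ e[of "CU 2"] e[of "CV 3"]] hc
      by (intro bexI[of _ "h (cb R (CU 2)) (CU 2) \<otimes> h (cb R (CV 3)) (CV 3)
          \<ominus> h (cb R (CV 3)) (CU 2) \<otimes> h (cb R (CU 2)) (CV 3)"]) auto
  qed
  have "\<forall>x\<in>\<C>. k (plane_map x) = plane_map (k x)"
    unfolding k_def
  proof (intro ballI commutator_invariant[OF fg plane_map_closed])
    fix h assume "h \<in> {f, g, Inv f, Inv g}"
    then show "\<exists>d\<in>carrier R. \<forall>x\<in>\<C>. h (plane_map x) = d \<cdot> plane_map (h x)"
      using assms(1,2) fg unfolding points_stabilizer[OF comm_alg] by (intro semi) auto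
  qed
  moreover have "k \<in> \<A>"
    unfolding k_def using fg by simp
  ultimately show ?thesis
    using long_root_commute_iff by blast
qed

text \<open>\<open>commutator_invariant\<close> is applied to the constant map with value v3. It
  would not fit \<open>point_map\<close>, whose linear and quadratic parts are scaled by different
  powers of the character.\<close>

lemma point_stabilizer_commutator:
  assumes "f \<in> points (stabilizer_eqns {CV 3}) R \<phi>" "g \<in> points (stabilizer_eqns {CV 3}) R \<phi>"
  defines "k \<equiv> f \<bullet> g \<bullet> Inv f \<bullet> Inv g"
  shows "k \<bullet> root_elt R \<phi> (NegEps 3) \<one> = root_elt R \<phi> (NegEps 3) \<one> \<bullet> k"
proof -
  have fg: "f \<in> \<A>" "g \<in> \<A>"
    using assms by (simp_all add: points_def)
  have semi: "\<exists>d\<in>carrier R. \<forall>x\<in>\<C>. h (cb R (CV 3)) = d \<cdot> cb R (CV 3)"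
    if h: "h \<in> \<A>" "\<And>a. a \<noteq> CV 3 \<Longrightarrow> h (cb R (CV 3)) a = \<zero>" for h
  proof -
    note hc = cay_Aut_closed[OF h(1) cay_closed(3), of "CV 3"]
    have "h (cb R (CV 3)) = h (cb R (CV 3)) (CV 3) \<cdot> cb R (CV 3)"
      using h(2) hc by (auto simp: fun_eq_iff cb_def)
    then show ?thesis
      using hc by (intro bexI[of _ "h (cb R (CV 3)) (CV 3)"]) auto
  qed
  have "k (cb R (CV 3)) = cb R (CV 3)"
    unfolding k_def
  proof (rule commutator_invariant[OF fg, of "\<lambda>_. cb R (CV 3)" "\<zero>\<^bsub>cay R\<^esub>"])
    fix h assume "h \<in> {f, g, Inv f, Inv g}"
    then show "\<exists>d\<in>carrier R. \<forall>x\<in>\<C>. h (cb R (CV 3)) = d \<cdot> cb R (CV 3)"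
      using assms(1,2) fg unfolding points_stabilizer[OF comm_alg] by (intro semi) auto
  qed auto
  moreover have "k \<in> \<A>"
    unfolding k_def using fg by simp
  ultimately show ?thesis
    using fix_CV3_commutes by blast
qed

end

section \<open>The centralizers\<close>

lemma cay_algI: "comm_alg R (\<phi> :: 'f::field \<Rightarrow> 'r) \<Longrightarrow> CHAR('f) = 3 \<Longrightarrow> cay_alg R \<phi>"
  by (intro cay_alg.intro cay_alg_axioms.intro cay_ring.intro) (auto dest: ring_hom_cring.axioms)

lemma generated_subset:
  fixes S :: "'f test ring \<Rightarrow> ('f::field \<Rightarrow> 'f test) \<Rightarrow> 'f test cay_map set"
  assumes "closed_subgroup I" "\<And>R \<phi>. comm_alg R \<phi> \<Longrightarrow> S R \<phi> \<subseteq> points I R \<phi>"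
  shows "points (generated S) R \<phi> \<subseteq> points I R \<phi>"
  using assms by (auto simp: points_generated)

lemma subset_generated:
  fixes S :: "'f test ring \<Rightarrow> ('f::field \<Rightarrow> 'f test) \<Rightarrow> 'f test cay_map set"
  assumes "comm_alg R \<phi>" "S R \<phi> \<subseteq> carrier (cay_Aut R)"
  shows "S R \<phi> \<subseteq> points (generated S) R \<phi>"
proof
  fix f assume f: "f \<in> S R \<phi>"
  then have "f \<in> carrier (cay_Aut R)"
    using assms(2) by (rule rev_subsetD)
  moreover have "f \<in> points I R \<phi>"
    if I: "closed_subgroup I \<and> (\<forall>R \<phi>. comm_alg R \<phi> \<longrightarrow> S R \<phi> \<subseteq> points I R \<phi>)" for I
  proof -
    have "S R \<phi> \<subseteq> points I R \<phi>"
      using conjunct2[OF I, rule_format, OF assms(1)] .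
    then show ?thesis
      using f by (rule subsetD)
  qed
  ultimately show "f \<in> points (generated S) R \<phi>"
    unfolding points_generated by blast
qed

lemma parabolic_generators:
  fixes T :: "'f::field test ring" and \<psi> :: "'f \<Rightarrow> 'f test"
  assumes T: "cay_alg T \<psi>" and \<gamma>: "valid_root (neg_root \<gamma>)"
  shows "torus T \<subseteq> points (parabolic \<gamma>) T \<psi>"
    "\<And>\<alpha>. \<alpha> \<in> insert (neg_root \<gamma>) positive_roots \<Longrightarrow> root_subgroup \<alpha> T \<psi> \<subseteq> points (parabolic \<gamma>) T \<psi>"
proof -
  interpret T: cay_alg T \<psi> by (rule T)
  have "torus T \<union> root_subgroup (neg_root \<gamma>) T \<psi> \<union> (\<Union>\<alpha>\<in>positive_roots. root_subgroup \<alpha> T \<psi>)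
      \<subseteq> points (parabolic \<gamma>) T \<psi>"
    unfolding parabolic_def
  proof (rule subset_generated[OF T.comm_alg])
    show "torus T \<union> root_subgroup (neg_root \<gamma>) T \<psi> \<union> (\<Union>\<alpha>\<in>positive_roots. root_subgroup \<alpha> T \<psi>)
        \<subseteq> carrier (cay_Aut T)"
      using T.root_subgroup_subset_Aut[OF \<gamma>] T.root_subgroup_subset_Aut T.positive_roots_valid
      by (auto simp: torus_def)
  qed
  then show "torus T \<subseteq> points (parabolic \<gamma>) T \<psi>"
    "\<And>\<alpha>. \<alpha> \<in> insert (neg_root \<gamma>) positive_roots \<Longrightarrow> root_subgroup \<alpha> T \<psi> \<subseteq> points (parabolic \<gamma>) T \<psi>"
    by auto
qed

text \<open>The common frame of both cases. \<open>stab\<close> and \<open>comm\<close> give one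
  inclusion because the stabilizer and the centralizer are closed subgroups, so that it suffices to
  look at generators. For the other one, \<open>pts\<close> is applied to an arbitrary closed
  subgroup that contains all commutators.\<close>

lemma centralizer_eq_derived_parabolic:
  fixes \<tau> :: "'f::field cay_map" and R :: "'r ring" and \<gamma> :: root
  assumes char3: "CHAR('f) = 3" and \<gamma>: "valid_root (neg_root \<gamma>)"
    and \<tau>: "\<tau> \<in> carrier (cay_Aut base_ring)"
    and stab: "\<And>(T :: 'f test ring) (\<psi> :: 'f \<Rightarrow> 'f test) \<alpha>. cay_alg T \<psi> \<Longrightarrow> \<alpha> \<in> insert (neg_root \<gamma>) positive_roots \<Longrightarrow>
      root_subgroup \<alpha> T \<psi> \<subseteq> points (stabilizer_eqns B) T \<psi>"
    and comm: "\<And>(T :: 'f test ring) \<psi> f g. cay_alg T \<psi> \<Longrightarrow>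
      f \<in> points (stabilizer_eqns B) T \<psi> \<Longrightarrow> g \<in> points (stabilizer_eqns B) T \<psi> \<Longrightarrow>
      f \<bullet>\<^bsub>T\<^esub> g \<bullet>\<^bsub>T\<^esub> Inv\<^bsub>T\<^esub> f \<bullet>\<^bsub>T\<^esub> Inv\<^bsub>T\<^esub> g \<in> centralizer_points \<tau> T \<psi>"
    and pts: "\<And>(I :: 'f cay_eqns) f. f \<in> centralizer_points \<tau> R \<phi> \<Longrightarrow>
      (\<And>(L :: (nat \<Rightarrow> 'r) set ring) h. cay_hom R L h \<Longrightarrow>
        words (insert (neg_root \<gamma>) positive_roots) L (h \<circ> \<phi>) \<subseteq> points I L (h \<circ> \<phi>)) \<Longrightarrow> f \<in> points I R \<phi>"
    and \<phi>: "comm_alg R \<phi>"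
  shows "centralizer_points \<tau> R \<phi> = points (derived_subgroup (parabolic \<gamma>)) R \<phi>"
proof
  interpret R: cay_alg R \<phi>
    by (rule cay_algI[OF \<phi> char3])
  have valid: "insert (neg_root \<gamma>) positive_roots \<subseteq> Collect valid_root"
    using \<gamma> R.positive_roots_valid by simp
  show "points (derived_subgroup (parabolic \<gamma>)) R \<phi> \<subseteq> centralizer_points \<tau> R \<phi>"
    unfolding points_centralizer_eqns(2)[OF \<tau> \<phi>, symmetric] derived_subgroup_def
  proof (rule generated_subset[OF closed_subgroup_centralizer[OF \<tau>]])
    fix T :: "'f test ring" and \<psi> :: "'f \<Rightarrow> 'f test"
    assume \<psi>: "comm_alg T \<psi>"
    interpret T: cay_alg T \<psi>
      by (rule cay_algI[OF \<psi> char3])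
    \<comment> \<open>The parabolic subgroup lies in the stabilizer because its generators
      do.\<close>
    have "points (parabolic \<gamma>) T \<psi> \<subseteq> points (stabilizer_eqns B) T \<psi>"
      unfolding parabolic_def
    proof (rule generated_subset[OF closed_subgroup_stabilizer])
      fix T :: "'f test ring" and \<psi> :: "'f \<Rightarrow> 'f test"
      assume "comm_alg T \<psi>"
      then have T: "cay_alg T \<psi>"
        by (rule cay_algI[OF _ char3])
      show "torus T \<union> root_subgroup (neg_root \<gamma>) T \<psi> \<union> (\<Union>\<alpha>\<in>positive_roots. root_subgroup \<alpha> T \<psi>)
          \<subseteq> points (stabilizer_eqns B) T \<psi>"
        using cay_alg.torus_subset_stabilizer[OF T] stab[OF T] by blast
    qed
    then show "{f \<bullet>\<^bsub>T\<^esub> g \<bullet>\<^bsub>T\<^esub> Inv\<^bsub>T\<^esub> f \<bullet>\<^bsub>T\<^esub> Inv\<^bsub>T\<^esub> g | f g.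
        f \<in> points (parabolic \<gamma>) T \<psi> \<and> g \<in> points (parabolic \<gamma>) T \<psi>} \<subseteq> points (centralizer_eqns \<tau>) T \<psi>"
      unfolding points_centralizer_eqns(2)[OF \<tau> \<psi>] using comm[OF T.cay_alg_axioms] by blast
  qed
  show "centralizer_points \<tau> R \<phi> \<subseteq> points (derived_subgroup (parabolic \<gamma>)) R \<phi>"
  proof
    fix f assume f: "f \<in> centralizer_points \<tau> R \<phi>"
    show "f \<in> points (derived_subgroup (parabolic \<gamma>)) R \<phi>"
      unfolding derived_subgroup_def points_generated
    proof (intro conjI allI impI)
      show "f \<in> carrier (cay_Aut R)"
        using f by (simp add: centralizer_points_def)
      fix I :: "'f cay_eqns"
      assume I: "closed_subgroup I \<and> (\<forall>(T :: 'f test ring) \<psi>. comm_alg T \<psi> \<longrightarrow>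
        {f \<bullet>\<^bsub>T\<^esub> g \<bullet>\<^bsub>T\<^esub> Inv\<^bsub>T\<^esub> f \<bullet>\<^bsub>T\<^esub> Inv\<^bsub>T\<^esub> g | f g.
          f \<in> points (parabolic \<gamma>) T \<psi> \<and> g \<in> points (parabolic \<gamma>) T \<psi>} \<subseteq> points I T \<psi>)"
      show "f \<in> points I R \<phi>"
      proof (rule pts[OF f])
        fix L :: "(nat \<Rightarrow> 'r) set ring" and h
        assume "cay_hom R L h"
        then interpret L: cay_alg L "h \<circ> \<phi>"
          by (rule R.push_cay_alg)
        show "words (insert (neg_root \<gamma>) positive_roots) L (h \<circ> \<phi>) \<subseteq> points I L (h \<circ> \<phi>)"
        proof (rule L.words_subset_points[OF valid conjunct1[OF I]])
          fix T :: "'f test ring" and \<psi> :: "'f \<Rightarrow> 'f test" and \<alpha>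
          assume \<psi>: "comm_alg T \<psi>" and \<alpha>: "\<alpha> \<in> insert (neg_root \<gamma>) positive_roots"
          interpret T: cay_alg T \<psi>
            by (rule cay_algI[OF \<psi> char3])
          note gen = parabolic_generators[OF T.cay_alg_axioms \<gamma>]
          show "root_subgroup \<alpha> T \<psi> \<subseteq> points I T \<psi>"
          proof
            fix x assume x: "x \<in> root_subgroup \<alpha> T \<psi>"
            then obtain t where t: "x = root_elt T \<psi> \<alpha> t" "t \<in> carrier T"
              by (auto simp: root_subgroup_def root_elt_def)
            have "valid_root \<alpha>"
              using \<alpha> valid by blast
            then obtain s where s: "s \<in> torus T"
              "s \<bullet>\<^bsub>T\<^esub> x \<bullet>\<^bsub>T\<^esub> Inv\<^bsub>T\<^esub> s \<bullet>\<^bsub>T\<^esub> Inv\<^bsub>T\<^esub> x = x"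
              unfolding t(1) using T.root_elt_commutator t(2) by blast
            have "s \<in> points (parabolic \<gamma>) T \<psi>" "x \<in> points (parabolic \<gamma>) T \<psi>"
              using gen(1) gen(2)[OF \<alpha>] s(1) x by auto
            then have "s \<bullet>\<^bsub>T\<^esub> x \<bullet>\<^bsub>T\<^esub> Inv\<^bsub>T\<^esub> s \<bullet>\<^bsub>T\<^esub> Inv\<^bsub>T\<^esub> x \<in> points I T \<psi>"
              using conjunct2[OF I] \<psi> by blast
            then show "x \<in> points I T \<psi>"
              unfolding s(2) .
          qed
        qed
      qed
    qed
  qed
qed

lemma comm_alg_base: "comm_alg (base_ring :: 'f::field ring) id"
  by (intro ring_hom_cring.intro ring_hom_cring_axioms.intro cring_from_type_algebra) simp_all

lemma cay_extend_root_elt: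
  assumes "CHAR('f::field) = 3" "valid_root \<alpha>" and \<phi>: "comm_alg R (\<phi> :: 'f \<Rightarrow> 'r)"
  shows "cay_extend R \<phi> (root_elt base_ring (id :: 'f \<Rightarrow> 'f) \<alpha> 1) = root_elt R \<phi> \<alpha> \<one>\<^bsub>R\<^esub>"
proof -
  interpret R: cay_alg R \<phi>
    by (rule cay_algI[OF \<phi> assms(1)])
  have "base_change base_ring R \<phi> (root_elt base_ring (id :: 'f \<Rightarrow> 'f) \<alpha> 1) = root_elt R \<phi> \<alpha> (\<phi> 1)"
    by (rule R.root_elt_base_change)
      (use assms cay_algI[OF comm_alg_base assms(1)] in \<open>simp_all add: cay_hom_def\<close>)
  moreover have "\<phi> 1 = \<one>\<^bsub>R\<^esub>"
    using ring_hom_one[OF ring_hom_cring.homh[OF \<phi>]] by simp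
  ultimately show ?thesis
    by (simp add: cay_extend_def base_change_def)
qed

lemma centralizer_root_elt:
  assumes "CHAR('f::field) = 3" "valid_root \<alpha>" "comm_alg R (\<phi> :: 'f \<Rightarrow> 'r)"
  shows "f \<in> centralizer_points (root_elt base_ring (id :: 'f \<Rightarrow> 'f) \<alpha> 1) R \<phi> \<longleftrightarrow> f \<in> carrier (cay_Aut R) \<and>
    f \<bullet>\<^bsub>R\<^esub> root_elt R \<phi> \<alpha> \<one>\<^bsub>R\<^esub> = root_elt R \<phi> \<alpha> \<one>\<^bsub>R\<^esub> \<bullet>\<^bsub>R\<^esub> f"
  unfolding centralizer_points_def cay_extend_root_elt[OF assms] by simp

text \<open>The cube is the root element with parameter 3 = 0, so the order divides the prime 3; a
  moved vector excludes order 1.\<close>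

lemma root_elt_ord:
  assumes char3: "CHAR('f::field) = 3" and \<alpha>: "valid_root \<alpha>"
    and neq: "root_elt base_ring (id :: 'f \<Rightarrow> 'f) \<alpha> 1 x \<noteq> x"
  shows "group.ord (cay_Aut base_ring) (root_elt base_ring (id :: 'f \<Rightarrow> 'f) \<alpha> 1) = 3"
proof -
  interpret B: cay_alg "base_ring :: 'f ring" id
    by (rule cay_algI[OF comm_alg_base char3])
  let ?x = "root_elt base_ring (id :: 'f \<Rightarrow> 'f) \<alpha>"
  have x: "?x t \<in> carrier (cay_Aut base_ring)" for t
    using \<alpha> by simp
  have "?x 1 [^]\<^bsub>cay_Aut base_ring\<^esub> (3 :: nat) = ?x (1 + 1 + 1)"
    using \<alpha> x by (simp add: numeral_3_eq_3 B.root_elt_mult)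
  also have "(1 + 1 + 1 :: 'f) = 0"
    using B.char3_base(1) by simp
  also have "?x 0 = \<one>\<^bsub>cay_Aut base_ring\<^esub>"
    using B.root_elt_zero[OF \<alpha>] by simp
  finally have "B.A.ord (?x 1) dvd 3"
    using B.A.pow_eq_id[OF x] by blast
  moreover have "B.A.ord (?x 1) \<noteq> 1"
    using B.A.ord_eq_1[OF x] neq by auto
  moreover have "prime (3 :: nat)"
    by simp
  ultimately show ?thesis
    unfolding prime_nat_iff by blast
qed

theorem theorem7p1:
  assumes char3: "CHAR('f::field) = 3"
  shows
    "(\<exists>\<tau> :: 'f cay_map.
        {\<sigma> \<in> carrier (cay_Aut base_ring).
           \<sigma> (cb base_ring (CU 1)) = cb base_ring (CU 1) \<and>
           \<sigma> (cb base_ring (CU 2)) = cb base_ring (CU 2) \<and>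
           \<sigma> (cb base_ring (CU 3)) = cb base_ring (CU 3) \<oplus>\<^bsub>cay base_ring\<^esub> cb base_ring (CU 2)} = {\<tau>} \<and>
        group.ord (cay_Aut base_ring) \<tau> = 3 \<and>
        (\<forall>(R :: 'r ring) \<phi>. comm_alg R \<phi> \<longrightarrow>
           centralizer_points \<tau> R \<phi> = points (derived_subgroup (parabolic (PosEps 1))) R \<phi>))
     \<and>
     (\<exists>\<tau> :: 'f cay_map.
        {\<sigma> \<in> carrier (cay_Aut base_ring).
           \<sigma> (cb base_ring (CU 1)) = cb base_ring (CU 1) \<and>
           \<sigma> (cb base_ring (CU 2)) = cb base_ring (CU 2) \<and>
           \<sigma> (cb base_ring (CU 3)) =
             (cb base_ring (CU 3) \<oplus>\<^bsub>cay base_ring\<^esub> cb base_ring (CV 3))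
               \<ominus>\<^bsub>cay base_ring\<^esub> (cb base_ring CE1 \<ominus>\<^bsub>cay base_ring\<^esub> cb base_ring CE2)} = {\<tau>} \<and>
        group.ord (cay_Aut base_ring) \<tau> = 3 \<and>
        (\<forall>(R :: 'r ring) \<phi>. comm_alg R \<phi> \<longrightarrow>
           centralizer_points \<tau> R \<phi> = points (derived_subgroup (parabolic (EpsDiff 2 1))) R \<phi>))"
proof -
  interpret B: cay_alg "base_ring :: 'f ring" id
    by (rule cay_algI[OF comm_alg_base char3])
  let ?e = "cb (base_ring :: 'f ring)"
  \<comment> \<open>An automorphism is determined by its values on the u vectors, so exhibiting one
    solution suffices.\<close>
  have unique: "{\<sigma> \<in> carrier (cay_Aut base_ring). \<sigma> (?e (CU 1)) = ?e (CU 1) \<and> \<sigma> (?e (CU 2)) = ?e (CU 2) \<and>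
      \<sigma> (?e (CU 3)) = z} = {\<tau>}"
    if "\<tau> \<in> carrier (cay_Aut base_ring)" "\<tau> (?e (CU 1)) = ?e (CU 1)" "\<tau> (?e (CU 2)) = ?e (CU 2)" "\<tau> (?e (CU 3)) = z"
    for \<tau> z
  proof -
    have "\<sigma> = \<tau>" if "\<sigma> \<in> carrier (cay_Aut base_ring)" "\<sigma> (?e (CU 1)) = ?e (CU 1)" "\<sigma> (?e (CU 2)) = ?e (CU 2)"
        "\<sigma> (?e (CU 3)) = z" for \<sigma>
    proof (rule B.cay_Aut_eq_on_CU)
      show "\<sigma> (?e (CU i)) = \<tau> (?e (CU i))" for i
        using index_3_cases[of i] that \<open>\<tau> (?e (CU 1)) = _\<close> \<open>\<tau> (?e (CU 2)) = _\<close> \<open>\<tau> (?e (CU 3)) = _\<close> by auto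
    qed fact+
    then show ?thesis
      using that by blast
  qed
  let ?\<tau> = "\<lambda>\<alpha>. root_elt base_ring (id :: 'f \<Rightarrow> 'f) \<alpha> 1"
  have \<tau>: "?\<tau> \<alpha> \<in> carrier (cay_Aut base_ring)" if "valid_root \<alpha>" for \<alpha>
    using that by simp
  have \<tau>_cb: "?\<tau> \<alpha> (?e b) = root_map base_ring \<alpha> 1 (?e b)" if "valid_root \<alpha>" for \<alpha> b
    using that by (simp add: B.root_elt_apply)
  show ?thesis
  proof (rule conjI, goal_cases)
    case 1
    \<comment> \<open>The long root element that adds u2 to u3 and fixes u1 and u2.\<close>
    let ?\<alpha> = "EpsDiff 2 3"
    have u: "?\<tau> ?\<alpha> (?e (CU 1)) = ?e (CU 1)" "?\<tau> ?\<alpha> (?e (CU 2)) = ?e (CU 2)"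
      "?\<tau> ?\<alpha> (?e (CU 3)) = ?e (CU 3) \<oplus>\<^bsub>cay base_ring\<^esub> ?e (CU 2)"
      by (simp_all add: \<tau>_cb B.cay_eqI; simp add: cb_def)+
    show ?case
    proof (intro exI[of _ "?\<tau> ?\<alpha>"] conjI allI impI)
      show "{\<sigma> \<in> carrier (cay_Aut base_ring). \<sigma> (?e (CU 1)) = ?e (CU 1) \<and> \<sigma> (?e (CU 2)) = ?e (CU 2) \<and>
          \<sigma> (?e (CU 3)) = ?e (CU 3) \<oplus>\<^bsub>cay base_ring\<^esub> ?e (CU 2)} = {?\<tau> ?\<alpha>}"
        by (rule unique[OF \<tau> u]) simp
      have "?\<tau> ?\<alpha> (?e (CU 3)) (CU 2) \<noteq> ?e (CU 3) (CU 2)"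
        unfolding u by (simp add: cb_def)
      then show "group.ord (cay_Aut base_ring) (?\<tau> ?\<alpha>) = 3"
        by (intro root_elt_ord[OF char3, of _ "?e (CU 3)"]) auto
      fix R :: "'r ring" and \<phi> :: "'f \<Rightarrow> 'r"
      assume \<phi>: "comm_alg R \<phi>"
      interpret R: cay_alg R \<phi>
        by (rule cay_algI[OF \<phi> char3])
      show "centralizer_points (?\<tau> ?\<alpha>) R \<phi> = points (derived_subgroup (parabolic (PosEps 1))) R \<phi>"
      proof (rule centralizer_eq_derived_parabolic[where B = "{CU 2, CV 3}", OF char3 _ \<tau> _ _ _ \<phi>])
        fix T :: "'f test ring" and \<psi> :: "'f \<Rightarrow> 'f test"
        assume T: "cay_alg T \<psi>"
        interpret T: cay_alg T \<psi> by (rule T)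
        show "\<alpha> \<in> insert (neg_root (PosEps 1)) positive_roots \<Longrightarrow>
            root_subgroup \<alpha> T \<psi> \<subseteq> points (stabilizer_eqns {CU 2, CV 3}) T \<psi>" for \<alpha>
          using T.root_subgroup_subset_plane_stabilizer by simp
        fix f g assume fg: "f \<in> points (stabilizer_eqns {CU 2, CV 3}) T \<psi>"
          "g \<in> points (stabilizer_eqns {CU 2, CV 3}) T \<psi>"
        then have "f \<in> carrier (cay_Aut T)" "g \<in> carrier (cay_Aut T)"
          by (simp_all add: points_def)
        then show "f \<bullet>\<^bsub>T\<^esub> g \<bullet>\<^bsub>T\<^esub> Inv\<^bsub>T\<^esub> f \<bullet>\<^bsub>T\<^esub> Inv\<^bsub>T\<^esub> g
            \<in> centralizer_points (?\<tau> ?\<alpha>) T \<psi>"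
          using T.plane_stabilizer_commutator[OF fg] by (simp add: centralizer_root_elt char3 T.comm_alg)
      next
        fix I :: "'f cay_eqns" and f
        assume "f \<in> centralizer_points (?\<tau> ?\<alpha>) R \<phi>"
        then have f: "f \<in> carrier (cay_Aut R)" "\<And>y. y \<in> carrier (cay R) \<Longrightarrow> f (R.plane_map y) = R.plane_map (f y)"
          using R.long_root_commute_iff[of f] by (auto simp: centralizer_root_elt char3 \<phi>)
        assume words: "\<And>(L :: (nat \<Rightarrow> 'r) set ring) h. cay_hom R L h \<Longrightarrow>
          words (insert (neg_root (PosEps 1)) positive_roots) L (h \<circ> \<phi>) \<subseteq> points I L (h \<circ> \<phi>)"
        obtain p q r s where "p \<in> carrier R" "q \<in> carrier R" "r \<in> carrier R" "s \<in> carrier R"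
          "f (cb R (CU 2)) = p \<cdot>\<^bsub>R\<^esub> cb R (CU 2) \<boxplus>\<^bsub>R\<^esub> q \<cdot>\<^bsub>R\<^esub> cb R (CV 3)"
          "f (cb R (CV 3)) = r \<cdot>\<^bsub>R\<^esub> cb R (CU 2) \<boxplus>\<^bsub>R\<^esub> s \<cdot>\<^bsub>R\<^esub> cb R (CV 3)"
          "p \<otimes>\<^bsub>R\<^esub> s \<ominus>\<^bsub>R\<^esub> r \<otimes>\<^bsub>R\<^esub> q = \<one>\<^bsub>R\<^esub>"
          by (rule R.plane_map_commute_imp[OF f])
        then show "f \<in> points I R \<phi>"
          by (rule R.plane_stabilizer_in_points[OF f(1)]) (use words in simp)
      qed simp_all
    qed
  next
    case 2
    \<comment> \<open>The short root element: on u3 the linear term of the exponential is e2 - e1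
      and the quadratic one is v3.\<close>
    let ?\<alpha> = "NegEps 3"
    let ?z = "(?e (CU 3) \<oplus>\<^bsub>cay base_ring\<^esub> ?e (CV 3)) \<ominus>\<^bsub>cay base_ring\<^esub> (?e CE1 \<ominus>\<^bsub>cay base_ring\<^esub> ?e CE2)"
    have u: "?\<tau> ?\<alpha> (?e (CU 1)) = ?e (CU 1)" "?\<tau> ?\<alpha> (?e (CU 2)) = ?e (CU 2)"
      "?\<tau> ?\<alpha> (?e (CU 3)) = ?z"
      by (simp_all add: \<tau>_cb B.cay_eqI index_3_reduce; simp add: cb_def)+
    show ?case
    proof (intro exI[of _ "?\<tau> ?\<alpha>"] conjI allI impI)
      show "{\<sigma> \<in> carrier (cay_Aut base_ring). \<sigma> (?e (CU 1)) = ?e (CU 1) \<and> \<sigma> (?e (CU 2)) = ?e (CU 2) \<and>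
          \<sigma> (?e (CU 3)) = ?z} = {?\<tau> ?\<alpha>}"
        by (rule unique[OF \<tau> u]) simp
      have "?\<tau> ?\<alpha> (?e (CU 3)) (CV 3) \<noteq> ?e (CU 3) (CV 3)"
        unfolding u by (simp; simp add: cb_def)
      then show "group.ord (cay_Aut base_ring) (?\<tau> ?\<alpha>) = 3"
        by (intro root_elt_ord[OF char3, of _ "?e (CU 3)"]) auto
      fix R :: "'r ring" and \<phi> :: "'f \<Rightarrow> 'r"
      assume \<phi>: "comm_alg R \<phi>"
      interpret R: cay_alg R \<phi>
        by (rule cay_algI[OF \<phi> char3])
      show "centralizer_points (?\<tau> ?\<alpha>) R \<phi> = points (derived_subgroup (parabolic (EpsDiff 2 1))) R \<phi>"
      proof (rule centralizer_eq_derived_parabolic[where B = "{CV 3}", OF char3 _ \<tau> _ _ _ \<phi>])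
        fix T :: "'f test ring" and \<psi> :: "'f \<Rightarrow> 'f test"
        assume T: "cay_alg T \<psi>"
        interpret T: cay_alg T \<psi> by (rule T)
        show "\<alpha> \<in> insert (neg_root (EpsDiff 2 1)) positive_roots \<Longrightarrow>
            root_subgroup \<alpha> T \<psi> \<subseteq> points (stabilizer_eqns {CV 3}) T \<psi>" for \<alpha>
          using T.root_subgroup_subset_point_stabilizer by simp
        fix f g assume fg: "f \<in> points (stabilizer_eqns {CV 3}) T \<psi>" "g \<in> points (stabilizer_eqns {CV 3}) T \<psi>"
        then have "f \<in> carrier (cay_Aut T)" "g \<in> carrier (cay_Aut T)"
          by (simp_all add: points_def)
        then show "f \<bullet>\<^bsub>T\<^esub> g \<bullet>\<^bsub>T\<^esub> Inv\<^bsub>T\<^esub> f \<bullet>\<^bsub>T\<^esub> Inv\<^bsub>T\<^esub> g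
            \<in> centralizer_points (?\<tau> ?\<alpha>) T \<psi>"
          using T.point_stabilizer_commutator[OF fg] by (simp add: centralizer_root_elt char3 T.comm_alg)
      next
        fix I :: "'f cay_eqns" and f
        assume "f \<in> centralizer_points (?\<tau> ?\<alpha>) R \<phi>"
        then have f: "f \<in> carrier (cay_Aut R)" "f (cb R (CV 3)) = cb R (CV 3)"
          using R.short_root_commute_imp[of f] by (auto simp: centralizer_root_elt char3 \<phi>)
        assume words: "\<And>(L :: (nat \<Rightarrow> 'r) set ring) h. cay_hom R L h \<Longrightarrow>
          words (insert (neg_root (EpsDiff 2 1)) positive_roots) L (h \<circ> \<phi>) \<subseteq> points I L (h \<circ> \<phi>)"
        from f show "f \<in> points I R \<phi>"
          by (rule R.fix_CV3_in_points) (use words in simp)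
      qed simp_all
    qed
  qed
qed

end
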